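(* Let $V\subseteq L^2(\mathbb{R}^d)$ be a shift-invariant space with range function $J$ such that $\dim J(\omega)<\infty$ for a.e. $\omega\in[0,1)^d$, and let $L:V\to V$ be a shift-preserving operator with associated range operator $R$. Then: (i) If $L$ is invertible, then $L^{-1}$ is also shift preserving. (ii) $L$ is invertible if and only if $R(\omega)$ is invertible for a.e. $\omega\in[0,1)^d$ and there exists a constant $C>0$ such that $R(\omega)$ is uniformly bounded from below by $C$ (i.e. for a.e. $\omega\in[0,1)^d$, $\|R(\omega)a\|\ge C\|a\|$ for all $a\in J(\omega)$). In that case, if $R^{-1}$ denotes the range operator associated to $L^{-1}$, then $(R(\omega))^{-1}=R^{-1}(\omega)$ for a.e. $\omega\in[0,1)^d$.
   Context: For $k\in\mathbb{Z}^d$, $T_kf(x)=f(x-k)$. A closed subspace $V\subseteq L^2(\mathbb{R}^d)$ is shift invariant if $T_kf\in V$ for all $f\in V$, $k\in\mathbb{Z}^d$. Let $\hat f(\omega)=\int f(x)e^{-2\pi i\langle\omega,x\rangle}dx$, and let $\mathcal{T}:L^2(\mathbb{R}^d)\to L^2([0,1)^d,\ell^2(\mathbb{Z}^d))$ be the isometric isomorphism $\mathcal{T}f(\omega)=\{\hat f(\omega+k)\}_{k\in\mathbb{Z}^d}$. A range function is a map $J$ from $[0,1)^d$ to the closed subspaces of $\ell^2(\mathbb{Z}^d)$; it is measurable if $\omega\mapsto\langle P_{J(\omega)}u,v\rangle$ is measurable for all $u,v\in\ell^2(\mathbb{Z}^d)$ ($P_S$ is the orthogonal projection onto $S$). Each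 shift-invariant $V$ has a measurable range function $J=J_V$, unique up to null sets, with $f\in V$ iff $\mathcal{T}f(\omega)\in J(\omega)$ for a.e. $\omega$. An operator $L:V\to V$ is shift preserving if it is bounded, linear and $LT_k=T_kL$ for all $k\in\mathbb{Z}^d$. Its range operator $R$ is the (a.e. unique) measurable field of bounded operators $R(\omega):J(\omega)\to J(\omega)$ with $\mathcal{T}(Lf)(\omega)=R(\omega)(\mathcal{T}f(\omega))$ for a.e. $\omega$ and all $f\in V$; measurable means $\omega\mapsto\langle R(\omega)P_{J(\omega)}u,v\rangle$ is measurable for all $u,v\in\ell^2(\mathbb{Z}^d)$. *)

theory Defs
  imports "HOL-Analysis.Analysis"
begin

section \<open>Complex inner product spaces\<close>

text \<open>
  The complex structure sits on top of the library class \<open>real_inner\<close>, whose real inner product is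
  the real part of the complex one; norm, topology and \<open>closed\<close> are the library's.
  The complex inner product is linear in the first argument.
\<close>

class complex_inner = real_inner +
  fixes scaleC :: "complex \<Rightarrow> 'a \<Rightarrow> 'a"  (infixr "*\<^sub>C" 75)
    and cinner :: "'a \<Rightarrow> 'a \<Rightarrow> complex"
  assumes scaleC_add_right: "c *\<^sub>C (x + y) = c *\<^sub>C x + c *\<^sub>C y"
    and scaleC_add_left: "(b + c) *\<^sub>C x = b *\<^sub>C x + c *\<^sub>C x"
    and scaleC_scaleC: "b *\<^sub>C c *\<^sub>C x = (b * c) *\<^sub>C x"
    and scaleC_of_real: "complex_of_real r *\<^sub>C x = r *\<^sub>R x"
    and cinner_commute: "cinner x y = cnj (cinner y x)"
    and cinner_add_left: "cinner (x + y) z = cinner x z + cinner y z"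
    and cinner_scaleC_left: "cinner (c *\<^sub>C x) y = c * cinner x y"
    and inner_eq_Re_cinner: "inner x y = Re (cinner x y)"

lemma scaleC_one: "1 *\<^sub>C x = (x :: 'a :: complex_inner)"
  using scaleC_of_real[of 1 x] by simp

interpretation complex_vector: vector_space "scaleC :: complex \<Rightarrow> 'a \<Rightarrow> 'a :: complex_inner"
  by unfold_locales (simp_all add: scaleC_add_right scaleC_add_left scaleC_scaleC scaleC_one)

definition closed_subspace :: "'a::complex_inner set \<Rightarrow> bool" where
  "closed_subspace S \<longleftrightarrow> complex_vector.subspace S \<and> closed S"

definition finite_dimensional :: "'a::complex_inner set \<Rightarrow> bool" where
  "finite_dimensional S \<longleftrightarrow> (\<exists>B. finite B \<and> complex_vector.span B = S)"

definition orthogonal_projection :: "'a::complex_inner set \<Rightarrow> 'a \<Rightarrow> 'a" where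
  "orthogonal_projection S u = (THE p. p \<in> S \<and> (\<forall>s\<in>S. cinner (u - p) s = 0))"

text \<open>
  An operator \<open>S \<rightarrow> S\<close> is a function on the whole type of which only the values on \<open>S\<close> matter.
\<close>

definition bounded_operator_on :: "'a::complex_inner set \<Rightarrow> ('a \<Rightarrow> 'a) \<Rightarrow> bool" where
  "bounded_operator_on S A \<longleftrightarrow>
     (\<forall>x\<in>S. A x \<in> S) \<and>
     (\<forall>x\<in>S. \<forall>y\<in>S. A (x + y) = A x + A y) \<and>
     (\<forall>c. \<forall>x\<in>S. A (c *\<^sub>C x) = c *\<^sub>C A x) \<and>
     (\<exists>K. \<forall>x\<in>S. norm (A x) \<le> K * norm x)"

section \<open>The sequence space\<close>

typedef 'i ell2 = "{a :: 'i \<Rightarrow> complex. (\<lambda>k. (cmod (a k))\<^sup>2) summable_on UNIV}"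
  by (rule exI[of _ "\<lambda>_. 0"]) simp

setup_lifting type_definition_ell2

lemma cmod_mult_cnj_le: "cmod (z * cnj w) \<le> (cmod z)\<^sup>2 + (cmod w)\<^sup>2"
proof -
  have "0 \<le> (cmod z - cmod w)\<^sup>2" by simp
  then have "2 * (cmod z * cmod w) \<le> (cmod z)\<^sup>2 + (cmod w)\<^sup>2"
    by (simp add: power2_diff)
  moreover have "0 \<le> cmod z * cmod w" by simp
  ultimately have "cmod z * cmod w \<le> (cmod z)\<^sup>2 + (cmod w)\<^sup>2" by linarith
  then show ?thesis by (simp add: norm_mult)
qed

lemma cmod_add_square_le: "(cmod (z + w))\<^sup>2 \<le> 2 * (cmod z)\<^sup>2 + 2 * (cmod w)\<^sup>2"
proof -
  have "(cmod (z + w))\<^sup>2 \<le> (cmod z + cmod w)\<^sup>2"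
    by (intro power_mono norm_triangle_ineq) simp
  also have "\<dots> \<le> 2 * (cmod z)\<^sup>2 + 2 * (cmod w)\<^sup>2"
    using zero_le_power2[of "cmod z - cmod w"] by (simp add: power2_diff power2_sum)
  finally show ?thesis .
qed

lemma ell2_summable_cinner:
  fixes a b :: "'i \<Rightarrow> complex"
  assumes "(\<lambda>k. (cmod (a k))\<^sup>2) summable_on UNIV" "(\<lambda>k. (cmod (b k))\<^sup>2) summable_on UNIV"
  shows "(\<lambda>k. a k * cnj (b k)) summable_on UNIV"
  by (rule abs_summable_summable, rule summable_on_comparison_test[OF summable_on_add[OF assms]])
     (use cmod_mult_cnj_le in auto)

lemma ell2_summable_add:
  fixes a b :: "'i \<Rightarrow> complex"
  assumes "(\<lambda>k. (cmod (a k))\<^sup>2) summable_on UNIV" "(\<lambda>k. (cmod (b k))\<^sup>2) summable_on UNIV"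
  shows "(\<lambda>k. (cmod (a k + b k))\<^sup>2) summable_on UNIV"
  by (rule summable_on_comparison_test
        [OF summable_on_add[OF summable_on_cmult_right[OF assms(1)] summable_on_cmult_right[OF assms(2)]]])
     (use cmod_add_square_le in auto)

lemma ell2_summable_cmult:
  fixes a :: "'i \<Rightarrow> complex"
  assumes "(\<lambda>k. (cmod (a k))\<^sup>2) summable_on UNIV"
  shows "(\<lambda>k. (cmod (c * a k))\<^sup>2) summable_on UNIV"
  using summable_on_cmult_right[OF assms] by (simp add: norm_mult power_mult_distrib)

instantiation ell2 :: (type) complex_inner
begin

lift_definition zero_ell2 :: "'a ell2" is "\<lambda>_. 0" by simp
lift_definition plus_ell2 :: "'a ell2 \<Rightarrow> 'a ell2 \<Rightarrow> 'a ell2" is "\<lambda>a b k. a k + b k"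
  by (rule ell2_summable_add)
lift_definition scaleC_ell2 :: "complex \<Rightarrow> 'a ell2 \<Rightarrow> 'a ell2" is "\<lambda>c a k. c * a k"
  by (rule ell2_summable_cmult)
lift_definition cinner_ell2 :: "'a ell2 \<Rightarrow> 'a ell2 \<Rightarrow> complex" is
  "\<lambda>a b. \<Sum>\<^sub>\<infinity>k. a k * cnj (b k)" .

definition "(r :: real) *\<^sub>R (x :: 'a ell2) = complex_of_real r *\<^sub>C x"
definition "- (x :: 'a ell2) = (- 1) *\<^sub>C x"
definition "(x :: 'a ell2) - y = x + - y"
definition "inner (x :: 'a ell2) y = Re (cinner x y)"
definition "norm (x :: 'a ell2) = sqrt (inner x x)"
definition "dist (x :: 'a ell2) y = norm (x - y)"
definition "sgn (x :: 'a ell2) = complex_of_real (inverse (norm x)) *\<^sub>C x"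
definition [code del]:
  "(uniformity :: ('a ell2 \<times> 'a ell2) filter) = (INF e\<in>{0<..}. principal {(x, y). dist x y < e})"
definition [code del]:
  "open (U :: 'a ell2 set) = (\<forall>x\<in>U. eventually (\<lambda>(x', y). x' = x \<longrightarrow> y \<in> U) uniformity)"

lemma ell2_cinner_self:
  "cinner (x :: 'a ell2) x = of_real (\<Sum>\<^sub>\<infinity>k. (cmod (Rep_ell2 x k))\<^sup>2)"
proof -
  have "((\<lambda>k. (cmod (Rep_ell2 x k))\<^sup>2) has_sum (\<Sum>\<^sub>\<infinity>k. (cmod (Rep_ell2 x k))\<^sup>2)) UNIV"
    using Rep_ell2[of x] by (simp add: has_sum_infsum)
  then have "((\<lambda>k. complex_of_real ((cmod (Rep_ell2 x k))\<^sup>2)) has_sum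
      complex_of_real (\<Sum>\<^sub>\<infinity>k. (cmod (Rep_ell2 x k))\<^sup>2)) UNIV"
    by (rule has_sum_of_real)
  then show ?thesis
    unfolding cinner_ell2.rep_eq complex_norm_square by (rule infsumI)
qed

instance
proof
  fix x y z :: "'a ell2" and b c :: complex and r s :: real
  note defs = scaleR_ell2_def uminus_ell2_def minus_ell2_def inner_ell2_def norm_ell2_def
    dist_ell2_def sgn_ell2_def uniformity_ell2_def open_ell2_def
  show "x + y + z = x + (y + z)" by transfer (auto simp: fun_eq_iff)
  show "x + y = y + x" by transfer (auto simp: fun_eq_iff)
  show "0 + x = x" by transfer auto
  show "- x + x = 0" unfolding defs by transfer auto
  show "x - y = x + - y" unfolding defs ..
  show add_r: "c *\<^sub>C (x + y) = c *\<^sub>C x + c *\<^sub>C y" for c :: complex and x y :: "'a ell2"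
    by transfer (auto simp: fun_eq_iff algebra_simps)
  show add_l: "(b + c) *\<^sub>C x = b *\<^sub>C x + c *\<^sub>C x" for b c :: complex and x :: "'a ell2"
    by transfer (auto simp: fun_eq_iff algebra_simps)
  show assoc: "b *\<^sub>C c *\<^sub>C x = (b * c) *\<^sub>C x" for b c :: complex and x :: "'a ell2"
    by transfer (auto simp: fun_eq_iff algebra_simps)
  show "complex_of_real r *\<^sub>C x = r *\<^sub>R x" unfolding defs ..
  show "r *\<^sub>R (x + y) = r *\<^sub>R x + r *\<^sub>R y" unfolding defs by (rule add_r)
  show "(r + s) *\<^sub>R x = r *\<^sub>R x + s *\<^sub>R x" unfolding defs by (simp add: add_l)
  show "r *\<^sub>R s *\<^sub>R x = (r * s) *\<^sub>R x" unfolding defs by (simp add: assoc)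
  show "1 *\<^sub>R x = x" unfolding defs by transfer auto
  show "dist x y = norm (x - y)" unfolding defs ..
  show "sgn x = inverse (norm x) *\<^sub>R x" unfolding sgn_ell2_def scaleR_ell2_def ..
  show "(uniformity :: ('a ell2 \<times> 'a ell2) filter) = (INF e\<in>{0<..}. principal {(x, y). dist x y < e})"
    by (rule uniformity_ell2_def)
  show "open U = (\<forall>x\<in>U. eventually (\<lambda>(x', y). x' = x \<longrightarrow> y \<in> U) uniformity)" for U :: "'a ell2 set"
    by (rule open_ell2_def)
  show comm: "cinner x y = cnj (cinner y x)" for x y :: "'a ell2"
    by transfer (simp add: infsum_cnj[symmetric] mult.commute del: infsum_cnj)
  show add: "cinner (x + y) z = cinner x z + cinner y z" for x y z :: "'a ell2"
    by transfer (simp add: distrib_right infsum_add ell2_summable_cinner)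
  show scale: "cinner (c *\<^sub>C x) y = c * cinner x y" for c :: complex and x y :: "'a ell2"
    by transfer (simp add: mult.assoc infsum_cmult_right ell2_summable_cinner)
  show "inner x y = Re (cinner x y)" by (rule inner_ell2_def)
  show "inner x y = inner y x" unfolding inner_ell2_def by (subst comm) simp
  show "inner (x + y) z = inner x z + inner y z" unfolding inner_ell2_def by (simp add: add)
  show "inner (r *\<^sub>R x) y = r * inner x y" unfolding inner_ell2_def scaleR_ell2_def by (simp add: scale)
  show "0 \<le> inner x x" unfolding inner_ell2_def by (simp add: ell2_cinner_self infsum_nonneg)
  show "(inner x x = 0) = (x = 0)"
  proof
    assume "inner x x = 0"
    then have "(\<Sum>\<^sub>\<infinity>k. (cmod (Rep_ell2 x k))\<^sup>2) = 0"
      unfolding inner_ell2_def by (simp add: ell2_cinner_self)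
    then have "(cmod (Rep_ell2 x k))\<^sup>2 = 0" for k
      using nonneg_infsum_le_0D[of "\<lambda>k. (cmod (Rep_ell2 x k))\<^sup>2" UNIV k] Rep_ell2[of x] by auto
    then show "x = 0" by (simp add: Rep_ell2_inject[symmetric] zero_ell2.rep_eq fun_eq_iff)
  next
    assume "x = 0"
    then show "inner x x = 0" unfolding inner_ell2_def by (simp add: ell2_cinner_self zero_ell2.rep_eq)
  qed
  show "norm x = sqrt (inner x x)" by (rule norm_ell2_def)
qed

end

section \<open>The space of square integrable functions\<close>

definition square_integrable :: "('a::euclidean_space \<Rightarrow> complex) \<Rightarrow> bool" where
  "square_integrable f \<longleftrightarrow> f \<in> borel_measurable lborel \<and> integrable lborel (\<lambda>x. (cmod (f x))\<^sup>2)"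

definition L2_rel :: "('a::euclidean_space \<Rightarrow> complex) \<Rightarrow> ('a \<Rightarrow> complex) \<Rightarrow> bool" where
  "L2_rel f g \<longleftrightarrow> square_integrable f \<and> square_integrable g \<and> (AE x in lborel. f x = g x)"

lemma square_integrable_zero: "square_integrable (\<lambda>_. 0)"
  by (simp add: square_integrable_def)

lemma part_equivp_L2_rel: "part_equivp L2_rel"
proof (rule part_equivpI)
  show "\<exists>f :: 'a \<Rightarrow> complex. L2_rel f f"
    using square_integrable_zero by (auto simp: L2_rel_def)
  show "symp (L2_rel :: ('a \<Rightarrow> complex) \<Rightarrow> _)" by (auto intro!: sympI simp: L2_rel_def elim: eventually_mono)
  show "transp (L2_rel :: ('a \<Rightarrow> complex) \<Rightarrow> _)"
    by (rule transpI) (auto simp: L2_rel_def elim: eventually_elim2)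
qed

text \<open>
  Classes of Borel measurable functions modulo equality almost everywhere; every Lebesgue
  measurable function agrees almost everywhere with a Borel measurable one.  The constant
  \<open>rep_L2\<close> chooses a representative.
\<close>

quotient_type (overloaded) 'a L2 = "'a::euclidean_space \<Rightarrow> complex" / partial: L2_rel
  by (rule part_equivp_L2_rel)

lemma square_integrable_add:
  assumes "square_integrable f" "square_integrable g"
  shows "square_integrable (\<lambda>x. f x + g x)"
proof -
  have [measurable]: "f \<in> borel_measurable lborel" "g \<in> borel_measurable lborel"
    using assms by (auto simp: square_integrable_def)
  have "integrable lborel (\<lambda>x. 2 * (cmod (f x))\<^sup>2 + 2 * (cmod (g x))\<^sup>2)"
    using assms by (auto simp: square_integrable_def)
  then have "integrable lborel (\<lambda>x. (cmod (f x + g x))\<^sup>2)"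
    by (rule Bochner_Integration.integrable_bound) (use cmod_add_square_le in auto)
  then show ?thesis by (simp add: square_integrable_def)
qed

lemma square_integrable_cmult:
  assumes "square_integrable f"
  shows "square_integrable (\<lambda>x. c * f x)"
  using assms by (auto simp: square_integrable_def norm_mult power_mult_distrib)

lemma square_integrable_cinner:
  assumes "square_integrable f" "square_integrable g"
  shows "integrable lborel (\<lambda>x. f x * cnj (g x))"
proof -
  have [measurable]: "f \<in> borel_measurable lborel" "g \<in> borel_measurable lborel"
    using assms by (auto simp: square_integrable_def)
  have "integrable lborel (\<lambda>x. (cmod (f x))\<^sup>2 + (cmod (g x))\<^sup>2)"
    using assms by (auto simp: square_integrable_def)
  then show ?thesis
  proof (rule Bochner_Integration.integrable_bound)
    show "(\<lambda>x. f x * cnj (g x)) \<in> borel_measurable lborel"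
      by (intro borel_measurable_times measurable_compose[OF _ borel_measurable_continuous_onI[of cnj]])
         (auto intro: continuous_intros)
    show "AE x in lborel. norm (f x * cnj (g x)) \<le> norm ((cmod (f x))\<^sup>2 + (cmod (g x))\<^sup>2)"
      using cmod_mult_cnj_le by (intro AE_I2) (simp only: real_norm_def abs_of_nonneg sum_power2_ge_zero)
  qed
qed

lemma L2_rel_rep: "L2_rel (rep_L2 f) (rep_L2 f)"
  by (rule Quotient3_rep_reflp[OF Quotient3_L2])

lemma square_integrable_rep_L2: "square_integrable (rep_L2 f)"
  using L2_rel_rep by (auto simp: L2_rel_def)

lemma rep_abs_L2:
  assumes "square_integrable f"
  shows "AE x in lborel. rep_L2 (abs_L2 f) x = f x"
  using rep_abs_rsp_left[OF Quotient3_L2, of f f] assms by (simp add: L2_rel_def)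

instantiation L2 :: (euclidean_space) complex_inner
begin

lift_definition zero_L2 :: "'a L2" is "\<lambda>_. 0"
  by (simp add: L2_rel_def square_integrable_zero)
lift_definition plus_L2 :: "'a L2 \<Rightarrow> 'a L2 \<Rightarrow> 'a L2" is "\<lambda>f g x. f x + g x"
  by (auto simp: L2_rel_def square_integrable_add elim: eventually_elim2)
lift_definition scaleC_L2 :: "complex \<Rightarrow> 'a L2 \<Rightarrow> 'a L2" is "\<lambda>c f x. c * f x"
  by (auto simp: L2_rel_def square_integrable_cmult elim: eventually_mono)
lift_definition cinner_L2 :: "'a L2 \<Rightarrow> 'a L2 \<Rightarrow> complex" is
  "\<lambda>f g. \<integral>x. f x * cnj (g x) \<partial>lborel"
proof -
  fix f f' g g' :: "'a \<Rightarrow> complex"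
  assume rel: "L2_rel f f'" "L2_rel g g'"
  show "(\<integral>x. f x * cnj (g x) \<partial>lborel) = (\<integral>x. f' x * cnj (g' x) \<partial>lborel)"
  proof (rule integral_cong_AE)
    show "AE x in lborel. f x * cnj (g x) = f' x * cnj (g' x)"
      using rel by (auto simp: L2_rel_def elim: eventually_elim2)
    show "(\<lambda>x. f x * cnj (g x)) \<in> borel_measurable lborel"
      using rel by (intro borel_measurable_integrable[OF square_integrable_cinner]) (auto simp: L2_rel_def)
    show "(\<lambda>x. f' x * cnj (g' x)) \<in> borel_measurable lborel"
      using rel by (intro borel_measurable_integrable[OF square_integrable_cinner]) (auto simp: L2_rel_def)
  qed
qed

definition "(r :: real) *\<^sub>R (x :: 'a L2) = complex_of_real r *\<^sub>C x"
definition "- (x :: 'a L2) = (- 1) *\<^sub>C x"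
definition "(x :: 'a L2) - y = x + - y"
definition "inner (x :: 'a L2) y = Re (cinner x y)"
definition "norm (x :: 'a L2) = sqrt (inner x x)"
definition "dist (x :: 'a L2) y = norm (x - y)"
definition "sgn (x :: 'a L2) = complex_of_real (inverse (norm x)) *\<^sub>C x"
definition [code del]:
  "(uniformity :: ('a L2 \<times> 'a L2) filter) = (INF e\<in>{0<..}. principal {(x, y). dist x y < e})"
definition [code del]:
  "open (U :: 'a L2 set) = (\<forall>x\<in>U. eventually (\<lambda>(x', y). x' = x \<longrightarrow> y \<in> U) uniformity)"

lemma L2_cinner_self:
  "cinner (f :: 'a L2) f = of_real (\<integral>x. (cmod (rep_L2 f x))\<^sup>2 \<partial>lborel)"
proof -
  have "cinner f f = cinner (abs_L2 (rep_L2 f)) (abs_L2 (rep_L2 f))"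
    by (simp add: Quotient3_abs_rep[OF Quotient3_L2])
  also have "\<dots> = (\<integral>x. rep_L2 f x * cnj (rep_L2 f x) \<partial>lborel)"
    by (rule cinner_L2.abs_eq[OF L2_rel_rep L2_rel_rep])
  also have "\<dots> = (\<integral>x. of_real ((cmod (rep_L2 f x))\<^sup>2) \<partial>lborel)"
    by (simp only: complex_norm_square)
  finally show ?thesis by (simp only: integral_complex_of_real)
qed

instance
proof
  fix x y z :: "'a L2" and b c :: complex and r s :: real
  note defs = scaleR_L2_def uminus_L2_def minus_L2_def dist_L2_def
  note rel = L2_rel_def square_integrable_add square_integrable_cmult square_integrable_zero
  show "x + y + z = x + (y + z)" by transfer (auto simp: rel add.assoc)
  show "x + y = y + x" by transfer (auto simp: rel add.commute)
  show "0 + x = x" by transfer (auto simp: rel)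
  show "- x + x = 0" unfolding defs by transfer (auto simp: rel)
  show "x - y = x + - y" unfolding defs ..
  show add_r: "c *\<^sub>C (x + y) = c *\<^sub>C x + c *\<^sub>C y" for c :: complex and x y :: "'a L2"
    by transfer (auto simp: rel distrib_left)
  show add_l: "(b + c) *\<^sub>C x = b *\<^sub>C x + c *\<^sub>C x" for b c :: complex and x :: "'a L2"
    by transfer (auto simp: rel distrib_right)
  show assoc: "b *\<^sub>C c *\<^sub>C x = (b * c) *\<^sub>C x" for b c :: complex and x :: "'a L2"
    by transfer (auto simp: rel mult.assoc)
  show "complex_of_real r *\<^sub>C x = r *\<^sub>R x" unfolding defs ..
  show "r *\<^sub>R (x + y) = r *\<^sub>R x + r *\<^sub>R y" unfolding defs by (rule add_r)
  show "(r + s) *\<^sub>R x = r *\<^sub>R x + s *\<^sub>R x" unfolding defs by (simp add: add_l)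
  show "r *\<^sub>R s *\<^sub>R x = (r * s) *\<^sub>R x" unfolding defs by (simp add: assoc)
  show "1 *\<^sub>R x = x" unfolding defs by transfer (auto simp: rel)
  show "dist x y = norm (x - y)" unfolding defs ..
  show "sgn x = inverse (norm x) *\<^sub>R x" unfolding sgn_L2_def scaleR_L2_def ..
  show "(uniformity :: ('a L2 \<times> 'a L2) filter) = (INF e\<in>{0<..}. principal {(x, y). dist x y < e})"
    by (rule uniformity_L2_def)
  show "open U = (\<forall>x\<in>U. eventually (\<lambda>(x', y). x' = x \<longrightarrow> y \<in> U) uniformity)" for U :: "'a L2 set"
    by (rule open_L2_def)
  show comm: "cinner x y = cnj (cinner y x)" for x y :: "'a L2"
    by transfer (simp add: Bochner_Integration.integral_cnj[symmetric] mult.commute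
        del: Bochner_Integration.integral_cnj)
  show add: "cinner (x + y) z = cinner x z + cinner y z" for x y z :: "'a L2"
    by transfer (simp add: L2_rel_def distrib_right square_integrable_cinner)
  show scale: "cinner (c *\<^sub>C x) y = c * cinner x y" for c :: complex and x y :: "'a L2"
    by transfer (simp add: L2_rel_def mult.assoc square_integrable_cinner)
  show "inner x y = Re (cinner x y)" by (rule inner_L2_def)
  show "inner x y = inner y x" unfolding inner_L2_def by (subst comm) simp
  show "inner (x + y) z = inner x z + inner y z" unfolding inner_L2_def by (simp add: add)
  show "inner (r *\<^sub>R x) y = r * inner x y" unfolding inner_L2_def scaleR_L2_def by (simp add: scale)
  show "0 \<le> inner x x" unfolding inner_L2_def by (simp add: L2_cinner_self)
  have "(\<integral>t. (cmod (rep_L2 x t))\<^sup>2 \<partial>lborel) = 0 \<longleftrightarrow> (AE t in lborel. rep_L2 x t = 0)"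
    using square_integrable_rep_L2[of x]
    by (subst integral_nonneg_eq_0_iff_AE) (auto simp: square_integrable_def)
  also have "\<dots> \<longleftrightarrow> L2_rel (rep_L2 x) (\<lambda>_. 0)"
    by (simp add: L2_rel_def square_integrable_rep_L2 square_integrable_zero)
  also have "\<dots> \<longleftrightarrow> x = 0"
    using Quotient3_rel[OF Quotient3_L2, of "rep_L2 x" "\<lambda>_. 0"] L2_rel_rep[of x]
    by (simp add: Quotient3_abs_rep[OF Quotient3_L2] zero_L2.abs_eq L2_rel_def square_integrable_zero)
  finally show "(inner x x = 0) = (x = 0)"
    unfolding inner_L2_def by (simp add: L2_cinner_self)
  show "norm x = sqrt (inner x x)" by (rule norm_L2_def)
qed

end

lemma AE_lborel_translate:
  fixes P :: "'a::euclidean_space \<Rightarrow> bool"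
  assumes "AE x in lborel. P x"
  shows "AE x in lborel. P (x - t)"
proof -
  have "AE x in distr lborel borel ((+) (- t)). P x"
    using assms by (simp only: lborel_distr_plus)
  then have "AE x in lborel. P (- t + x)"
    by (rule AE_distrD[rotated]) simp
  then show ?thesis by (simp add: algebra_simps)
qed

lemma square_integrable_translate:
  assumes "square_integrable f"
  shows "square_integrable (\<lambda>x. f (x - t))"
proof -
  have [measurable]: "f \<in> borel_measurable borel"
    using assms by (simp add: square_integrable_def)
  have "integrable (distr lborel borel ((+) (- t))) (\<lambda>x. (cmod (f x))\<^sup>2)"
    using assms by (simp only: lborel_distr_plus square_integrable_def)
  then have "integrable lborel (\<lambda>x. (cmod (f (- t + x)))\<^sup>2)"
    by (rule integrable_distr[rotated]) simp
  then show ?thesis by (simp add: square_integrable_def algebra_simps)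
qed

lift_definition translate :: "'a::euclidean_space \<Rightarrow> 'a L2 \<Rightarrow> 'a L2" is "\<lambda>t f x. f (x - t)"
  unfolding L2_rel_def by (intro conjI square_integrable_translate AE_lborel_translate) auto

section \<open>The Fourier transform\<close>

definition fourier_integral :: "('a::euclidean_space \<Rightarrow> complex) \<Rightarrow> 'a \<Rightarrow> complex" where
  "fourier_integral f \<omega> =
     (\<integral>x. f x * exp (- 2 * complex_of_real pi * \<i> * complex_of_real (\<omega> \<bullet> x)) \<partial>lborel)"

text \<open>
  The integral converges only on \<open>L\<^sup>1 \<inter> L\<^sup>2\<close>; on all of \<open>L\<^sup>2\<close> the Fourier transform is, by
  Plancherel's theorem, the unique continuous extension.
\<close>

definition fourier :: "'a::euclidean_space L2 \<Rightarrow> 'a L2" where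
  "fourier = (THE F. continuous_on UNIV F \<and>
     (\<forall>f. integrable lborel (rep_L2 f) \<longrightarrow>
        (AE \<omega> in lborel. rep_L2 (F f) \<omega> = fourier_integral (rep_L2 f) \<omega>)))"

section \<open>Shift-invariant spaces, range functions and range operators\<close>

definition lattice_point :: "int ^ 'd \<Rightarrow> real ^ 'd" where
  "lattice_point k = (\<chi> i. real_of_int (k $ i))"

definition shift :: "int ^ 'd \<Rightarrow> (real ^ 'd::finite) L2 \<Rightarrow> (real ^ 'd) L2" where
  "shift k = translate (lattice_point k)"

definition shift_invariant :: "(real ^ 'd::finite) L2 set \<Rightarrow> bool" where
  "shift_invariant V \<longleftrightarrow> closed_subspace V \<and> (\<forall>f\<in>V. \<forall>k. shift k f \<in> V)"

definition half_open_cube :: "(real ^ 'd::finite) set" where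
  "half_open_cube = {\<omega>. \<forall>i. 0 \<le> \<omega> $ i \<and> \<omega> $ i < 1}"

text \<open>
  The map \<open>\<T>\<close>, with the chosen representative of the Fourier transform; another one changes it only
  on a null set.  The sequence is square summable for almost every \<open>\<omega>\<close>, elsewhere the value is \<open>0\<close>.
\<close>

definition fiber :: "(real ^ 'd::finite) L2 \<Rightarrow> real ^ 'd \<Rightarrow> (int ^ 'd) ell2" where
  "fiber f \<omega> =
     (let a = (\<lambda>k. rep_L2 (fourier f) (\<omega> + lattice_point k))
      in if (\<lambda>k. (cmod (a k))\<^sup>2) summable_on UNIV then Abs_ell2 a else 0)"

definition measurable_range_function :: "(real ^ 'd::finite \<Rightarrow> (int ^ 'd) ell2 set) \<Rightarrow> bool" where
  "measurable_range_function J \<longleftrightarrow>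
     (\<forall>\<omega>\<in>half_open_cube. closed_subspace (J \<omega>)) \<and>
     (\<forall>u v. (\<lambda>\<omega>. cinner (orthogonal_projection (J \<omega>) u) v)
              \<in> borel_measurable (lebesgue_on half_open_cube))"

definition is_range_function ::
    "(real ^ 'd::finite) L2 set \<Rightarrow> (real ^ 'd \<Rightarrow> (int ^ 'd) ell2 set) \<Rightarrow> bool" where
  "is_range_function V J \<longleftrightarrow>
     measurable_range_function J \<and>
     (\<forall>f. f \<in> V \<longleftrightarrow> (AE \<omega> in lebesgue_on half_open_cube. fiber f \<omega> \<in> J \<omega>))"

definition shift_preserving ::
    "(real ^ 'd::finite) L2 set \<Rightarrow> ((real ^ 'd) L2 \<Rightarrow> (real ^ 'd) L2) \<Rightarrow> bool" where
  "shift_preserving V L \<longleftrightarrow>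
     bounded_operator_on V L \<and> (\<forall>k. \<forall>f\<in>V. L (shift k f) = shift k (L f))"

definition is_range_operator ::
    "(real ^ 'd::finite) L2 set \<Rightarrow> (real ^ 'd \<Rightarrow> (int ^ 'd) ell2 set) \<Rightarrow>
     ((real ^ 'd) L2 \<Rightarrow> (real ^ 'd) L2) \<Rightarrow>
     (real ^ 'd \<Rightarrow> (int ^ 'd) ell2 \<Rightarrow> (int ^ 'd) ell2) \<Rightarrow> bool" where
  "is_range_operator V J L R \<longleftrightarrow>
     (\<forall>\<omega>\<in>half_open_cube. bounded_operator_on (J \<omega>) (R \<omega>)) \<and>
     (\<forall>u v. (\<lambda>\<omega>. cinner (R \<omega> (orthogonal_projection (J \<omega>) u)) v)
              \<in> borel_measurable (lebesgue_on half_open_cube)) \<and>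
     (\<forall>f\<in>V. AE \<omega> in lebesgue_on half_open_cube. fiber (L f) \<omega> = R \<omega> (fiber f \<omega>))"

text \<open>
  Bijectivity on \<open>S\<close>.  For a bounded operator on a closed subspace of a Hilbert space the inverse is
  then bounded by the open mapping theorem, so boundedness is not part of the definition.
\<close>

definition invertible_on :: "'a set \<Rightarrow> ('a \<Rightarrow> 'a) \<Rightarrow> bool" where
  "invertible_on S A \<longleftrightarrow> bij_betw A S S"

end

theory Submission
  imports Defs "HOL-Probability.Characteristic_Functions"
begin

text \<open>
  The map \<open>f \<mapsto> fiber f\<close> carries \<open>L\<^sup>2(\<real>\<^sup>d)\<close> isometrically onto the square integrable fields of
  sequences over the unit cube, and \<open>V\<close> onto the fields with values in \<open>J\<close>.  There \<open>L\<close> acts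
  pointwise through \<open>R\<close>, so the theorem is a passage between global statements about \<open>L\<close> and
  statements about almost every \<open>R \<omega>\<close>.  Two devices make the passage.

  \<^item> Localisation (\<open>fiber_norm_le_of_localized\<close>).  A field in \<open>V\<close> may be cut off to any Borel set of
    frequencies without leaving \<open>V\<close>, and \<open>L\<close> commutes with the cut-off.  A norm inequality that
    holds for all cut-offs therefore holds fiber by fiber.

  \<^item> Density (\<open>AE_all_projected\<close>, \<open>projected_dense\<close>).  For a fixed sequence \<open>u\<close>, the field of
    projections of \<open>u\<close> onto \<open>J \<omega>\<close> is measurable and bounded, hence the fiber of an element of \<open>V\<close>.
    Letting \<open>u\<close> run through a countable dense set, a statement that holds almost everywhere for
    each element of \<open>V\<close> holds, off one null set, for vectors that are dense in \<open>J \<omega>\<close>; boundedness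
    of \<open>R \<omega>\<close> extends it to all of \<open>J \<omega>\<close>.

  If \<open>L\<close> is bijective on \<open>V\<close>, the bounded inverse theorem gives \<open>C * norm f \<le> norm (L f)\<close>, which is
  localised and extended by density to a lower bound for \<open>R \<omega>\<close>.  The range of \<open>R \<omega>\<close> contains the
  projections of a dense set, and it is closed because \<open>J \<omega>\<close> has finite dimension, so \<open>R \<omega>\<close> is onto.

  Conversely, a uniform lower bound makes \<open>L\<close> injective with closed range.  Instead of inverting
  \<open>R \<omega>\<close> measurably, take \<open>y\<close> in \<open>V\<close> and let \<open>h\<close> be \<open>y\<close> minus its nearest point in the range.  Then
  \<open>norm h \<le> norm (h + L f)\<close> for all \<open>f\<close> in \<open>V\<close>; localised, this says that the fiber of \<open>h\<close> cannot be
  shortened by adding vectors \<open>R \<omega> a\<close>.  As these exhaust \<open>J \<omega>\<close>, the fiber vanishes, and \<open>y\<close> lies in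
  the range.  For a range operator \<open>R'\<close> of the inverse, \<open>R \<omega> (R' \<omega> a) = a\<close> holds for the dense
  projections and hence on \<open>J \<omega>\<close>.

  All this presupposes that \<open>fourier\<close>, which is defined by a unique description, is a unitary operator.
  Plancherel's identity on \<open>L\<^sup>1 \<inter> L\<^sup>2\<close> is obtained by damping the energy of the transform with a
  Gaussian window: the damped energy is a Gaussian average of the autocorrelation
  \<open>t \<mapsto> cinner f (translate t f)\<close>, which tends to the energy of \<open>f\<close> as the window opens, because
  translation is continuous in \<open>L\<^sup>2\<close>.  Completeness of \<open>L\<^sup>2\<close> extends the transform, and surjectivity
  follows from the multiplication formula: a function orthogonal to the closed range has a
  conjugate with vanishing transform.
\<close>

section \<open>Subspaces and bounded operators\<close>

lemma parallelogram_midpoint: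
  fixes a b y :: "'a::real_inner"
  shows "(norm (a - b))\<^sup>2 = 2 * (norm (y - a))\<^sup>2 + 2 * (norm (y - b))\<^sup>2 - 4 * (norm (y - (1/2) *\<^sub>R (a + b)))\<^sup>2"
  by (simp add: power2_norm_eq_inner inner_diff_left inner_diff_right inner_add_left inner_add_right
      inner_commute algebra_simps)

text \<open>
  By the parallelogram law, two points of a convex set whose distances to \<open>y\<close> are almost minimal are
  close to each other, since their midpoint is no closer; a minimizing sequence is Cauchy.
\<close>

lemma nearest_point_exists:
  fixes S :: "'a::{real_inner, banach} set"
  assumes "closed S" "convex S" "S \<noteq> {}"
  obtains m where "m \<in> S" "\<And>s. s \<in> S \<Longrightarrow> norm (y - m) \<le> norm (y - s)"
proof -
  define d where "d = infdist y S"
  have d: "d \<ge> 0" "\<And>s. s \<in> S \<Longrightarrow> d \<le> norm (y - s)"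
    unfolding d_def using infdist_le[of _ S y] by (auto simp: infdist_nonneg dist_norm)
  have "\<exists>s\<in>S. (norm (y - s))\<^sup>2 < d\<^sup>2 + 1 / Suc n" for n
  proof -
    have "d < sqrt (d\<^sup>2 + 1 / Suc n)" by (rule real_less_rsqrt) simp
    then have "(INF a\<in>S. dist y a) < sqrt (d\<^sup>2 + 1 / Suc n)"
      unfolding d_def infdist_def using assms(3) by simp
    then obtain s where "s \<in> S" "dist y s < sqrt (d\<^sup>2 + 1 / Suc n)"
      using assms(3) by (subst (asm) cINF_less_iff) (auto intro: bdd_belowI[of _ 0])
    then have "(norm (y - s))\<^sup>2 < (sqrt (d\<^sup>2 + 1 / Suc n))\<^sup>2"
      by (intro power_strict_mono) (auto simp: dist_norm)
    with \<open>s \<in> S\<close> show ?thesis by (intro bexI[of _ s]) (auto simp: add_nonneg_nonneg)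
  qed
  then obtain s where s: "\<And>n. s n \<in> S" "\<And>n. (norm (y - s n))\<^sup>2 < d\<^sup>2 + 1 / Suc n"
    by metis
  have close: "(norm (s m - s n))\<^sup>2 \<le> 2 / Suc m + 2 / Suc n" for m n
  proof -
    have "(1/2) *\<^sub>R (s m + s n) \<in> S"
      using convexD[OF assms(2) s(1)[of m] s(1)[of n], of "1/2" "1/2"] by (simp add: scaleR_add_right)
    then have "d\<^sup>2 \<le> (norm (y - (1/2) *\<^sub>R (s m + s n)))\<^sup>2"
      using d by (intro power_mono) auto
    then show ?thesis
      using parallelogram_midpoint[of "s m" "s n" y] s(2)[of m] s(2)[of n] by simp
  qed
  have "Cauchy s"
  proof (rule CauchyI)
    fix e :: real assume "e > 0"
    then obtain N where N: "4 / e\<^sup>2 < real N" using reals_Archimedean2 by blast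
    have "norm (s m - s n) < e" if "m \<ge> N" "n \<ge> N" for m n
    proof -
      have "0 < real N" using N \<open>e > 0\<close> by (smt (verit) zero_le_divide_iff zero_le_power2)
      have "2 / real (Suc m) + 2 / real (Suc n) \<le> 2 / real N + 2 / real N"
        using that \<open>0 < real N\<close> by (intro add_mono divide_left_mono) auto
      also have "\<dots> < e\<^sup>2" using N \<open>0 < real N\<close> \<open>e > 0\<close> by (simp add: field_simps)
      finally have "(norm (s m - s n))\<^sup>2 < e\<^sup>2" using close[of m n] by linarith
      then show ?thesis using \<open>e > 0\<close> by (intro power_less_imp_less_base[of _ 2 e]) auto
    qed
    then show "\<exists>M. \<forall>m\<ge>M. \<forall>n\<ge>M. norm (s m - s n) < e" by blast
  qed
  then obtain m where m: "s \<longlonglongrightarrow> m" using Cauchy_convergent_iff convergent_def by blast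
  have "m \<in> S" using closed_sequentially[OF assms(1) s(1) m] .
  moreover have "norm (y - m) \<le> norm (y - t)" if "t \<in> S" for t
  proof -
    have "(\<lambda>n. (norm (y - s n))\<^sup>2) \<longlonglongrightarrow> (norm (y - m))\<^sup>2" by (intro tendsto_intros m)
    moreover have "(\<lambda>n. d\<^sup>2 + 1 / Suc n) \<longlonglongrightarrow> d\<^sup>2 + 0"
      by (intro tendsto_intros LIMSEQ_Suc[OF lim_1_over_n])
    ultimately have "(norm (y - m))\<^sup>2 \<le> d\<^sup>2 + 0"
      by (rule LIMSEQ_le) (use s(2) less_imp_le in blast)
    then have "(norm (y - m))\<^sup>2 \<le> d\<^sup>2" by simp
    then have "norm (y - m) \<le> d" by (rule power2_le_imp_le) (rule d(1))
    then show ?thesis using d(2)[OF that] by simp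
  qed
  ultimately show ?thesis by (rule that)
qed

text \<open>
  Operators such as \<open>L\<close> and \<open>R \<omega>\<close> are controlled only on a subspace, so linearity and the norm bound
  are required there and nowhere else.
\<close>

locale bounded_linear_on =
  fixes S :: "'a::{real_normed_vector} set" and L :: "'a \<Rightarrow> 'b::real_normed_vector" and K :: real
  assumes subspace: "subspace S"
    and add: "\<And>x y. x \<in> S \<Longrightarrow> y \<in> S \<Longrightarrow> L (x + y) = L x + L y"
    and scale: "\<And>c x. x \<in> S \<Longrightarrow> L (c *\<^sub>R x) = c *\<^sub>R L x"
    and bound: "\<And>x. x \<in> S \<Longrightarrow> norm (L x) \<le> K * norm x"
begin

lemma minus: "x \<in> S \<Longrightarrow> y \<in> S \<Longrightarrow> L (x - y) = L x - L y"
  using add[of x "(-1) *\<^sub>R y"] scale[of y "-1"] subspace_scale[OF subspace, of y "-1"] by simp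

lemma zero: "L 0 = 0"
proof -
  have "L (0 *\<^sub>R 0) = 0 *\<^sub>R L 0" by (rule scale) (rule subspace_0[OF subspace])
  then show ?thesis by (simp only: scaleR_zero_left)
qed

lemma subspace_image: "subspace (L ` S)"
  unfolding subspace_def
proof (intro conjI ballI allI)
  show "0 \<in> L ` S" using zero subspace_0[OF subspace] by force
next
  fix x y assume "x \<in> L ` S" "y \<in> L ` S"
  then obtain a b where "a \<in> S" "b \<in> S" "x = L a" "y = L b" by auto
  then show "x + y \<in> L ` S" using add[of a b] subspace_add[OF subspace, of a b] by (intro image_eqI[of _ _ "a + b"]) auto
next
  fix c x assume "x \<in> L ` S"
  then obtain a where "a \<in> S" "x = L a" by auto
  then show "c *\<^sub>R x \<in> L ` S" using scale[of a c] subspace_scale[OF subspace, of a c]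
    by (intro image_eqI[of _ _ "c *\<^sub>R a"]) auto
qed

lemma tendsto:
  assumes "\<And>n. x n \<in> S" "a \<in> S" "x \<longlonglongrightarrow> a"
  shows "(\<lambda>n. L (x n)) \<longlonglongrightarrow> L a"
proof -
  have "(\<lambda>n. K * norm (x n - a)) \<longlonglongrightarrow> K * norm (a - a)" by (intro tendsto_intros assms)
  then have "(\<lambda>n. K * norm (x n - a)) \<longlonglongrightarrow> 0" by simp
  moreover have "norm (L (x n) - L a) \<le> K * norm (x n - a)" for n
    using bound[of "x n - a"] minus[of "x n" a] assms subspace_diff[OF subspace] by simp
  ultimately have "(\<lambda>n. L (x n) - L a) \<longlonglongrightarrow> 0"
    by (rule_tac Lim_null_comparison[OF always_eventually]) auto
  then show ?thesis by (rule LIM_zero_cancel)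
qed

end

lemma closed_image_of_bounded_below:
  fixes S :: "'a::banach set"
  assumes "bounded_linear_on S L K" "closed S" "0 < C"
    and below: "\<And>x. x \<in> S \<Longrightarrow> C * norm x \<le> norm (L x)"
  shows "closed (L ` S)"
proof -
  interpret bounded_linear_on S L K by fact
  show ?thesis
    unfolding closed_sequential_limits
  proof (intro allI impI, elim conjE)
    fix z l assume z: "\<forall>n. z n \<in> L ` S" and l: "z \<longlonglongrightarrow> l"
    then have "\<forall>n. \<exists>x. x \<in> S \<and> z n = L x" by auto
    then obtain x where x: "\<And>n. x n \<in> S" "\<And>n. z n = L (x n)" by (auto dest!: choice)
    have "Cauchy x"
    proof (rule CauchyI)
      fix e :: real assume "e > 0"
      then obtain M where M: "\<And>m n. m \<ge> M \<Longrightarrow> n \<ge> M \<Longrightarrow> norm (z m - z n) < C * e"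
        using CauchyD[OF LIMSEQ_imp_Cauchy[OF l], of "C * e"] \<open>0 < C\<close> by auto
      have "norm (x m - x n) < e" if "m \<ge> M" "n \<ge> M" for m n
      proof -
        have "C * norm (x m - x n) \<le> norm (z m - z n)"
          using below[of "x m - x n"] x minus[of "x m" "x n"] subspace_diff[OF subspace] by simp
        also have "\<dots> < C * e" using M that by blast
        finally show ?thesis using \<open>0 < C\<close> by simp
      qed
      then show "\<exists>M. \<forall>m\<ge>M. \<forall>n\<ge>M. norm (x m - x n) < e" by blast
    qed
    then obtain a where a: "x \<longlonglongrightarrow> a" using Cauchy_convergent_iff convergent_def by blast
    have "a \<in> S" using closed_sequentially[OF \<open>closed S\<close> x(1) a] .
    then have "(\<lambda>n. L (x n)) \<longlonglongrightarrow> L a" by (intro tendsto x a)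
    then have "z \<longlonglongrightarrow> L a" using x(2) by presburger
    then show "l \<in> L ` S" using l LIMSEQ_unique \<open>a \<in> S\<close> by blast
  qed
qed

text \<open>
  The Baire category step of the open mapping theorem.  The images of the balls cover \<open>S\<close>, so the
  closure of one of them contains a relative ball; differences of its points show that a ball around
  \<open>0\<close> is approximated, and scaling does the rest.
\<close>

lemma open_mapping_approximate:
  fixes S :: "'a::banach set"
  assumes "bounded_linear_on S L K" "closed S" "L ` S = S"
  obtains M where "M > 0" "\<And>y. y \<in> S \<Longrightarrow> \<exists>x\<in>S. norm x \<le> M * norm y \<and> norm (y - L x) \<le> norm y / 2"
proof -
  interpret bounded_linear_on S L K by fact
  define X where "X = top_of_set S"
  define B where "B n = {x \<in> S. norm x \<le> real n}" for n :: nat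
  define G where "G n = S \<inter> closure (L ` B n)" for n
  have "S \<subseteq> \<Union> (range G)"
  proof
    fix y assume "y \<in> S"
    then obtain x where x: "x \<in> S" "y = L x" using assms(3) by blast
    obtain n where "norm x \<le> real n" using real_arch_simple by blast
    then have "y \<in> G n"
      unfolding G_def B_def using x \<open>y \<in> S\<close> closure_subset[of "L ` {x \<in> S. norm x \<le> real n}"] by blast
    then show "y \<in> \<Union> (range G)" by blast
  qed
  then have un: "\<Union> (range G) = topspace X" unfolding X_def G_def by auto
  have "\<not> (\<forall>n. X interior_of G n = {})"
  proof
    assume empty: "\<forall>n. X interior_of G n = {}"
    have "X interior_of \<Union> (range G) = {}"
    proof (rule Baire_category_alt)
      show "completely_metrizable_space X \<or> locally_compact_space X \<and> regular_space X"
        unfolding X_def using assms(2)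
        by (simp add: completely_metrizable_space_closedin completely_metrizable_space_euclidean)
      fix T assume "T \<in> range G"
      then show "closedin X T \<and> X interior_of T = {}"
        using empty by (auto simp: X_def G_def closedin_closed_Int)
    qed auto
    then have "topspace X = {}" unfolding un interior_of_topspace .
    then show False using subspace_0[OF subspace] by (auto simp: X_def)
  qed
  then obtain n y0 where "y0 \<in> X interior_of G n" by blast
  moreover have "openin (top_of_set S) (X interior_of G n)" unfolding X_def by (rule openin_interior_of)
  ultimately obtain r where r: "r > 0" "y0 \<in> S" "ball y0 r \<inter> S \<subseteq> X interior_of G n"
    unfolding openin_contains_ball by blast
  have r_sub: "ball y0 r \<inter> S \<subseteq> G n"
    using r(3) interior_of_subset[of X "G n"] by (rule subset_trans)
  have near: "\<exists>x\<in>S. norm x \<le> 2 * real n \<and> norm (y - L x) < e"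
    if "y \<in> S" "norm y < r" "e > 0" for y e
  proof -
    have "y0 + y \<in> G n" using r r_sub that subspace_add[OF subspace] by (auto simp: dist_norm)
    then have "y0 + y \<in> closure (L ` B n)" by (simp add: G_def)
    then obtain u where u: "u \<in> B n" "dist (L u) (y0 + y) < e / 2"
      using \<open>e > 0\<close> unfolding closure_approachable by (auto dest!: spec[of _ "e / 2"])
    have "y0 \<in> G n" using r(1,2) r_sub by auto
    then have "y0 \<in> closure (L ` B n)" by (simp add: G_def)
    then obtain v where v: "v \<in> B n" "dist (L v) y0 < e / 2"
      using \<open>e > 0\<close> unfolding closure_approachable by (auto dest!: spec[of _ "e / 2"])
    have "norm (y - (L u - L v)) = norm ((y0 + y - L u) - (y0 - L v))" by (simp add: algebra_simps)
    also have "\<dots> \<le> norm (y0 + y - L u) + norm (y0 - L v)" by (rule norm_triangle_ineq4)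
    also have "\<dots> < e" using u(2) v(2) by (simp add: dist_norm norm_minus_commute)
    finally have "norm (y - L (u - v)) < e" using u(1) v(1) minus by (simp add: B_def)
    moreover have "norm (u - v) \<le> 2 * real n"
      using norm_triangle_ineq4[of u v] u(1) v(1) by (simp add: B_def)
    ultimately show ?thesis using u(1) v(1) subspace_diff[OF subspace] by (auto simp: B_def)
  qed
  show ?thesis
  proof
    \<comment> \<open>the summand \<open>1\<close> keeps the constant positive when \<open>n = 0\<close>\<close>
    show "4 * real n / r + 1 > 0" using r(1) by (simp add: add_nonneg_pos)
    fix y assume "y \<in> S"
    show "\<exists>x\<in>S. norm x \<le> (4 * real n / r + 1) * norm y \<and> norm (y - L x) \<le> norm y / 2"
    proof (cases "y = 0")
      case True
      then show ?thesis using subspace_0[OF subspace] zero by (intro bexI[of _ 0]) auto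
    next
      case False
      define c where "c = r / (2 * norm y)"
      have c: "c > 0" "c * norm y = r / 2" using False r(1) by (auto simp: c_def)
      obtain x where x: "x \<in> S" "norm x \<le> 2 * real n" "norm (c *\<^sub>R y - L x) < r / 4"
        using near[of "c *\<^sub>R y" "r / 4"] c r(1) \<open>y \<in> S\<close> subspace_scale[OF subspace] by auto
      have "norm (y - L ((1 / c) *\<^sub>R x)) = norm ((1 / c) *\<^sub>R (c *\<^sub>R y - L x))"
        using c(1) scale[OF x(1)] by (simp add: scaleR_diff_right)
      also have "\<dots> = (1 / c) * norm (c *\<^sub>R y - L x)" using c(1) by simp
      also have "\<dots> \<le> (1 / c) * (r / 4)" using c(1) x(3) by (intro mult_left_mono) auto
      also have "\<dots> = norm y / 2" using c r(1) by (simp add: field_simps c_def)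
      finally have 1: "norm (y - L ((1 / c) *\<^sub>R x)) \<le> norm y / 2" .
      have "norm ((1 / c) *\<^sub>R x) \<le> (1 / c) * (2 * real n)"
        using c(1) x(2) by (simp add: divide_right_mono)
      also have "\<dots> = (4 * real n / r) * norm y" using r(1) False by (simp add: c_def field_simps)
      also have "\<dots> \<le> (4 * real n / r + 1) * norm y" by (simp add: distrib_right)
      finally show ?thesis using 1 x(1) subspace_scale[OF subspace] by blast
    qed
  qed
qed

text \<open>
  Correcting the remaining error over and over turns approximate preimages into a geometric series
  whose sum is an exact preimage, bounded by a fixed multiple of \<open>norm (L x)\<close>; injectivity identifies
  it with \<open>x\<close>.
\<close>

lemma bounded_inverse_on:
  fixes S :: "'a::banach set"
  assumes "bounded_linear_on S L K" "closed S" "bij_betw L S S"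
  obtains C where "C > 0" "\<And>x. x \<in> S \<Longrightarrow> C * norm x \<le> norm (L x)"
proof -
  interpret bounded_linear_on S L K by fact
  have "L ` S = S" using assms(3) by (simp add: bij_betw_def)
  then obtain M where M: "M > 0"
      "\<And>y. y \<in> S \<Longrightarrow> \<exists>x\<in>S. norm x \<le> M * norm y \<and> norm (y - L x) \<le> norm y / 2"
    using open_mapping_approximate[OF assms(1,2)] by blast
  then obtain p where p: "\<And>y. y \<in> S \<Longrightarrow> p y \<in> S" "\<And>y. y \<in> S \<Longrightarrow> norm (p y) \<le> M * norm y"
      "\<And>y. y \<in> S \<Longrightarrow> norm (y - L (p y)) \<le> norm y / 2"
    by metis
  have LS: "L x \<in> S" if "x \<in> S" for x using \<open>L ` S = S\<close> that by blast
  have inverse_bound: "norm x \<le> (2 * M) * norm (L x)" if "x \<in> S" for x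
  proof -
    define y where "y k = ((\<lambda>y. y - L (p y)) ^^ k) (L x)" for k
    have y0: "y 0 = L x" and y_Suc: "y (Suc k) = y k - L (p (y k))" for k by (simp_all add: y_def)
    have yS: "y k \<in> S" for k
      by (induction k) (auto simp: y0 y_Suc LS that p subspace_diff[OF subspace])
    have ybound: "norm (y k) \<le> norm (L x) * (1/2)^k" for k
    proof (induction k)
      case (Suc k)
      then show ?case using p(3)[OF yS, of k] by (simp add: y_Suc)
    qed (simp add: y0)
    have pbound: "norm (p (y k)) \<le> (M * norm (L x)) * (1/2)^k" for k
    proof -
      have "norm (p (y k)) \<le> M * norm (y k)" by (rule p(2)[OF yS])
      also have "\<dots> \<le> M * (norm (L x) * (1/2)^k)" using M(1) ybound by (intro mult_left_mono) auto
      finally show ?thesis by (simp add: mult.assoc)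
    qed
    have sums: "(\<lambda>k. (M * norm (L x)) * (1/2)^k) sums ((M * norm (L x)) * 2)"
      using sums_mult[OF geometric_sums[of "1/2 :: real"]] by simp
    have ns: "summable (\<lambda>k. norm (p (y k)))"
      by (rule summable_comparison_test[OF _ sums_summable[OF sums]]) (use pbound in auto)
    define z where "z = (\<Sum>k. p (y k))"
    have part: "(\<lambda>n. \<Sum>k<n. p (y k)) \<longlonglongrightarrow> z"
      unfolding z_def using summable_LIMSEQ[OF summable_norm_cancel[OF ns]] .
    have partS: "(\<Sum>k<n. p (y k)) \<in> S" for n
      by (rule subspace_sum[OF subspace]) (rule p(1)[OF yS])
    have zS: "z \<in> S" using closed_sequentially[OF assms(2) partS part] .
    have "L (\<Sum>k<n. p (y k)) = L x - y n" for n
    proof (induction n)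
      case 0 then show ?case by (simp add: zero y0)
    next
      case (Suc n)
      then show ?case using add[OF partS p(1)[OF yS]] by (simp add: y_Suc)
    qed
    then have "(\<lambda>n. L x - y n) \<longlonglongrightarrow> L z" using tendsto[OF partS zS part] by simp
    moreover have "y \<longlonglongrightarrow> 0"
    proof (rule Lim_null_comparison)
      show "\<forall>\<^sub>F n in sequentially. norm (y n) \<le> norm (L x) * (1/2)^n" using ybound by simp
      show "(\<lambda>n. norm (L x) * (1/2)^n) \<longlonglongrightarrow> 0"
        by (rule tendsto_mult_right_zero) (rule LIMSEQ_power_zero, simp)
    qed
    then have "(\<lambda>n. L x - y n) \<longlonglongrightarrow> L x - 0" by (intro tendsto_intros)
    ultimately have "L z = L x" using LIMSEQ_unique by fastforce
    then have "z = x" using assms(3) zS that by (auto simp: bij_betw_def inj_on_def)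
    then show ?thesis
      using summable_norm[OF ns] suminf_le[OF pbound ns sums_summable[OF sums]] sums_unique[OF sums]
      by (simp add: z_def)
  qed
  show ?thesis
  proof
    show "1 / (2 * M) > 0" using M(1) by simp
    show "1 / (2 * M) * norm x \<le> norm (L x)" if "x \<in> S" for x
      using inverse_bound[OF that] M(1) by (simp add: field_simps)
  qed
qed

section \<open>Complex inner products\<close>

abbreviation csubspace :: "'a::complex_inner set \<Rightarrow> bool" where
  "csubspace \<equiv> complex_vector.subspace"

abbreviation cspan :: "'a::complex_inner set \<Rightarrow> 'a set" where
  "cspan \<equiv> complex_vector.span"

lemma scaleC_minus1: "(-1) *\<^sub>C x = - (x :: 'a::complex_inner)"
  using scaleC_of_real[of "-1" x] by simp

lemma scaleC_diff_right: "c *\<^sub>C (x - y) = c *\<^sub>C x - c *\<^sub>C (y :: 'a::complex_inner)"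
  by (simp add: complex_vector.scale_right_diff_distrib)

lemma cinner_add_right: "cinner x (y + z) = cinner x y + cinner x (z :: 'a::complex_inner)"
  by (subst (1 2 3) cinner_commute) (simp add: cinner_add_left)

lemma cinner_scaleC_right: "cinner x (c *\<^sub>C y) = cnj c * cinner x (y :: 'a::complex_inner)"
  by (subst (1 2) cinner_commute) (simp add: cinner_scaleC_left)

lemma cinner_diff_left: "cinner (x - y) z = cinner x z - cinner y (z :: 'a::complex_inner)"
  using cinner_add_left[of x "(-1) *\<^sub>C y" z] cinner_scaleC_left[of "-1" y z] by (simp add: scaleC_minus1)

lemma cinner_diff_right: "cinner x (y - z) = cinner x y - cinner x (z :: 'a::complex_inner)"
  using cinner_add_right[of x y "(-1) *\<^sub>C z"] cinner_scaleC_right[of x "-1" z] by (simp add: scaleC_minus1)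

lemma cinner_zero [simp]: "cinner 0 (x :: 'a::complex_inner) = 0" "cinner x (0 :: 'a) = 0"
  using cinner_diff_left[of x x x] cinner_diff_right[of x x x] by simp_all

lemma cinner_self: "cinner x x = of_real ((norm (x :: 'a::complex_inner))\<^sup>2)"
proof (rule complex_eqI)
  show "Re (cinner x x) = Re (of_real ((norm x)\<^sup>2))"
    by (simp add: power2_norm_eq_inner inner_eq_Re_cinner)
  have "Im (cinner x x) = - Im (cinner x x)"
    by (subst cinner_commute) simp
  then show "Im (cinner x x) = Im (of_real ((norm x)\<^sup>2))" by simp
qed

lemma norm_scaleC [simp]: "norm (c *\<^sub>C x) = cmod c * norm (x :: 'a::complex_inner)"
proof -
  have "complex_of_real ((norm (c *\<^sub>C x))\<^sup>2) = of_real ((cmod c * norm x)\<^sup>2)"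
    unfolding cinner_self[symmetric] cinner_scaleC_left cinner_scaleC_right
    by (simp add: cinner_self power_mult_distrib complex_norm_square del: of_real_power)
  then have "(norm (c *\<^sub>C x))\<^sup>2 = (cmod c * norm x)\<^sup>2" by (simp only: of_real_eq_iff)
  then show ?thesis by (subst (asm) power2_eq_iff_nonneg) auto
qed

text \<open>
  Rotating \<open>x\<close> by a unimodular scalar makes the inner product real and nonnegative, which reduces
  the claim to the real Cauchy--Schwarz inequality.
\<close>

lemma cinner_bound: "cmod (cinner x y) \<le> norm x * norm (y :: 'a::complex_inner)"
proof -
  define c where "c = cnj (sgn (cinner x y))"
  have "of_real (cmod (cinner x y)) = cinner (c *\<^sub>C x) y"
    by (simp add: c_def cinner_scaleC_left sgn_eq complex_norm_square[symmetric] power2_eq_square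
        mult.commute[of _ "cinner x y"])
  then have "cmod (cinner x y) = Re (cinner (c *\<^sub>C x) y)" by (metis Re_complex_of_real)
  also have "\<dots> = inner (c *\<^sub>C x) y" by (simp add: inner_eq_Re_cinner)
  also have "\<dots> \<le> norm (c *\<^sub>C x) * norm y" by (rule norm_cauchy_schwarz)
  also have "\<dots> \<le> (1 * norm x) * norm y"
    unfolding norm_scaleC by (intro mult_right_mono) (auto simp: c_def norm_sgn)
  finally show ?thesis by simp
qed

lemma csubspace_imp_subspace: "csubspace S \<Longrightarrow> subspace (S :: 'a::complex_inner set)"
  unfolding complex_vector.subspace_def subspace_def by (metis scaleC_of_real)

section \<open>Completeness of the space of square integrable functions\<close>

lemma rep_L2_measurable [measurable]: "rep_L2 f \<in> borel_measurable borel"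
  using square_integrable_rep_L2[of f] by (simp add: square_integrable_def)

lemma integrable_norm_square_rep_L2 [simp]: "integrable lborel (\<lambda>x. (cmod (rep_L2 f x))\<^sup>2)"
  using square_integrable_rep_L2[of f] by (simp add: square_integrable_def)

lemma abs_rep_L2 [simp]: "abs_L2 (rep_L2 f) = f"
  by (rule Quotient3_abs_rep[OF Quotient3_L2])

lemma abs_L2_eqI:
  assumes "square_integrable f" "square_integrable g" "AE x in lborel. f x = g x"
  shows "abs_L2 f = abs_L2 g"
  using Quotient3_rel_abs[OF Quotient3_L2, of f g] assms by (simp add: L2_rel_def)

lemma L2_eqI:
  assumes "AE x in lborel. rep_L2 f x = rep_L2 g x"
  shows "f = g"
  using abs_L2_eqI[OF square_integrable_rep_L2 square_integrable_rep_L2 assms] by simp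

lemma AE_rep_plus: "AE x in lborel. rep_L2 (f + g) x = rep_L2 f x + rep_L2 g x"
proof -
  have "f + g = abs_L2 (\<lambda>x. rep_L2 f x + rep_L2 g x)"
    using plus_L2.abs_eq[OF L2_rel_rep L2_rel_rep, of f g] by simp
  then show ?thesis
    using rep_abs_L2[OF square_integrable_add[OF square_integrable_rep_L2 square_integrable_rep_L2]]
    by simp
qed

lemma AE_rep_scaleC: "AE x in lborel. rep_L2 (c *\<^sub>C f) x = c * rep_L2 f x"
proof -
  have "c *\<^sub>C f = abs_L2 (\<lambda>x. c * rep_L2 f x)"
    using scaleC_L2.abs_eq[OF L2_rel_rep, of c f] by simp
  then show ?thesis
    using rep_abs_L2[OF square_integrable_cmult[OF square_integrable_rep_L2]] by simp
qed

lemma AE_rep_zero: "AE x in lborel. rep_L2 0 x = 0"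
  using rep_abs_L2[OF square_integrable_zero] by (simp add: zero_L2.abs_eq)

lemma AE_rep_diff: "AE x in lborel. rep_L2 (f - g) x = rep_L2 f x - rep_L2 g x"
proof -
  have "AE x in lborel. rep_L2 (f + (-1) *\<^sub>C g) x = rep_L2 f x + rep_L2 ((-1) *\<^sub>C g) x"
    by (rule AE_rep_plus)
  moreover have "f + (-1) *\<^sub>C g = f - g" unfolding minus_L2_def uminus_L2_def ..
  ultimately show ?thesis using AE_rep_scaleC[of "-1" g] by (auto elim: eventually_elim2)
qed

lemma cinner_L2_rep: "cinner f g = (\<integral>x. rep_L2 f x * cnj (rep_L2 g x) \<partial>lborel)"
  using cinner_L2.abs_eq[OF L2_rel_rep L2_rel_rep, of f g] by simp

lemma norm_L2_square: "(norm (f :: 'a::euclidean_space L2))\<^sup>2 = (\<integral>x. (cmod (rep_L2 f x))\<^sup>2 \<partial>lborel)"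
  unfolding norm_L2_def inner_L2_def by (simp add: L2_cinner_self)

lemma nn_norm_L2_square:
  "ennreal ((norm (f :: 'a::euclidean_space L2))\<^sup>2) = (\<integral>\<^sup>+x. ennreal ((cmod (rep_L2 f x))\<^sup>2) \<partial>lborel)"
  unfolding norm_L2_square by (rule nn_integral_eq_integral[symmetric]) auto

lemma square_integrable_iff_nn:
  assumes [measurable]: "f \<in> borel_measurable borel"
  shows "square_integrable f \<longleftrightarrow> (\<integral>\<^sup>+x. ennreal ((cmod (f x))\<^sup>2) \<partial>lborel) < \<infinity>"
  unfolding square_integrable_def integrable_iff_bounded by simp

lemma nn_norm_diff_L2:
  assumes "square_integrable g"
  shows "ennreal ((norm (f - abs_L2 g))\<^sup>2) = (\<integral>\<^sup>+x. ennreal ((cmod (rep_L2 f x - g x))\<^sup>2) \<partial>lborel)"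
  unfolding nn_norm_L2_square
  by (rule nn_integral_cong_AE) (use rep_abs_L2[OF assms] AE_rep_diff[of f "abs_L2 g"] in auto)

lemma Cauchy_rapid_subsequence:
  fixes X :: "nat \<Rightarrow> 'a::real_normed_vector"
  assumes "Cauchy X"
  obtains r where "strict_mono r" "\<And>n m. m \<ge> r n \<Longrightarrow> norm (X m - X (r n)) \<le> (1/2)^n"
proof -
  have "\<exists>N. \<forall>m\<ge>N. \<forall>k\<ge>N. norm (X m - X k) < (1/2)^n" for n :: nat
    using CauchyD[OF assms, of "(1/2)^n"] by auto
  then obtain N where N: "\<And>n m k. m \<ge> N n \<Longrightarrow> k \<ge> N n \<Longrightarrow> norm (X m - X k) < (1/2)^n"
    by metis
  \<comment> \<open>each index also exceeds the previous one, which makes the subsequence strictly increasing\<close>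
  define r where "r = rec_nat (N 0) (\<lambda>n p. max (Suc p) (N (Suc n)))"
  have r_Suc: "r (Suc n) = max (Suc (r n)) (N (Suc n))" for n by (simp add: r_def)
  have "strict_mono r" by (rule strict_monoI_Suc) (simp add: r_Suc)
  moreover have "r n \<ge> N n" for n by (cases n) (auto simp: r_Suc, simp add: r_def)
  then have "norm (X m - X (r n)) \<le> (1/2)^n" if "m \<ge> r n" for n m
    using N[of n m "r n"] that by (meson less_imp_le order_trans order_refl)
  ultimately show ?thesis by (rule that)
qed

text \<open>
  The weighted energy \<open>\<Sum>n. 2^n * |d n|\<^sup>2\<close> of the increments \<open>d n\<close> has finite integral and is
  therefore finite almost everywhere; since \<open>d n \<le> (1/2)^n + 2^n * |d n|\<^sup>2\<close>, the increments are
  summable there.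
\<close>

lemma L2_rapid_sequence_AE_convergent:
  fixes Y :: "nat \<Rightarrow> 'a::euclidean_space L2"
  assumes Y: "\<And>n m. m \<ge> n \<Longrightarrow> norm (Y m - Y n) \<le> (1/2)^n"
  shows "AE x in lborel. convergent (\<lambda>n. rep_L2 (Y n) x)"
proof -
  define d where "d n x = cmod (rep_L2 (Y (Suc n)) x - rep_L2 (Y n) x)" for n x
  have [measurable]: "d n \<in> borel_measurable borel" for n unfolding d_def by measurable
  have dn: "(\<integral>\<^sup>+x. ennreal ((d n x)\<^sup>2) \<partial>lborel) \<le> ennreal ((1/4)^n)" for n
  proof -
    have "(\<integral>\<^sup>+x. ennreal ((d n x)\<^sup>2) \<partial>lborel) = ennreal ((norm (Y (Suc n) - Y n))\<^sup>2)"
      unfolding nn_norm_L2_square d_def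
      by (rule nn_integral_cong_AE) (use AE_rep_diff[of "Y (Suc n)" "Y n"] in auto)
    also have "\<dots> \<le> ennreal (((1/2)^n)\<^sup>2)"
      using Y[of n "Suc n"] by (intro ennreal_leI power_mono) auto
    also have "((1/2::real)^n)\<^sup>2 = (1/4)^n"
      by (simp add: power2_eq_square power_mult_distrib[symmetric])
    finally show ?thesis .
  qed
  have "(\<integral>\<^sup>+x. (\<Sum>n. ennreal (2^n * (d n x)\<^sup>2)) \<partial>lborel) = (\<Sum>n. \<integral>\<^sup>+x. ennreal (2^n * (d n x)\<^sup>2) \<partial>lborel)"
    by (rule nn_integral_suminf) measurable
  also have "\<dots> = (\<Sum>n. ennreal (2^n) * (\<integral>\<^sup>+x. ennreal ((d n x)\<^sup>2) \<partial>lborel))"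
    by (subst nn_integral_cmult[symmetric]) (auto simp: ennreal_mult' simp del: ennreal_power)
  also have "\<dots> \<le> (\<Sum>n. ennreal ((1/2)^n))"
  proof (rule suminf_le)
    show "ennreal (2^n) * (\<integral>\<^sup>+x. ennreal ((d n x)\<^sup>2) \<partial>lborel) \<le> ennreal ((1/2)^n)" for n
    proof -
      have "ennreal (2^n) * (\<integral>\<^sup>+x. ennreal ((d n x)\<^sup>2) \<partial>lborel) \<le> ennreal (2^n) * ennreal ((1/4)^n)"
        by (rule mult_left_mono[OF dn]) simp
      also have "\<dots> = ennreal ((1/2)^n)"
        by (simp add: ennreal_mult'[symmetric] power_mult_distrib[symmetric] del: ennreal_power)
      finally show ?thesis .
    qed
  qed auto
  also have "\<dots> < \<infinity>"
    by (subst suminf_ennreal2) (auto intro: summable_geometric)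
  finally have "AE x in lborel. (\<Sum>n. ennreal (2^n * (d n x)\<^sup>2)) \<noteq> \<infinity>"
    by (intro nn_integral_PInf_AE) auto
  then show ?thesis
  proof eventually_elim
    case (elim x)
    have s: "summable (\<lambda>n. 2^n * (d n x)\<^sup>2)"
      by (rule summable_suminf_not_top) (use elim in auto)
    have "summable (\<lambda>n. (1/2)^n + 2^n * (d n x)\<^sup>2)"
      by (intro summable_add s summable_geometric) auto
    moreover have "d n x \<le> (1/2)^n + 2^n * (d n x)\<^sup>2" for n
    proof -
      have "0 \<le> 2^n * ((1/2)^n - d n x)\<^sup>2" by simp
      also have "\<dots> = (1/2)^n - 2 * d n x + 2^n * (d n x)\<^sup>2"
        by (simp add: power2_eq_square algebra_simps power_mult_distrib[symmetric])
      finally have "2 * d n x \<le> (1/2)^n + 2^n * (d n x)\<^sup>2" by simp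
      moreover have "0 \<le> d n x" by (simp add: d_def)
      ultimately show ?thesis by linarith
    qed
    ultimately have "summable (\<lambda>n. d n x)"
      by (rule_tac summable_comparison_test) (auto simp: d_def)
    then have "summable (\<lambda>n. rep_L2 (Y (Suc n)) x - rep_L2 (Y n) x)"
      unfolding d_def by (rule summable_norm_cancel)
    then have "convergent (\<lambda>n. \<Sum>i<n. rep_L2 (Y (Suc i)) x - rep_L2 (Y i) x)"
      by (simp add: summable_iff_convergent)
    then have "convergent (\<lambda>n. rep_L2 (Y n) x - rep_L2 (Y 0) x)"
      by (simp add: sum_lessThan_telescope[of "\<lambda>n. rep_L2 (Y n) x"])
    then show ?case
      by (simp add: convergent_diff_const_right_iff)
  qed
qed

text \<open>
  Fatou's lemma turns the pointwise limit into a limit in norm.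
\<close>

lemma L2_rapid_sequence_convergent:
  fixes Y :: "nat \<Rightarrow> 'a::euclidean_space L2"
  assumes Y: "\<And>n m. m \<ge> n \<Longrightarrow> norm (Y m - Y n) \<le> (1/2)^n"
  shows "\<exists>f. Y \<longlonglongrightarrow> f"
proof -
  define g where "g x = lim (\<lambda>n. rep_L2 (Y n) x)" for x
  have [measurable]: "g \<in> borel_measurable borel"
    unfolding g_def by (rule borel_measurable_lim_metric) measurable
  have "AE x in lborel. convergent (\<lambda>n. rep_L2 (Y n) x)"
    by (rule L2_rapid_sequence_AE_convergent) (rule Y)
  then have lim: "AE x in lborel. (\<lambda>n. rep_L2 (Y n) x) \<longlonglongrightarrow> g x"
    by eventually_elim (simp add: g_def convergent_LIMSEQ_iff)
  have bound: "(\<integral>\<^sup>+x. ennreal ((cmod (rep_L2 (Y n) x - g x))\<^sup>2) \<partial>lborel) \<le> ennreal ((1/4)^n)" for n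
  proof -
    have "(\<integral>\<^sup>+x. ennreal ((cmod (rep_L2 (Y n) x - g x))\<^sup>2) \<partial>lborel)
        = (\<integral>\<^sup>+x. liminf (\<lambda>m. ennreal ((cmod (rep_L2 (Y n) x - rep_L2 (Y m) x))\<^sup>2)) \<partial>lborel)"
    proof (rule nn_integral_cong_AE, use lim in eventually_elim)
      case (elim x)
      have "(\<lambda>m. ennreal ((cmod (rep_L2 (Y n) x - rep_L2 (Y m) x))\<^sup>2)) \<longlonglongrightarrow>
          ennreal ((cmod (rep_L2 (Y n) x - g x))\<^sup>2)"
        by (intro tendsto_intros tendsto_ennrealI elim)
      then show ?case by (rule lim_imp_Liminf[OF trivial_limit_sequentially, symmetric])
    qed
    also have "\<dots> \<le> liminf (\<lambda>m. \<integral>\<^sup>+x. ennreal ((cmod (rep_L2 (Y n) x - rep_L2 (Y m) x))\<^sup>2) \<partial>lborel)"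
      by (rule nn_integral_liminf) measurable
    also have "\<dots> = liminf (\<lambda>m. ennreal ((norm (Y n - Y m))\<^sup>2))"
    proof -
      have "(\<integral>\<^sup>+x. ennreal ((cmod (rep_L2 (Y n) x - rep_L2 (Y m) x))\<^sup>2) \<partial>lborel)
           = ennreal ((norm (Y n - Y m))\<^sup>2)" for m
        unfolding nn_norm_L2_square
        by (rule nn_integral_cong_AE) (use AE_rep_diff[of "Y n" "Y m"] in auto)
      then show ?thesis by simp
    qed
    also have "\<dots> \<le> ennreal ((1/4)^n)"
    proof (rule Liminf_le)
      have "ennreal ((norm (Y n - Y m))\<^sup>2) \<le> ennreal ((1/4)^n)" if "m \<ge> n" for m
      proof -
        have "(norm (Y n - Y m))\<^sup>2 \<le> ((1/2)^n)\<^sup>2"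
          using Y[OF that] by (intro power_mono) (auto simp: norm_minus_commute)
        also have "((1/2::real)^n)\<^sup>2 = (1/4)^n"
          by (simp add: power2_eq_square power_mult_distrib[symmetric])
        finally show ?thesis by (rule ennreal_leI)
      qed
      then show "\<forall>\<^sub>F m in sequentially. ennreal ((norm (Y n - Y m))\<^sup>2) \<le> ennreal ((1/4)^n)"
        by (auto simp: eventually_sequentially)
    qed simp
    finally show ?thesis .
  qed
  have diff: "square_integrable (\<lambda>x. rep_L2 (Y 0) x - g x)"
    using bound[of 0] by (subst square_integrable_iff_nn) (auto simp: le_less_trans)
  have sq: "square_integrable g"
    using square_integrable_add[OF square_integrable_rep_L2[of "Y 0"] square_integrable_cmult[OF diff, of "-1"]]
    by simp
  have "norm (Y n - abs_L2 g) \<le> (1/2)^n" for n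
  proof -
    have "ennreal ((norm (Y n - abs_L2 g))\<^sup>2) \<le> ennreal ((1/4)^n)"
      using bound[of n] unfolding nn_norm_diff_L2[OF sq, of "Y n"] .
    then have "(norm (Y n - abs_L2 g))\<^sup>2 \<le> (1/4)^n" by (subst (asm) ennreal_le_iff) simp_all
    also have "(1/4)^n = ((1/2::real)^n)\<^sup>2"
      by (simp add: power2_eq_square power_mult_distrib[symmetric])
    finally show ?thesis by (rule power2_le_imp_le) simp
  qed
  moreover have "(\<lambda>n. (1/2::real)^n) \<longlonglongrightarrow> 0" by (rule LIMSEQ_power_zero) simp
  ultimately have "(\<lambda>n. Y n - abs_L2 g) \<longlonglongrightarrow> 0"
    by (rule_tac Lim_null_comparison[OF always_eventually]) auto
  then show ?thesis by (auto intro: LIM_zero_cancel)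
qed

text \<open>
  The Riesz--Fischer theorem.
\<close>

instance L2 :: (euclidean_space) complete_space
proof
  fix X :: "nat \<Rightarrow> 'a L2"
  assume X: "Cauchy X"
  obtain r where r: "strict_mono r" "\<And>n m. m \<ge> r n \<Longrightarrow> norm (X m - X (r n)) \<le> (1/2)^n"
    using Cauchy_rapid_subsequence[OF X] by blast
  have "norm ((X \<circ> r) m - (X \<circ> r) n) \<le> (1/2)^n" if "m \<ge> n" for n m
    using r(2)[of n "r m"] strict_mono_less_eq[OF r(1)] that by simp
  then obtain f where "(X \<circ> r) \<longlonglongrightarrow> f"
    using L2_rapid_sequence_convergent by blast
  then have "X \<longlonglongrightarrow> f"
    using X r(1) Cauchy_converges_subseq by metis
  then show "convergent X" by (rule convergentI)
qed

instance L2 :: (euclidean_space) banach ..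

section \<open>Approximation and translation in \<open>L\<^sup>2\<close>\<close>

lemma integral_lborel_affine:
  fixes f :: "'a::euclidean_space \<Rightarrow> 'b::{banach, second_countable_topology}"
  assumes "c > 0" and [measurable]: "f \<in> borel_measurable borel"
  shows "(\<integral>x. f x \<partial>lborel) = (c ^ DIM('a)) *\<^sub>R (\<integral>x. f (t + c *\<^sub>R x) \<partial>lborel)"
proof -
  have "(\<integral>x. f x \<partial>lborel) =
      (\<integral>x. f x \<partial>(density (distr lborel borel (\<lambda>x. t + c *\<^sub>R x)) (\<lambda>_. ennreal (\<bar>c\<bar> ^ DIM('a)))))"
    using lborel_affine[of c t] assms(1) by simp
  also have "\<dots> = (\<integral>x. (\<bar>c\<bar> ^ DIM('a)) *\<^sub>R f x \<partial>(distr lborel borel (\<lambda>x. t + c *\<^sub>R x)))"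
    by (rule integral_density) auto
  also have "\<dots> = (\<integral>x. (\<bar>c\<bar> ^ DIM('a)) *\<^sub>R f (t + c *\<^sub>R x) \<partial>lborel)"
    by (rule integral_distr) auto
  finally show ?thesis using assms(1) by simp
qed

lemma integral_lborel_translate:
  fixes f :: "'a::euclidean_space \<Rightarrow> 'b::{banach, second_countable_topology}"
  assumes "f \<in> borel_measurable borel"
  shows "(\<integral>x. f (x - t) \<partial>lborel) = (\<integral>x. f x \<partial>lborel)"
  using integral_lborel_affine[OF zero_less_one assms, of "- t"] by simp

definition truncation :: "nat \<Rightarrow> ('a::euclidean_space \<Rightarrow> complex) \<Rightarrow> 'a \<Rightarrow> complex" where
  "truncation n f x = (if norm x \<le> real n then f x else 0)"

lemma truncation_measurable [measurable]:
  "f \<in> borel_measurable borel \<Longrightarrow> truncation n f \<in> borel_measurable borel"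
proof -
  assume [measurable]: "f \<in> borel_measurable borel"
  have [measurable]: "cball (0::'a) (real n) \<in> sets borel" by simp
  have "(\<lambda>x. if x \<in> cball 0 (real n) then f x else 0) \<in> borel_measurable borel" by measurable
  then show ?thesis by (simp add: truncation_def[abs_def])
qed

lemma square_integrable_bound:
  assumes "square_integrable g" and [measurable]: "f \<in> borel_measurable borel" 
    and "\<And>x. cmod (f x) \<le> cmod (g x)"
  shows "square_integrable f"
proof -
  have "integrable lborel (\<lambda>x. (cmod (f x))\<^sup>2)"
    by (rule Bochner_Integration.integrable_bound[of _ "\<lambda>x. (cmod (g x))\<^sup>2"])
       (use assms in \<open>auto simp: square_integrable_def power_mono\<close>)
  then show ?thesis by (simp add: square_integrable_def)
qed

lemma square_integrable_truncation:
  assumes "square_integrable f"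
  shows "square_integrable (truncation n f)"
  by (rule square_integrable_bound[OF assms])
     (use assms in \<open>auto simp: truncation_def square_integrable_def intro!: truncation_measurable\<close>)

lemma square_integrable_dominated_convergence:
  fixes g :: "nat \<Rightarrow> 'a::euclidean_space \<Rightarrow> complex"
  assumes [measurable]: "f \<in> borel_measurable borel" "\<And>n. g n \<in> borel_measurable borel"
    and w: "integrable lborel w"
    and lim: "AE x in lborel. (\<lambda>n. g n x) \<longlonglongrightarrow> f x"
    and bound: "\<And>n. AE x in lborel. (cmod (g n x - f x))\<^sup>2 \<le> w x"
  shows "(\<lambda>n. \<integral>x. (cmod (g n x - f x))\<^sup>2 \<partial>lborel) \<longlonglongrightarrow> 0"
proof -
  have "(\<lambda>n. \<integral>x. (cmod (g n x - f x))\<^sup>2 \<partial>lborel) \<longlonglongrightarrow> integral\<^sup>L (lborel :: 'a measure) (\<lambda>_. 0)"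
  proof (rule integral_dominated_convergence[OF _ _ w])
    show "AE x in lborel. (\<lambda>n. (cmod (g n x - f x))\<^sup>2) \<longlonglongrightarrow> 0"
      using lim
    proof eventually_elim
      case (elim x)
      then have "(\<lambda>n. (cmod (g n x - f x))\<^sup>2) \<longlonglongrightarrow> (cmod (f x - f x))\<^sup>2" by (intro tendsto_intros)
      then show ?case by simp
    qed
  qed (use bound in auto)
  then show ?thesis by simp
qed

lemma norm_L2_abs_diff_square:
  assumes "square_integrable f" "square_integrable g"
  shows "(norm (abs_L2 f - abs_L2 g))\<^sup>2 = (\<integral>x. (cmod (f x - g x))\<^sup>2 \<partial>lborel)"
proof -
  have [measurable]: "f \<in> borel_measurable borel" "g \<in> borel_measurable borel"
    using assms by (auto simp: square_integrable_def)
  show ?thesis unfolding norm_L2_square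
    by (rule integral_cong_AE)
       (use rep_abs_L2[OF assms(1)] rep_abs_L2[OF assms(2)] AE_rep_diff[of "abs_L2 f" "abs_L2 g"] in auto)
qed

lemma tendsto_norm_square_zero:
  fixes f :: "nat \<Rightarrow> 'a::real_normed_vector"
  assumes "(\<lambda>n. (norm (f n - l))\<^sup>2) \<longlonglongrightarrow> 0"
  shows "f \<longlonglongrightarrow> l"
proof -
  have "(\<lambda>n. sqrt ((norm (f n - l))\<^sup>2)) \<longlonglongrightarrow> sqrt 0" by (intro tendsto_intros assms)
  then show ?thesis by (simp add: tendsto_norm_zero_iff LIM_zero_iff)
qed

lemma abs_L2_dominated_convergence:
  fixes g :: "nat \<Rightarrow> 'a::euclidean_space \<Rightarrow> complex"
  assumes "square_integrable f" "\<And>n. square_integrable (g n)" "integrable lborel w"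
    "AE x in lborel. (\<lambda>n. g n x) \<longlonglongrightarrow> f x"
    "\<And>n. AE x in lborel. (cmod (g n x - f x))\<^sup>2 \<le> w x"
  shows "(\<lambda>n. abs_L2 (g n)) \<longlonglongrightarrow> abs_L2 f"
proof (rule tendsto_norm_square_zero)
  show "(\<lambda>n. (norm (abs_L2 (g n) - abs_L2 f))\<^sup>2) \<longlonglongrightarrow> 0"
    using square_integrable_dominated_convergence[OF _ _ assms(3-5)] assms(1,2)
    by (simp add: norm_L2_abs_diff_square) (simp add: square_integrable_def)
qed

lemma truncation_tendsto:
  assumes "square_integrable f"
  shows "(\<lambda>n. abs_L2 (truncation n f)) \<longlonglongrightarrow> abs_L2 f"
proof (rule abs_L2_dominated_convergence[OF assms square_integrable_truncation[OF assms]])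
  show "integrable lborel (\<lambda>x. (cmod (f x))\<^sup>2)" using assms by (simp add: square_integrable_def)
  show "AE x in lborel. (\<lambda>n. truncation n f x) \<longlonglongrightarrow> f x"
  proof (rule AE_I2)
    fix x :: 'a
    obtain N where N: "norm x \<le> real N" using real_arch_simple by blast
    have "\<forall>\<^sub>F n in sequentially. f x = truncation n f x"
      using eventually_ge_at_top[of N] by eventually_elim (use N in \<open>auto simp: truncation_def\<close>)
    then show "(\<lambda>n. truncation n f x) \<longlonglongrightarrow> f x"
      by (rule Lim_transform_eventually[OF tendsto_const])
  qed
qed (auto simp: truncation_def)

lemma integrable_indicator_ball: "integrable lborel (indicator (cball (0::'a::euclidean_space) r) :: 'a \<Rightarrow> real)"
  using emeasure_lborel_cball_finite[of 0 r] by (intro integrable_real_indicator) auto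

lemma integrable_truncation:
  assumes "square_integrable f"
  shows "integrable lborel (truncation n f)"
proof (rule Bochner_Integration.integrable_bound)
  show "integrable lborel (\<lambda>x. indicator (cball 0 (real n)) x + (cmod (f x))\<^sup>2)"
    using assms by (intro Bochner_Integration.integrable_add integrable_indicator_ball)
       (simp add: square_integrable_def)
  show "truncation n f \<in> borel_measurable lborel"
    using assms by (auto simp: square_integrable_def intro: truncation_measurable)
  have "t \<le> 1 + t\<^sup>2" if "0 \<le> t" for t :: real
    using zero_le_power2[of "t - 1"] that by (simp add: power2_diff)
  then show "AE x in lborel. norm (truncation n f x) \<le> norm (indicator (cball 0 (real n)) x + (cmod (f x))\<^sup>2)"
    by (auto simp: truncation_def indicator_def)
qed

text \<open>
  A continuous retraction of the plane onto the disc of radius \<open>M\<close>.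
\<close>

definition clamp_disc :: "real \<Rightarrow> complex \<Rightarrow> complex" where
  "clamp_disc M z = (M / max M (cmod z)) *\<^sub>R z"

lemma clamp_disc:
  assumes "M > 0"
  shows "cmod (clamp_disc M z) \<le> M" "cmod z \<le> M \<Longrightarrow> clamp_disc M z = z"
    "continuous_on UNIV (clamp_disc M)"
proof -
  show "cmod (clamp_disc M z) \<le> M"
    using assms by (auto simp: clamp_disc_def max_def field_simps)
  show "cmod z \<le> M \<Longrightarrow> clamp_disc M z = z"
    using assms by (auto simp: clamp_disc_def max_def)
  have "max M (cmod z) \<noteq> 0" for z using assms by (auto simp: max_def)
  then show "continuous_on UNIV (clamp_disc M)"
    unfolding clamp_disc_def by (intro continuous_intros) auto
qed

text \<open>
  A measurable function is an almost everywhere limit of continuous functions.  Clamping their values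
  and multiplying by a continuous cut-off keeps the limit and adds the uniform bounds that dominated
  convergence needs.
\<close>

lemma bounded_support_bounded_approx:
  fixes f :: "'a::euclidean_space \<Rightarrow> complex"
  assumes f [measurable]: "f \<in> borel_measurable borel"
    and "M > 0" and bound: "\<And>x. cmod (f x) \<le> M" and supp: "\<And>x. norm x > r \<Longrightarrow> f x = 0"
  obtains g where "\<And>n. continuous_on UNIV (g n)" "\<And>n x. cmod (g n x) \<le> M"
    "\<And>n x. norm x > r + 1 \<Longrightarrow> g n x = 0" "AE x in lborel. (\<lambda>n. g n x) \<longlonglongrightarrow> f x"
proof -
  have "f \<in> borel_measurable lebesgue" by (rule measurable_completion) simp
  then have "f measurable_on UNIV"
    by (subst measurable_on_iff_borel_measurable) auto
  then obtain N h where h: "negligible N" "\<And>n. continuous_on UNIV (h n)"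
      "\<And>x. x \<notin> N \<Longrightarrow> (\<lambda>n. h n x) \<longlonglongrightarrow> f x"
    unfolding measurable_on_def by auto
  \<comment> \<open>equal to \<open>1\<close> on the ball of radius \<open>r\<close> and to \<open>0\<close> beyond radius \<open>r + 1\<close>\<close>
  define c where "c x = max 0 (min 1 (r + 1 - norm x))" for x :: 'a
  define g where "g n x = c x *\<^sub>R clamp_disc M (h n x)" for n x
  show ?thesis
  proof
    show "continuous_on UNIV (g n)" for n
      unfolding g_def c_def
      by (intro continuous_intros continuous_on_compose2[OF clamp_disc(3)[OF \<open>M > 0\<close>] h(2)]) auto
    show "cmod (g n x) \<le> M" for n x
    proof -
      have "cmod (g n x) = c x * cmod (clamp_disc M (h n x))" by (simp add: g_def c_def)
      also have "\<dots> \<le> 1 * M" using clamp_disc(1)[OF \<open>M > 0\<close>] \<open>M > 0\<close>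
        by (intro mult_mono) (auto simp: c_def)
      finally show ?thesis by simp
    qed
    show "norm x > r + 1 \<Longrightarrow> g n x = 0" for n x by (simp add: g_def c_def)
    have "(\<lambda>n. g n x) \<longlonglongrightarrow> f x" if "x \<notin> N" for x
    proof -
      have "isCont (clamp_disc M) (f x)"
        using clamp_disc(3)[OF \<open>M > 0\<close>] by (simp add: continuous_on_eq_continuous_at)
      then have "(\<lambda>n. clamp_disc M (h n x)) \<longlonglongrightarrow> clamp_disc M (f x)"
        by (rule isCont_tendsto_compose) (rule h(3)[OF that])
      then have "(\<lambda>n. g n x) \<longlonglongrightarrow> c x *\<^sub>R clamp_disc M (f x)"
        unfolding g_def by (intro tendsto_intros)
      also have "c x *\<^sub>R clamp_disc M (f x) = f x"
      proof (cases "norm x > r")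
        case True
        then show ?thesis using supp by (simp add: clamp_disc_def)
      next
        case False
        then have "c x = 1" by (simp add: c_def)
        then show ?thesis using clamp_disc(2)[OF \<open>M > 0\<close> bound] by simp
      qed
      finally show ?thesis .
    qed
    moreover have "AE x in lborel. x \<notin> N"
    proof -
      have "N \<in> null_sets lebesgue" using h(1) by (simp add: negligible_iff_null_sets)
      then have "AE x in lebesgue. x \<notin> N" by (rule AE_not_in)
      then show ?thesis by (simp add: AE_completion_iff)
    qed
    ultimately show "AE x in lborel. (\<lambda>n. g n x) \<longlonglongrightarrow> f x" by (auto elim: eventually_mono)
  qed
qed

definition continuous_bounded_support :: "('a::euclidean_space \<Rightarrow> complex) \<Rightarrow> bool" where
  "continuous_bounded_support g \<longleftrightarrow> continuous_on UNIV g \<and> (\<exists>M. \<forall>x. cmod (g x) \<le> M) \<and> (\<exists>r. \<forall>x. norm x > r \<longrightarrow> g x = 0)"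

lemma integrable_const_on_ball: "integrable lborel (\<lambda>x::'a::euclidean_space. (M::real) * indicator (cball 0 r) x)"
  using integrable_indicator_ball by (intro integrable_mult_right)

lemma square_integrable_bounded_support:
  assumes [measurable]: "g \<in> borel_measurable borel" 
    and "\<And>x. cmod (g x) \<le> M" and "\<And>x. norm x > r \<Longrightarrow> g x = 0"
  shows "square_integrable g"
proof -
  have "integrable lborel (\<lambda>x. (cmod (g x))\<^sup>2)"
    by (rule Bochner_Integration.integrable_bound[OF integrable_const_on_ball[of "M\<^sup>2" r]])
       (use assms in \<open>auto simp: indicator_def power_mono dist_norm not_le\<close>)
  then show ?thesis by (simp add: square_integrable_def)
qed

lemma continuous_bounded_support_dense:
  assumes "square_integrable f" "e > 0"
  obtains g where "continuous_bounded_support g" "square_integrable g" "norm (abs_L2 g - abs_L2 f) < e"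
proof -
  have [measurable]: "f \<in> borel_measurable borel" using assms by (simp add: square_integrable_def)
  define t where "t n x = (if cmod (f x) \<le> real n then truncation n f x else 0)" for n x
  have [measurable]: "t n \<in> borel_measurable borel" for n unfolding t_def by measurable
  have t_sq: "square_integrable (t n)" for n
    by (rule square_integrable_bound[OF assms(1)]) (auto simp: t_def truncation_def)
  have "(\<lambda>n. abs_L2 (t n)) \<longlonglongrightarrow> abs_L2 f"
  proof (rule abs_L2_dominated_convergence[OF assms(1) t_sq])
    show "integrable lborel (\<lambda>x. (cmod (f x))\<^sup>2)" using assms by (simp add: square_integrable_def)
    show "AE x in lborel. (\<lambda>n. t n x) \<longlonglongrightarrow> f x"
    proof (rule AE_I2)
      fix x :: 'a
      obtain N where N: "max (norm x) (cmod (f x)) \<le> real N" using real_arch_simple by blast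
      have "\<forall>\<^sub>F n in sequentially. f x = t n x"
        using eventually_ge_at_top[of N] by eventually_elim (use N in \<open>auto simp: t_def truncation_def\<close>)
      then show "(\<lambda>n. t n x) \<longlonglongrightarrow> f x"
        by (rule Lim_transform_eventually[OF tendsto_const])
    qed
  qed (auto simp: truncation_def t_def)
  then obtain n where n: "norm (abs_L2 (t n) - abs_L2 f) < e / 2"
    using LIMSEQ_D[of _ _ "e / 2"] assms(2) by (metis half_gt_zero order_refl)
  \<comment> \<open>one is added only to make the bound positive\<close>
  define M where "M = real n + 1"
  obtain g where g: "\<And>m. continuous_on UNIV (g m)" "\<And>m x. cmod (g m x) \<le> M"
      "\<And>m x. norm x > real n + 1 \<Longrightarrow> g m x = 0" "AE x in lborel. (\<lambda>m. g m x) \<longlonglongrightarrow> t n x"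
    by (rule bounded_support_bounded_approx[of "t n" M "real n"]) (auto simp: t_def truncation_def M_def)
  have [measurable]: "g m \<in> borel_measurable borel" for m
    by (rule borel_measurable_continuous_onI) (rule g(1))
  have g_sq: "square_integrable (g m)" for m
    by (rule square_integrable_bounded_support[of _ M "real n + 1"]) (use g in auto)
  have "(\<lambda>m. abs_L2 (g m)) \<longlonglongrightarrow> abs_L2 (t n)"
  proof (rule abs_L2_dominated_convergence[OF t_sq g_sq integrable_const_on_ball[of "(2 * M)\<^sup>2" "real n + 1"] g(4)])
    fix m
    have "(cmod (g m x - t n x))\<^sup>2 \<le> (2 * M)\<^sup>2 * indicator (cball 0 (real n + 1)) x" for x
    proof (cases "norm x > real n + 1")
      case True
      then show ?thesis using g(3) by (simp add: t_def truncation_def)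
    next
      case False
      have "cmod (g m x - t n x) \<le> M + M"
        using g(2)[of m x] by (intro order_trans[OF norm_triangle_ineq4] add_mono) (auto simp: t_def truncation_def M_def)
      then have "(cmod (g m x - t n x))\<^sup>2 \<le> (2 * M)\<^sup>2" by (intro power_mono) auto
      then show ?thesis using False by (simp add: indicator_def dist_norm)
    qed
    then show "AE x in lborel. (cmod (g m x - t n x))\<^sup>2 \<le> (2 * M)\<^sup>2 * indicator (cball 0 (real n + 1)) x"
      by simp
  qed
  then obtain m where m: "norm (abs_L2 (g m) - abs_L2 (t n)) < e / 2"
    using LIMSEQ_D[of _ _ "e / 2"] assms(2) by (metis half_gt_zero order_refl)
  show ?thesis
  proof
    show "continuous_bounded_support (g m)" unfolding continuous_bounded_support_def using g by blast
    show "square_integrable (g m)" by (rule g_sq)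
    show "norm (abs_L2 (g m) - abs_L2 f) < e"
      using norm_triangle_lt[of "abs_L2 (g m) - abs_L2 (t n)" "abs_L2 (t n) - abs_L2 f" e] n m by simp
  qed
qed

lemma translate_abs: "square_integrable f \<Longrightarrow> translate t (abs_L2 f) = abs_L2 (\<lambda>x. f (x - t))"
  by (rule translate.abs_eq) (simp add: L2_rel_def)

lemma AE_rep_translate: "AE x in lborel. rep_L2 (translate t f) x = rep_L2 f (x - t)"
  using translate_abs[OF square_integrable_rep_L2, of t f]
    rep_abs_L2[OF square_integrable_translate[OF square_integrable_rep_L2]] by simp

lemma norm_translate [simp]: "norm (translate t f) = norm f"
proof -
  have "(norm (translate t f))\<^sup>2 = (\<integral>x. (cmod (rep_L2 f (x - t)))\<^sup>2 \<partial>lborel)"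
    unfolding norm_L2_square
    by (rule integral_cong_AE) (use AE_rep_translate[of t f] in auto)
  also have "\<dots> = (norm f)\<^sup>2"
    unfolding norm_L2_square by (rule integral_lborel_translate[where f = "\<lambda>x. (cmod (rep_L2 f x))\<^sup>2"]) simp
  finally show ?thesis by simp
qed

lemma translate_diff: "translate t (f - g) = translate t f - translate t g"
proof (rule L2_eqI)
  show "AE x in lborel. rep_L2 (translate t (f - g)) x = rep_L2 (translate t f - translate t g) x"
    using AE_rep_translate[of t "f - g"] AE_rep_translate[of t f] AE_rep_translate[of t g]
      AE_rep_diff[of "translate t f" "translate t g"] AE_lborel_translate[OF AE_rep_diff[of f g], of t]
    by eventually_elim simp
qed

lemma translate_tendsto_continuous:
  fixes g :: "'a::euclidean_space \<Rightarrow> complex"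
  assumes "continuous_bounded_support g" "square_integrable g" "t \<longlonglongrightarrow> 0"
  shows "(\<lambda>n. translate (t n) (abs_L2 g)) \<longlonglongrightarrow> abs_L2 g"
proof -
  obtain M r where g: "continuous_on UNIV g" "\<And>x. cmod (g x) \<le> M" "\<And>x. norm x > r \<Longrightarrow> g x = 0"
    using assms(1) unfolding continuous_bounded_support_def by blast
  obtain T where T: "\<And>n. norm (t n) \<le> T"
    using convergent_imp_Bseq[OF convergentI[OF assms(3)]] unfolding Bseq_def by blast
  have "(\<lambda>n. abs_L2 (\<lambda>x. g (x - t n))) \<longlonglongrightarrow> abs_L2 g"
  proof (rule abs_L2_dominated_convergence[OF assms(2) square_integrable_translate[OF assms(2)]
        integrable_const_on_ball[of "(2 * M)\<^sup>2" "r + T"]])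
    have "(\<lambda>n. g (x - t n)) \<longlonglongrightarrow> g x" for x
    proof (rule isCont_tendsto_compose[of x g])
      show "isCont g x" using g(1) by (simp add: continuous_on_eq_continuous_at)
      show "(\<lambda>n. x - t n) \<longlonglongrightarrow> x" using tendsto_diff[OF tendsto_const assms(3), of x] by simp
    qed
    then show "AE x in lborel. (\<lambda>n. g (x - t n)) \<longlonglongrightarrow> g x" by simp
    have "(cmod (g (x - t n) - g x))\<^sup>2 \<le> (2 * M)\<^sup>2 * indicator (cball 0 (r + T)) x" for n x
    proof (cases "norm x > r + T")
      case True
      have "norm x \<le> norm (x - t n) + norm (t n)" using norm_triangle_ineq[of "x - t n" "t n"] by simp
      moreover have "0 \<le> T" using T[of n] norm_ge_zero order_trans by blast
      ultimately have "norm (x - t n) > r" "norm x > r" using True T[of n] by auto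
      then show ?thesis using g(3) by simp
    next
      case False
      have "cmod (g (x - t n) - g x) \<le> M + M"
        using g(2) by (intro order_trans[OF norm_triangle_ineq4] add_mono)
      then have "(cmod (g (x - t n) - g x))\<^sup>2 \<le> (2 * M)\<^sup>2" by (intro power_mono) auto
      then show ?thesis using False by (simp add: indicator_def dist_norm)
    qed
    then show "AE x in lborel. (cmod (g (x - t n) - g x))\<^sup>2 \<le> (2 * M)\<^sup>2 * indicator (cball 0 (r + T)) x" for n
      by blast
  qed
  then show ?thesis by (simp add: translate_abs[OF assms(2)])
qed

text \<open>
  Continuity of translation: clear for continuous functions of bounded support, and carried to all of
  \<open>L\<^sup>2\<close> because translations are isometries.
\<close>

lemma translate_tendsto:
  fixes f :: "'a::euclidean_space L2"
  assumes "t \<longlonglongrightarrow> 0"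
  shows "(\<lambda>n. translate (t n) f) \<longlonglongrightarrow> f"
proof (rule LIMSEQ_I)
  fix e :: real assume "e > 0"
  obtain g where g: "continuous_bounded_support g" "square_integrable g" "norm (abs_L2 g - f) < e / 3"
    using continuous_bounded_support_dense[OF square_integrable_rep_L2[of f], of "e / 3"] \<open>e > 0\<close> by auto
  define h where "h = abs_L2 g"
  obtain N where N: "\<And>n. n \<ge> N \<Longrightarrow> norm (translate (t n) h - h) < e / 3"
    using LIMSEQ_D[OF translate_tendsto_continuous[OF g(1,2) assms], of "e / 3"] \<open>e > 0\<close>
    by (auto simp: h_def)
  have "norm (translate (t n) f - f) < e" if "n \<ge> N" for n
  proof -
    have "norm (translate (t n) f - f) =
        norm ((translate (t n) h - h) + (h - f) - translate (t n) (h - f))"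
      by (simp add: translate_diff)
    also have "\<dots> \<le> norm (translate (t n) h - h) + norm (h - f) + norm (translate (t n) (h - f))"
      by (intro order_trans[OF norm_triangle_ineq4] add_right_mono norm_triangle_ineq)
    also have "\<dots> < e / 3 + e / 3 + e / 3"
      using N[OF that] g(3) by (simp add: h_def)
    finally show ?thesis by simp
  qed
  then show "\<exists>N. \<forall>n\<ge>N. norm (translate (t n) f - f) < e" by blast
qed

section \<open>Gaussian windows and Plancherel's identity\<close>

lemma lborel_integral_product:
  fixes f :: "'a::euclidean_space \<Rightarrow> real \<Rightarrow> complex"
  assumes f: "\<And>b. b \<in> Basis \<Longrightarrow> integrable lborel (f b)"
  shows "integrable lborel (\<lambda>x. \<Prod>b\<in>Basis. f b (x \<bullet> b))"
    and "(\<integral>x. (\<Prod>b\<in>Basis. f b (x \<bullet> b)) \<partial>lborel) = (\<Prod>b\<in>Basis. \<integral>t. f b t \<partial>lborel)"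
proof -
  interpret product_sigma_finite "\<lambda>_::'a. lborel :: real measure"
    by (simp add: product_sigma_finite_def sigma_finite_lborel)
  have eq: "(lborel :: 'a measure) = distr (Pi\<^sub>M Basis (\<lambda>b::'a. lborel)) borel (\<lambda>g. \<Sum>b\<in>Basis. g b *\<^sub>R b)"
    unfolding lborel_eq_real by (rule lborel_def)
  have [measurable]: "f b \<in> borel_measurable borel" if "b \<in> Basis" for b
    using borel_measurable_integrable[OF f[OF that]] by simp
  have m1: "(\<lambda>g. \<Sum>b\<in>Basis. g b *\<^sub>R b) \<in> Pi\<^sub>M Basis (\<lambda>b::'a. lborel) \<rightarrow>\<^sub>M (borel :: 'a measure)"
    by measurable
  have m2: "(\<lambda>x. \<Prod>b\<in>Basis. f b (x \<bullet> b)) \<in> borel_measurable (borel :: 'a measure)"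
    by measurable
  have coord: "(\<Prod>b\<in>Basis. f b ((\<Sum>b\<in>Basis. g b *\<^sub>R b) \<bullet> b)) = (\<Prod>b\<in>Basis. f b (g b))" for g :: "'a \<Rightarrow> real"
    by (rule prod.cong) auto
  show "integrable lborel (\<lambda>x. \<Prod>b\<in>Basis. f b (x \<bullet> b))"
    unfolding eq integrable_distr_eq[OF m1 m2] coord
    by (rule product_integrable_prod) (use f in auto)
  have "(\<integral>x. (\<Prod>b\<in>Basis. f b (x \<bullet> b)) \<partial>lborel) = (\<integral>g. (\<Prod>b\<in>Basis. f b (g b)) \<partial>(Pi\<^sub>M Basis (\<lambda>b::'a. lborel)))"
    by (subst eq, subst integral_distr[OF m1 m2], simp only: coord)
  also have "\<dots> = (\<Prod>b\<in>Basis. \<integral>t. f b t \<partial>lborel)"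
    by (rule product_integral_prod) (use f in auto)
  finally show "(\<integral>x. (\<Prod>b\<in>Basis. f b (x \<bullet> b)) \<partial>lborel) = (\<Prod>b\<in>Basis. \<integral>t. f b t \<partial>lborel)" .
qed

lemma borel_measurable_cnj [measurable (raw)]:
  "f \<in> borel_measurable M \<Longrightarrow> (\<lambda>x. cnj (f x)) \<in> borel_measurable M"
  by (rule measurable_compose[OF _ borel_measurable_continuous_onI]) (auto intro: continuous_intros)

text \<open>
  The standard normal density in \<open>DIM('a)\<close> dimensions.
\<close>

definition gauss :: "'a::euclidean_space \<Rightarrow> real" where
  "gauss x = (1 / sqrt (2 * pi)) ^ DIM('a) * exp (- (norm x)\<^sup>2 / 2)"

lemma gauss_nonneg [simp]: "0 \<le> gauss x"
  by (simp add: gauss_def)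

lemma gauss_measurable [measurable]: "gauss \<in> borel_measurable borel"
  unfolding gauss_def by measurable

lemma exp_norm_square_eq_prod:
  "exp (- (norm x)\<^sup>2 / 2) = (\<Prod>b\<in>Basis. exp (- (x \<bullet> b)\<^sup>2 / 2))" for x :: "'a::euclidean_space"
proof -
  have "- (norm x)\<^sup>2 / 2 = - (\<Sum>b\<in>Basis. (x \<bullet> b) * (x \<bullet> b)) / 2"
    unfolding power2_norm_eq_inner by (subst euclidean_inner) simp
  also have "\<dots> = (\<Sum>b\<in>Basis. - (x \<bullet> b)\<^sup>2 / 2)"
    by (simp only: power2_eq_square sum_negf[symmetric] sum_divide_distrib)
  finally show ?thesis by (simp only: exp_sum finite_Basis)
qed

lemma gauss_eq_prod: "gauss (x :: 'a::euclidean_space) = (\<Prod>b\<in>Basis. std_normal_density (x \<bullet> b))"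
  unfolding gauss_def exp_norm_square_eq_prod std_normal_density_def prod.distrib prod_constant ..

lemma gauss_fourier_product:
  "complex_of_real (gauss x) * exp (- (\<i> * complex_of_real (x \<bullet> u))) =
     (\<Prod>b\<in>Basis. complex_of_real (std_normal_density (x \<bullet> b)) * exp (\<i> * complex_of_real (- (u \<bullet> b) * (x \<bullet> b))))"
proof -
  have "- (\<i> * complex_of_real (x \<bullet> u)) = - (\<i> * complex_of_real (\<Sum>b\<in>Basis. (x \<bullet> b) * (u \<bullet> b)))"
    by (subst euclidean_inner) simp
  also have "\<dots> = (\<Sum>b\<in>Basis. \<i> * complex_of_real (- (u \<bullet> b) * (x \<bullet> b)))"
    by (simp add: sum_distrib_left sum_negf mult.commute)
  finally have "exp (- (\<i> * complex_of_real (x \<bullet> u))) = (\<Prod>b\<in>Basis. exp (\<i> * complex_of_real (- (u \<bullet> b) * (x \<bullet> b))))"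
    by (simp only: exp_sum finite_Basis)
  then show ?thesis unfolding gauss_eq_prod prod.distrib by simp
qed

lemma std_normal_fourier:
  "integrable lborel (\<lambda>t. complex_of_real (std_normal_density t) * exp (\<i> * complex_of_real (s * t)))"
  "(\<integral>t. complex_of_real (std_normal_density t) * exp (\<i> * complex_of_real (s * t)) \<partial>lborel)
     = complex_of_real (exp (- s\<^sup>2 / 2))"
proof -
  show "integrable lborel (\<lambda>t. complex_of_real (std_normal_density t) * exp (\<i> * complex_of_real (s * t)))"
    by (rule Bochner_Integration.integrable_bound[OF integrable_normal_density[of 1 0]])
       (auto simp: norm_mult)
  have "complex_of_real (exp (- s\<^sup>2 / 2)) = char std_normal_distribution s"
    by (simp add: char_std_normal_distribution)
  also have "\<dots> = (\<integral>t. complex_of_real (std_normal_density t) * exp (\<i> * complex_of_real (s * t)) \<partial>lborel)"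
    unfolding char_def by (subst integral_density) (auto simp: scaleR_conv_of_real)
  finally show "(\<integral>t. complex_of_real (std_normal_density t) * exp (\<i> * complex_of_real (s * t)) \<partial>lborel)
     = complex_of_real (exp (- s\<^sup>2 / 2))" ..
qed

lemma gauss_fourier:
  fixes u :: "'a::euclidean_space"
  shows "integrable lborel (\<lambda>x. complex_of_real (gauss x) * exp (- (\<i> * complex_of_real (x \<bullet> u))))"
    and "(\<integral>x. complex_of_real (gauss x) * exp (- (\<i> * complex_of_real (x \<bullet> u))) \<partial>lborel)
       = complex_of_real (exp (- (norm u)\<^sup>2 / 2))"
proof -
  note p = lborel_integral_product[of "\<lambda>b t. complex_of_real (std_normal_density t) * exp (\<i> * complex_of_real (- (u \<bullet> b) * t))",
      OF std_normal_fourier(1)]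
  show "integrable lborel (\<lambda>x. complex_of_real (gauss x) * exp (- (\<i> * complex_of_real (x \<bullet> u))))"
    unfolding gauss_fourier_product by (rule p(1))
  show "(\<integral>x. complex_of_real (gauss x) * exp (- (\<i> * complex_of_real (x \<bullet> u))) \<partial>lborel)
       = complex_of_real (exp (- (norm u)\<^sup>2 / 2))"
    unfolding gauss_fourier_product p(2) std_normal_fourier(2) exp_norm_square_eq_prod[of u]
    by (simp del: of_real_exp)
qed

lemma integrable_gauss: "integrable lborel gauss"
  using integrable_norm[OF gauss_fourier(1)[of 0]] by simp

lemma integral_gauss: "(\<integral>x. gauss x \<partial>lborel) = 1"
  using gauss_fourier(2)[of 0] by (simp add: of_real_eq_1_iff)

definition fchar :: "'a::euclidean_space \<Rightarrow> 'a \<Rightarrow> complex" where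
  "fchar \<omega> x = exp (- 2 * complex_of_real pi * \<i> * complex_of_real (\<omega> \<bullet> x))"

lemma fourier_integral_fchar: "fourier_integral f \<omega> = (\<integral>x. f x * fchar \<omega> x \<partial>lborel)"
  by (simp add: fourier_integral_def fchar_def)

lemma norm_fchar [simp]: "cmod (fchar \<omega> x) = 1"
  by (simp add: fchar_def)

lemma fchar_commute: "fchar \<omega> x = fchar x \<omega>"
  by (simp add: fchar_def inner_commute)

lemma fchar_diff: "fchar (y - x) \<omega> = cnj (fchar x \<omega>) * fchar y \<omega>"
  by (simp add: fchar_def exp_cnj inner_diff_left algebra_simps exp_add[symmetric])

lemma fchar_measurable [measurable (raw)]:
  assumes [measurable]: "f \<in> borel_measurable M" "g \<in> borel_measurable M"
  shows "(\<lambda>x. fchar (f x) (g x)) \<in> borel_measurable M"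
  unfolding fchar_def by measurable

lemma fourier_integral_bound: "cmod (fourier_integral f \<omega>) \<le> (\<integral>x. cmod (f x) \<partial>lborel)"
  unfolding fourier_integral_fchar
  by (rule order_trans[OF integral_norm_bound]) (simp add: norm_mult)

lemma fourier_integral_measurable [measurable]:
  assumes [measurable]: "f \<in> borel_measurable borel"
  shows "fourier_integral f \<in> borel_measurable borel"
proof -
  have "(\<lambda>\<omega>. \<integral>x. f x * fchar \<omega> x \<partial>lborel) \<in> borel_measurable borel"
    by (rule lborel.borel_measurable_lebesgue_integral) (simp add: case_prod_beta, measurable)
  then show ?thesis by (simp add: fourier_integral_fchar[abs_def])
qed

lemma integrable_times_fchar:
  assumes "integrable lborel f"
  shows "integrable lborel (\<lambda>x. f x * fchar \<omega> x)"
proof -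
  have [measurable]: "f \<in> borel_measurable borel" using borel_measurable_integrable[OF assms] by simp
  show ?thesis
    by (rule Bochner_Integration.integrable_bound[OF integrable_norm[OF assms]]) (auto simp: norm_mult)
qed

lemma fourier_integral_add:
  assumes "integrable lborel f" "integrable lborel g"
  shows "fourier_integral (\<lambda>x. f x + g x) \<omega> = fourier_integral f \<omega> + fourier_integral g \<omega>"
  unfolding fourier_integral_fchar
  by (simp add: distrib_right integrable_times_fchar assms)

lemma fourier_integral_cmult:
  shows "fourier_integral (\<lambda>x. c * f x) \<omega> = c * fourier_integral f \<omega>"
  unfolding fourier_integral_fchar by (simp add: mult.assoc)

lemma fourier_integral_cong_AE:
  assumes "AE x in lborel. f x = g x" and [measurable]: "f \<in> borel_measurable borel" "g \<in> borel_measurable borel"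
  shows "fourier_integral f \<omega> = fourier_integral g \<omega>"
  unfolding fourier_integral_fchar
  by (rule integral_cong_AE) (use assms(1) in auto)

text \<open>
  Both sides are the double integral of \<open>f x * fchar \<omega> x * h \<omega>\<close>.
\<close>

lemma fourier_integral_multiplication:
  fixes f h :: "'a::euclidean_space \<Rightarrow> complex"
  assumes f: "integrable lborel f" and h: "integrable lborel h"
  shows "(\<integral>\<omega>. fourier_integral f \<omega> * h \<omega> \<partial>lborel) = (\<integral>x. f x * fourier_integral h x \<partial>lborel)"
proof -
  note [measurable] = borel_measurable_integrable[OF f] borel_measurable_integrable[OF h]
  have int: "integrable (lborel \<Otimes>\<^sub>M lborel) (\<lambda>(x, \<omega>). f x * fchar \<omega> x * h \<omega>)"
  proof (rule lborel_pair.Fubini_integrable)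
    show "(\<lambda>(x, \<omega>). f x * fchar \<omega> x * h \<omega>) \<in> borel_measurable (lborel \<Otimes>\<^sub>M lborel)"
      by measurable
    have "(\<lambda>x. \<integral>\<omega>. norm (f x * fchar \<omega> x * h \<omega>) \<partial>lborel) = (\<lambda>x. cmod (f x) * (\<integral>\<omega>. cmod (h \<omega>) \<partial>lborel))"
      by (simp add: norm_mult)
    then show "integrable lborel (\<lambda>x. \<integral>\<omega>. norm (case (x, \<omega>) of (x, \<omega>) \<Rightarrow> f x * fchar \<omega> x * h \<omega>) \<partial>lborel)"
      using f by simp
    show "AE x in lborel. integrable lborel (\<lambda>\<omega>. case (x, \<omega>) of (x, \<omega>) \<Rightarrow> f x * fchar \<omega> x * h \<omega>)"
      using integrable_mult_right[OF integrable_times_fchar[OF h], of "f _"]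
      by (simp add: fchar_commute[of _ x for x] mult.assoc mult.commute[of "fchar _ _"])
  qed
  have "(\<integral>\<omega>. fourier_integral f \<omega> * h \<omega> \<partial>lborel) = (\<integral>\<omega>. (\<integral>x. f x * fchar \<omega> x * h \<omega> \<partial>lborel) \<partial>lborel)"
    by (simp add: fourier_integral_fchar)
  also have "\<dots> = (\<integral>x. (\<integral>\<omega>. f x * fchar \<omega> x * h \<omega> \<partial>lborel) \<partial>lborel)"
    using lborel_pair.Fubini_integral[OF int] by simp
  also have "\<dots> = (\<integral>x. f x * fourier_integral h x \<partial>lborel)"
    by (simp add: fourier_integral_fchar fchar_commute mult.assoc mult.commute[of "fchar _ _"])
  finally show ?thesis .
qed

text \<open>
  The factor \<open>2 * pi * \<epsilon>\<close> is chosen so that the transform of the window is the Gaussian density of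
  width \<open>\<epsilon>\<close>, that is, \<open>gauss\<close> rescaled by \<open>\<epsilon>\<close>.
\<close>

definition window :: "real \<Rightarrow> 'a::euclidean_space \<Rightarrow> real" where
  "window \<epsilon> \<omega> = exp (- (norm ((2 * pi * \<epsilon>) *\<^sub>R \<omega>))\<^sup>2 / 2)"

lemma window_measurable [measurable]: "window \<epsilon> \<in> borel_measurable borel"
  unfolding window_def by measurable

lemma window_eq_gauss: "window \<epsilon> \<omega> = sqrt (2 * pi) ^ DIM('a) * gauss ((2 * pi * \<epsilon>) *\<^sub>R (\<omega> :: 'a::euclidean_space))"
  by (simp add: window_def gauss_def power_one_over)

lemma integrable_window:
  assumes "\<epsilon> > 0"
  shows "integrable lborel (window \<epsilon> :: 'a::euclidean_space \<Rightarrow> real)"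
proof -
  have c: "2 * pi * \<epsilon> > 0" using assms by simp
  have "(\<integral>\<omega>. gauss ((2 * pi * \<epsilon>) *\<^sub>R (\<omega> :: 'a)) \<partial>lborel) \<noteq> 0"
    using integral_lborel_affine[OF c gauss_measurable[where 'a = 'a], of 0] by (auto simp: integral_gauss)
  then have "integrable lborel (\<lambda>\<omega> :: 'a. gauss ((2 * pi * \<epsilon>) *\<^sub>R \<omega>))"
    using not_integrable_integral_eq by blast
  then show ?thesis unfolding window_eq_gauss by simp
qed

lemma fourier_window:
  fixes v :: "'a::euclidean_space"
  assumes "\<epsilon> > 0"
  shows "(\<integral>\<omega>. complex_of_real (window \<epsilon> \<omega>) * fchar v \<omega> \<partial>lborel) = complex_of_real (gauss ((1 / \<epsilon>) *\<^sub>R v) / \<epsilon> ^ DIM('a))"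
proof -
  define n where "n = DIM('a)"
  define W where "W = (\<integral>\<omega>. complex_of_real (window \<epsilon> \<omega>) * fchar v \<omega> \<partial>lborel)"
  have c: "2 * pi * \<epsilon> > 0" using assms by simp
  define \<phi> where "\<phi> u = complex_of_real (gauss u) * exp (- (\<i> * complex_of_real (u \<bullet> ((1 / \<epsilon>) *\<^sub>R v))))" for u :: 'a
  have [measurable]: "\<phi> \<in> borel_measurable borel" unfolding \<phi>_def by measurable
  have scaled: "\<phi> ((2 * pi * \<epsilon>) *\<^sub>R \<omega>) = complex_of_real ((1 / sqrt (2 * pi)) ^ n) * (complex_of_real (window \<epsilon> \<omega>) * fchar v \<omega>)" for \<omega>
    using assms by (simp add: \<phi>_def window_eq_gauss fchar_def n_def inner_commute power_one_over field_simps)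
  have "complex_of_real (exp (- (norm ((1 / \<epsilon>) *\<^sub>R v))\<^sup>2 / 2)) = (\<integral>u. \<phi> u \<partial>lborel)"
    unfolding \<phi>_def gauss_fourier(2) ..
  also have "\<dots> = ((2 * pi * \<epsilon>) ^ n) *\<^sub>R (\<integral>\<omega>. \<phi> (0 + (2 * pi * \<epsilon>) *\<^sub>R \<omega>) \<partial>lborel)"
    unfolding n_def by (rule integral_lborel_affine[OF c]) measurable
  also have "\<dots> = complex_of_real ((2 * pi * \<epsilon>) ^ n * (1 / sqrt (2 * pi)) ^ n) * W"
    unfolding add_0 scaled integral_mult_right_zero W_def by (simp add: scaleR_conv_of_real)
  also have "(2 * pi * \<epsilon>) ^ n * (1 / sqrt (2 * pi)) ^ n = sqrt (2 * pi) ^ n * \<epsilon> ^ n"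
  proof -
    have "(2 * pi * \<epsilon>) * (1 / sqrt (2 * pi)) = sqrt (2 * pi) * \<epsilon>"
      using real_sqrt_mult_self[of "2 * pi"] by (simp add: field_simps)
    then show ?thesis by (simp only: power_mult_distrib[symmetric])
  qed
  finally have "W = complex_of_real (exp (- (norm ((1 / \<epsilon>) *\<^sub>R v))\<^sup>2 / 2)) / complex_of_real (sqrt (2 * pi) ^ n * \<epsilon> ^ n)"
    using assms by (simp add: nonzero_eq_divide_eq mult.commute)
  also have "\<dots> = complex_of_real (gauss ((1 / \<epsilon>) *\<^sub>R v) / \<epsilon> ^ n)"
    by (simp add: gauss_def n_def power_one_over)
  finally show ?thesis by (simp add: W_def n_def)
qed

text \<open>
  The multiplication formula is used twice: it first moves the transform from \<open>f\<close> to the window times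
  the conjugate transform, and then, inside, onto the window times a character.
\<close>

lemma windowed_energy:
  fixes f :: "'a::euclidean_space \<Rightarrow> complex"
  assumes f: "integrable lborel f" and "\<epsilon> > 0"
  shows "(\<integral>\<omega>. fourier_integral f \<omega> * (cnj (fourier_integral f \<omega>) * complex_of_real (window \<epsilon> \<omega>)) \<partial>lborel)
     = (\<integral>x. f x * cnj (\<integral>s. f (x + \<epsilon> *\<^sub>R s) * complex_of_real (gauss s) \<partial>lborel) \<partial>lborel)"
proof -
  have fm [measurable]: "f \<in> borel_measurable borel" using borel_measurable_integrable[OF f] by simp
  define h where "h \<omega> = cnj (fourier_integral f \<omega>) * complex_of_real (window \<epsilon> \<omega>)" for \<omega>
  have [measurable]: "h \<in> borel_measurable borel"
    unfolding h_def by measurable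
  have w: "integrable lborel (\<lambda>\<omega>::'a. complex_of_real (window \<epsilon> \<omega>))"
    using integrable_window[OF assms(2), where 'a = 'a] by simp
  have "integrable lborel (\<lambda>\<omega>::'a. (\<integral>x. cmod (f x) \<partial>lborel) * window \<epsilon> \<omega>)"
    using integrable_window[OF assms(2), where 'a = 'a] by simp
  then have h: "integrable lborel h"
  proof (rule Bochner_Integration.integrable_bound)
    show "AE \<omega> in lborel. norm (h \<omega>) \<le> norm ((\<integral>x. cmod (f x) \<partial>lborel) * window \<epsilon> \<omega>)"
      by (auto simp: h_def norm_mult window_def intro!: mult_right_mono order_trans[OF fourier_integral_bound])
  qed simp
  have inner: "fourier_integral h x = cnj (\<integral>s. f (x + \<epsilon> *\<^sub>R s) * complex_of_real (gauss s) \<partial>lborel)" for x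
  proof -
    have int: "integrable lborel (\<lambda>\<omega>. complex_of_real (window \<epsilon> \<omega>) * cnj (fchar x \<omega>))"
      by (rule Bochner_Integration.integrable_bound[OF w]) (auto simp: norm_mult)
    have "fourier_integral h x = cnj (\<integral>\<omega>. fourier_integral f \<omega> * (complex_of_real (window \<epsilon> \<omega>) * cnj (fchar x \<omega>)) \<partial>lborel)"
      unfolding fourier_integral_fchar h_def by (simp add: mult.assoc flip: Bochner_Integration.integral_cnj)
    also have "(\<integral>\<omega>. fourier_integral f \<omega> * (complex_of_real (window \<epsilon> \<omega>) * cnj (fchar x \<omega>)) \<partial>lborel)
        = (\<integral>y. f y * fourier_integral (\<lambda>\<omega>. complex_of_real (window \<epsilon> \<omega>) * cnj (fchar x \<omega>)) y \<partial>lborel)"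
      by (rule fourier_integral_multiplication[OF f int])
    also have "\<dots> = (\<integral>y. f y * complex_of_real (gauss ((1 / \<epsilon>) *\<^sub>R (y - x)) / \<epsilon> ^ DIM('a)) \<partial>lborel)"
      unfolding fourier_integral_fchar fourier_window[OF assms(2), symmetric] fchar_diff by (simp only: mult.assoc)
    also have "\<dots> = (\<epsilon> ^ DIM('a)) *\<^sub>R (\<integral>s. f (x + \<epsilon> *\<^sub>R s) *
        complex_of_real (gauss ((1 / \<epsilon>) *\<^sub>R (x + \<epsilon> *\<^sub>R s - x)) / \<epsilon> ^ DIM('a)) \<partial>lborel)"
      by (rule integral_lborel_affine[OF assms(2)]) measurable
    also have "\<dots> = (\<integral>s. f (x + \<epsilon> *\<^sub>R s) * complex_of_real (gauss s) \<partial>lborel)"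
      using assms(2) by (simp flip: integral_scaleR_right) (simp add: scaleR_conv_of_real)
    finally show ?thesis .
  qed
  show ?thesis
    using fourier_integral_multiplication[OF f h] unfolding inner h_def .
qed

lemma integrable_product_translate:
  fixes f :: "'a::euclidean_space \<Rightarrow> complex"
  assumes "square_integrable f"
  shows "integrable lborel (\<lambda>x. f x * cnj (f (x - t)))"
    "(\<integral>x. cmod (f x * cnj (f (x - t))) \<partial>lborel) \<le> 2 * (norm (abs_L2 f))\<^sup>2"
    "(\<integral>x. f x * cnj (f (x - t)) \<partial>lborel) = cinner (abs_L2 f) (translate t (abs_L2 f))"
proof -
  have [measurable]: "f \<in> borel_measurable borel" using assms by (simp add: square_integrable_def)
  have sq: "integrable lborel (\<lambda>x. (cmod (f x))\<^sup>2)" "integrable lborel (\<lambda>x. (cmod (f (x - t)))\<^sup>2)"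
    using assms square_integrable_translate[OF assms, of t] by (auto simp: square_integrable_def)
  show int: "integrable lborel (\<lambda>x. f x * cnj (f (x - t)))"
    by (rule square_integrable_cinner[OF assms square_integrable_translate[OF assms]])
  have n: "(\<integral>x. (cmod (f x))\<^sup>2 \<partial>lborel) = (norm (abs_L2 f))\<^sup>2"
    unfolding norm_L2_square
    by (rule integral_cong_AE) (use rep_abs_L2[OF assms] in auto)
  have "(\<integral>x. cmod (f x * cnj (f (x - t))) \<partial>lborel) \<le> (\<integral>x. (cmod (f x))\<^sup>2 + (cmod (f (x - t)))\<^sup>2 \<partial>lborel)"
    by (rule integral_mono[OF integrable_norm[OF int]]) (use sq cmod_mult_cnj_le in auto)
  also have "\<dots> = 2 * (norm (abs_L2 f))\<^sup>2"
    using sq integral_lborel_translate[of "\<lambda>x. (cmod (f x))\<^sup>2" t] n by simp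
  finally show "(\<integral>x. cmod (f x * cnj (f (x - t))) \<partial>lborel) \<le> 2 * (norm (abs_L2 f))\<^sup>2" .
  show "(\<integral>x. f x * cnj (f (x - t)) \<partial>lborel) = cinner (abs_L2 f) (translate t (abs_L2 f))"
    unfolding translate_abs[OF assms]
    by (rule cinner_L2.abs_eq[symmetric])
       (use assms square_integrable_translate[OF assms] in \<open>auto simp: L2_rel_def\<close>)
qed

text \<open>
  Exchanging the order of integration leaves, for each \<open>s\<close>, the correlation of \<open>f\<close> with its translate
  by \<open>- (\<epsilon> *\<^sub>R s)\<close>.
\<close>

lemma windowed_energy_autocorrelation:
  fixes f :: "'a::euclidean_space \<Rightarrow> complex"
  assumes "square_integrable f"
  shows "(\<integral>x. f x * cnj (\<integral>s. f (x + \<epsilon> *\<^sub>R s) * complex_of_real (gauss s) \<partial>lborel) \<partial>lborel)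
     = (\<integral>s. complex_of_real (gauss s) * cinner (abs_L2 f) (translate (- (\<epsilon> *\<^sub>R s)) (abs_L2 f)) \<partial>lborel)"
proof -
  let ?u = "\<lambda>s x. complex_of_real (gauss s) * (f x * cnj (f (x + \<epsilon> *\<^sub>R s)))"
  have [measurable]: "f \<in> borel_measurable borel" using assms by (simp add: square_integrable_def)
  note t = integrable_product_translate[OF assms, of "- (\<epsilon> *\<^sub>R s)" for s, simplified]
  have int: "integrable (lborel \<Otimes>\<^sub>M lborel) (\<lambda>(s, x). ?u s x)"
  proof (rule lborel_pair.Fubini_integrable)
    show "(\<lambda>(s, x). ?u s x) \<in> borel_measurable (lborel \<Otimes>\<^sub>M lborel)"
      by measurable
    have "integrable lborel (\<lambda>s::'a. gauss s * (2 * (norm (abs_L2 f))\<^sup>2))"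
      using integrable_gauss[where 'a = 'a] by simp
    then show "integrable lborel (\<lambda>s. \<integral>x. norm (case (s, x) of (s, x) \<Rightarrow> ?u s x) \<partial>lborel)"
    proof (rule Bochner_Integration.integrable_bound)
      show "AE s in lborel. norm (\<integral>x. norm (case (s, x) of (s, x) \<Rightarrow> ?u s x) \<partial>lborel)
          \<le> norm (gauss s * (2 * (norm (abs_L2 f))\<^sup>2))"
        using t(2) by (auto simp: norm_mult[of "complex_of_real _"] intro!: mult_left_mono)
    qed measurable
    show "AE s in lborel. integrable lborel (\<lambda>x. case (s, x) of (s, x) \<Rightarrow> ?u s x)"
      using t(1) by simp
  qed
  have "(\<integral>x. f x * cnj (\<integral>s. f (x + \<epsilon> *\<^sub>R s) * complex_of_real (gauss s) \<partial>lborel) \<partial>lborel)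
      = (\<integral>x. (\<integral>s. ?u s x \<partial>lborel) \<partial>lborel)"
    by (simp add: mult_ac flip: Bochner_Integration.integral_cnj integral_mult_right_zero)
  also have "\<dots> = (\<integral>s. (\<integral>x. ?u s x \<partial>lborel) \<partial>lborel)"
    using lborel_pair.Fubini_integral[OF int] by simp
  also have "\<dots> = (\<integral>s. complex_of_real (gauss s) * cinner (abs_L2 f) (translate (- (\<epsilon> *\<^sub>R s)) (abs_L2 f)) \<partial>lborel)"
    by (simp add: t(3))
  finally show ?thesis .
qed

lemma windowed_energy_tendsto:
  fixes F :: "'a::euclidean_space L2"
  assumes "e \<longlonglongrightarrow> 0"
  shows "(\<lambda>n. \<integral>s. complex_of_real (gauss s) * cinner F (translate (- (e n *\<^sub>R s)) F) \<partial>lborel)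
     \<longlonglongrightarrow> complex_of_real ((norm F)\<^sup>2)"
proof -
  define f where "f = rep_L2 F"
  have sq: "square_integrable f" and F: "F = abs_L2 f"
    by (simp_all add: f_def square_integrable_rep_L2)
  have [measurable]: "f \<in> borel_measurable borel" using sq by (simp add: square_integrable_def)
  have m: "(\<lambda>s. cinner F (translate (- (e n *\<^sub>R s)) F)) \<in> borel_measurable borel" for n
  proof -
    have "(\<lambda>s. \<integral>x. f x * cnj (f (x - (- (e n *\<^sub>R s)))) \<partial>lborel) \<in> borel_measurable borel"
      by (rule lborel.borel_measurable_lebesgue_integral) (simp add: case_prod_beta, measurable)
    then show ?thesis unfolding F integrable_product_translate(3)[OF sq] .
  qed
  have "(\<lambda>n. \<integral>s. complex_of_real (gauss s) * cinner F (translate (- (e n *\<^sub>R s)) F) \<partial>lborel)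
     \<longlonglongrightarrow> (\<integral>s. complex_of_real (gauss (s :: 'a)) * complex_of_real ((norm F)\<^sup>2) \<partial>lborel)"
  proof (rule integral_dominated_convergence)
    show "integrable lborel (\<lambda>s::'a. gauss s * (norm F)\<^sup>2)" using integrable_gauss[where 'a = 'a] by simp
    show "AE s in lborel. (\<lambda>n. complex_of_real (gauss s) * cinner F (translate (- (e n *\<^sub>R s)) F))
        \<longlonglongrightarrow> complex_of_real (gauss s) * complex_of_real ((norm F)\<^sup>2)"
    proof (rule AE_I2)
      fix s :: 'a
      have "(\<lambda>n. - (e n *\<^sub>R s)) \<longlonglongrightarrow> - (0 *\<^sub>R s)" by (intro tendsto_intros assms)
      then have "(\<lambda>n. translate (- (e n *\<^sub>R s)) F) \<longlonglongrightarrow> F" by (intro translate_tendsto) simp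
      then have "(\<lambda>n. norm (translate (- (e n *\<^sub>R s)) F - F)) \<longlonglongrightarrow> 0"
        using LIM_zero tendsto_norm_zero by blast
      then have lim: "(\<lambda>n. norm F * norm (translate (- (e n *\<^sub>R s)) F - F)) \<longlonglongrightarrow> 0"
        by (rule tendsto_mult_right_zero)
      have "(\<lambda>n. cinner F (translate (- (e n *\<^sub>R s)) F) - cinner F F) \<longlonglongrightarrow> 0"
        by (rule Lim_null_comparison[OF always_eventually lim])
           (use cinner_bound in \<open>auto simp flip: cinner_diff_right\<close>)
      then have "(\<lambda>n. cinner F (translate (- (e n *\<^sub>R s)) F)) \<longlonglongrightarrow> cinner F F"
        by (rule LIM_zero_cancel)
      then show "(\<lambda>n. complex_of_real (gauss s) * cinner F (translate (- (e n *\<^sub>R s)) F))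
        \<longlonglongrightarrow> complex_of_real (gauss s) * complex_of_real ((norm F)\<^sup>2)"
        unfolding cinner_self by (intro tendsto_intros)
    qed
    show "AE s in lborel. norm (complex_of_real (gauss s) * cinner F (translate (- (e n *\<^sub>R s)) F)) \<le> gauss s * (norm F)\<^sup>2" for n
      using cinner_bound[of F "translate _ F"]
      by (auto simp: norm_mult power2_eq_square intro!: mult_left_mono)
  qed (use m in measurable)
  then show ?thesis
    using integral_gauss[where 'a='a] by (simp del: of_real_mult of_real_power add: of_real_mult[symmetric])
qed

text \<open>
  As the window opens, the windowed energies increase to the energy of the transform by monotone
  convergence, while the Gaussian averages of the autocorrelation tend to the energy of \<open>f\<close>.
\<close>

theorem plancherel_L1_L2:
  fixes f :: "'a::euclidean_space \<Rightarrow> complex"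
  assumes "integrable lborel f" "square_integrable f"
  shows "square_integrable (fourier_integral f)"
    and "norm (abs_L2 (fourier_integral f)) = norm (abs_L2 f)"
proof -
  have [measurable]: "f \<in> borel_measurable borel" using assms by (simp add: square_integrable_def)
  define e where "e n = 1 / real (Suc n)" for n
  have e: "e n > 0" for n by (simp add: e_def)
  have e0: "e \<longlonglongrightarrow> 0" unfolding e_def by (rule LIMSEQ_Suc[OF lim_1_over_n])
  define u where "u n \<omega> = (cmod (fourier_integral f \<omega>))\<^sup>2 * window (e n) \<omega>" for n \<omega>
  have eq: "fourier_integral f \<omega> * (cnj (fourier_integral f \<omega>) * complex_of_real (window (e n) \<omega>)) = complex_of_real (u n \<omega>)" for n \<omega>
    unfolding u_def of_real_mult complex_norm_square mult.assoc ..
  have int_u: "integrable lborel (u n)" for n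
  proof (rule Bochner_Integration.integrable_bound)
    show "integrable lborel (\<lambda>\<omega>::'a. (\<integral>x. cmod (f x) \<partial>lborel)\<^sup>2 * window (e n) \<omega>)"
      using integrable_window[OF e, where 'a = 'a] by simp
    show "AE \<omega> in lborel. norm (u n \<omega>) \<le> norm ((\<integral>x. cmod (f x) \<partial>lborel)\<^sup>2 * window (e n) \<omega>)"
      by (auto simp: u_def window_def intro!: mult_right_mono power_mono fourier_integral_bound)
  qed (unfold u_def, measurable)
  have "(\<lambda>n. complex_of_real (\<integral>\<omega>. u n \<omega> \<partial>lborel)) \<longlonglongrightarrow> complex_of_real ((norm (abs_L2 f))\<^sup>2)"
    using windowed_energy_tendsto[OF e0, of "abs_L2 f"]
    unfolding windowed_energy_autocorrelation[OF assms(2), symmetric] windowed_energy[OF assms(1) e, symmetric] eq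
    by simp
  then have lim: "(\<lambda>n. \<integral>\<omega>. u n \<omega> \<partial>lborel) \<longlonglongrightarrow> (norm (abs_L2 f))\<^sup>2"
    by (simp only: tendsto_of_real_iff)
  have mono: "AE \<omega> in lborel. mono (\<lambda>n. u n \<omega>)"
  proof (rule AE_I2, rule monoI)
    fix \<omega> :: 'a and m n :: nat assume "m \<le> n"
    then have "e n \<le> e m" by (simp add: e_def field_simps)
    then have "(norm ((2 * pi * e n) *\<^sub>R \<omega>))\<^sup>2 \<le> (norm ((2 * pi * e m) *\<^sub>R \<omega>))\<^sup>2"
      using e[of n] e[of m] by (intro power_mono) (auto intro!: mult_right_mono)
    then show "u m \<omega> \<le> u n \<omega>" unfolding u_def window_def by (intro mult_left_mono) auto
  qed
  have conv: "AE \<omega> in lborel. (\<lambda>n. u n \<omega>) \<longlonglongrightarrow> (cmod (fourier_integral f \<omega>))\<^sup>2"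
  proof (rule AE_I2)
    fix \<omega> :: 'a
    have "(\<lambda>n. u n \<omega>) \<longlonglongrightarrow> (cmod (fourier_integral f \<omega>))\<^sup>2 * exp (- (norm ((2 * pi * 0) *\<^sub>R \<omega>))\<^sup>2 / 2)"
      unfolding u_def window_def by (intro tendsto_intros e0) auto
    then show "(\<lambda>n. u n \<omega>) \<longlonglongrightarrow> (cmod (fourier_integral f \<omega>))\<^sup>2" by simp
  qed
  note mc = integrable_monotone_convergence[OF int_u mono conv lim] integral_monotone_convergence[OF int_u mono conv lim]
  show sq: "square_integrable (fourier_integral f)"
    unfolding square_integrable_def using mc(1) by simp
  have "(norm (abs_L2 (fourier_integral f)))\<^sup>2 = (\<integral>\<omega>. (cmod (fourier_integral f \<omega>))\<^sup>2 \<partial>lborel)"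
    unfolding norm_L2_square
    by (rule integral_cong_AE) (use rep_abs_L2[OF sq] in auto)
  also have "\<dots> = (norm (abs_L2 f))\<^sup>2" using mc(2) by simp
  finally show "norm (abs_L2 (fourier_integral f)) = norm (abs_L2 f)" by simp
qed

section \<open>The Fourier transform is unitary\<close>

lemma abs_L2_diff:
  assumes "square_integrable f" "square_integrable g"
  shows "abs_L2 f - abs_L2 g = abs_L2 (\<lambda>x. f x - g x)"
proof -
  have "abs_L2 f + (-1) *\<^sub>C abs_L2 g = abs_L2 (\<lambda>x. f x + (-1) * g x)"
    using plus_L2.abs_eq[of f "\<lambda>x. (-1) * g x"] scaleC_L2.abs_eq[of g "-1"] square_integrable_cmult[OF assms(2), of "-1"] assms
    by (simp add: L2_rel_def)
  then show ?thesis by (simp add: scaleC_minus1)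
qed

lemma plancherel_L1_L2_diff:
  fixes f g :: "'a::euclidean_space \<Rightarrow> complex"
  assumes f: "integrable lborel f" "square_integrable f" and g: "integrable lborel g" "square_integrable g"
  shows "norm (abs_L2 (fourier_integral f) - abs_L2 (fourier_integral g)) = norm (abs_L2 f - abs_L2 g)"
proof -
  have d: "integrable lborel (\<lambda>x. f x - g x)" "square_integrable (\<lambda>x. f x - g x)"
    using f(1) g(1) square_integrable_add[OF f(2) square_integrable_cmult[OF g(2), of "-1"]] by simp_all
  have "fourier_integral (\<lambda>x. f x - g x) \<omega> = fourier_integral f \<omega> - fourier_integral g \<omega>" for \<omega>
    using fourier_integral_add[of f "\<lambda>x. (-1) * g x" \<omega>] fourier_integral_cmult[of "-1" g \<omega>] f(1) g(1) by simp
  then have "fourier_integral (\<lambda>x. f x - g x) = (\<lambda>\<omega>. fourier_integral f \<omega> - fourier_integral g \<omega>)" ..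
  then have "abs_L2 (fourier_integral f) - abs_L2 (fourier_integral g) = abs_L2 (fourier_integral (\<lambda>x. f x - g x))"
    by (simp add: abs_L2_diff plancherel_L1_L2(1) f g)
  then show ?thesis using plancherel_L1_L2(2)[OF d] by (simp add: abs_L2_diff f g)
qed

definition truncated_fourier :: "nat \<Rightarrow> 'a::euclidean_space L2 \<Rightarrow> 'a L2" where
  "truncated_fourier n f = abs_L2 (fourier_integral (truncation n (rep_L2 f)))"

text \<open>
  The truncations of \<open>f\<close> lie in \<open>L\<^sup>1 \<inter> L\<^sup>2\<close> and form a Cauchy sequence, hence so do their transforms.
  Truncation is linear, so the limit is visibly linear in \<open>f\<close>.
\<close>

definition plancherel :: "'a::euclidean_space L2 \<Rightarrow> 'a L2" where
  "plancherel f = lim (\<lambda>n. truncated_fourier n f)"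

lemmas truncation_L1_L2 = integrable_truncation[OF square_integrable_rep_L2] square_integrable_truncation[OF square_integrable_rep_L2]

lemma truncation_rep_tendsto: "(\<lambda>n. abs_L2 (truncation n (rep_L2 f))) \<longlonglongrightarrow> f"
  using truncation_tendsto[OF square_integrable_rep_L2, of f] by simp

lemma truncated_fourier_tendsto: "(\<lambda>n. truncated_fourier n f) \<longlonglongrightarrow> plancherel f"
proof -
  have "Cauchy (\<lambda>n. abs_L2 (truncation n (rep_L2 f)))"
    using truncation_rep_tendsto by (rule LIMSEQ_imp_Cauchy)
  then have "Cauchy (\<lambda>n. truncated_fourier n f)"
    unfolding Cauchy_def dist_norm truncated_fourier_def plancherel_L1_L2_diff[OF truncation_L1_L2 truncation_L1_L2] .
  then show ?thesis
    unfolding plancherel_def Cauchy_convergent_iff by (rule convergent_LIMSEQ_iff[THEN iffD1])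
qed

lemma plancherel_integrable:
  assumes "integrable lborel (rep_L2 f)"
  shows "plancherel f = abs_L2 (fourier_integral (rep_L2 f))"
proof -
  have "(\<lambda>n. abs_L2 (truncation n (rep_L2 f)) - f) \<longlonglongrightarrow> 0"
    using truncation_rep_tendsto by (rule LIM_zero)
  then have "(\<lambda>n. norm (abs_L2 (truncation n (rep_L2 f)) - abs_L2 (rep_L2 f))) \<longlonglongrightarrow> 0"
    by (intro tendsto_norm_zero) simp
  then have "(\<lambda>n. norm (truncated_fourier n f - abs_L2 (fourier_integral (rep_L2 f)))) \<longlonglongrightarrow> 0"
    unfolding truncated_fourier_def plancherel_L1_L2_diff[OF truncation_L1_L2 assms square_integrable_rep_L2] .
  then have "(\<lambda>n. truncated_fourier n f) \<longlonglongrightarrow> abs_L2 (fourier_integral (rep_L2 f))"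
    by (rule LIM_zero_cancel[OF tendsto_norm_zero_cancel])
  then show ?thesis using truncated_fourier_tendsto LIMSEQ_unique by blast
qed

lemma AE_plancherel:
  assumes "integrable lborel (rep_L2 f)"
  shows "AE \<omega> in lborel. rep_L2 (plancherel f) \<omega> = fourier_integral (rep_L2 f) \<omega>"
  unfolding plancherel_integrable[OF assms]
  by (rule rep_abs_L2[OF plancherel_L1_L2(1)[OF assms square_integrable_rep_L2]])

lemma abs_L2_add:
  assumes "square_integrable f" "square_integrable g"
  shows "abs_L2 f + abs_L2 g = abs_L2 (\<lambda>x. f x + g x)"
  using plus_L2.abs_eq[of f g] assms by (simp add: L2_rel_def)

lemma abs_L2_scaleC:
  assumes "square_integrable f"
  shows "c *\<^sub>C abs_L2 f = abs_L2 (\<lambda>x. c * f x)"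
  using scaleC_L2.abs_eq[of f c] assms by (simp add: L2_rel_def)

lemma truncated_fourier_add: "truncated_fourier n (f + g) = truncated_fourier n f + truncated_fourier n g"
proof -
  have "AE x in lborel. truncation n (rep_L2 (f + g)) x = truncation n (rep_L2 f) x + truncation n (rep_L2 g) x"
    using AE_rep_plus[of f g] by eventually_elim (simp add: truncation_def)
  then have "fourier_integral (truncation n (rep_L2 (f + g))) \<omega> =
      fourier_integral (\<lambda>x. truncation n (rep_L2 f) x + truncation n (rep_L2 g) x) \<omega>" for \<omega>
    by (rule fourier_integral_cong_AE) measurable
  then have "fourier_integral (truncation n (rep_L2 (f + g))) =
      (\<lambda>\<omega>. fourier_integral (truncation n (rep_L2 f)) \<omega> + fourier_integral (truncation n (rep_L2 g)) \<omega>)"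
    by (simp add: fun_eq_iff fourier_integral_add truncation_L1_L2)
  then show ?thesis
    unfolding truncated_fourier_def
    by (simp add: abs_L2_add plancherel_L1_L2(1)[OF truncation_L1_L2])
qed

lemma truncated_fourier_scaleC: "truncated_fourier n (c *\<^sub>C f) = c *\<^sub>C truncated_fourier n f"
proof -
  have "AE x in lborel. truncation n (rep_L2 (c *\<^sub>C f)) x = c * truncation n (rep_L2 f) x"
    using AE_rep_scaleC[of c f] by eventually_elim (simp add: truncation_def)
  then have "fourier_integral (truncation n (rep_L2 (c *\<^sub>C f))) \<omega> =
      fourier_integral (\<lambda>x. c * truncation n (rep_L2 f) x) \<omega>" for \<omega>
    by (rule fourier_integral_cong_AE) measurable
  then have "fourier_integral (truncation n (rep_L2 (c *\<^sub>C f))) =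
      (\<lambda>\<omega>. c * fourier_integral (truncation n (rep_L2 f)) \<omega>)"
    by (simp add: fun_eq_iff fourier_integral_cmult)
  then show ?thesis
    unfolding truncated_fourier_def
    by (simp add: abs_L2_scaleC plancherel_L1_L2(1)[OF truncation_L1_L2])
qed

lemma plancherel_add: "plancherel (f + g) = plancherel f + plancherel g"
  using truncated_fourier_tendsto[of "f + g"] tendsto_add[OF truncated_fourier_tendsto[of f] truncated_fourier_tendsto[of g]]
  unfolding truncated_fourier_add by (rule LIMSEQ_unique)

lemma tendsto_scaleC:
  fixes x :: "nat \<Rightarrow> 'a::complex_inner"
  assumes "x \<longlonglongrightarrow> a"
  shows "(\<lambda>n. c *\<^sub>C x n) \<longlonglongrightarrow> c *\<^sub>C a"
proof -
  have "(\<lambda>n. cmod c * norm (x n - a)) \<longlonglongrightarrow> 0"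
    using tendsto_norm_zero[OF LIM_zero[OF assms]] by (rule tendsto_mult_right_zero)
  then have "(\<lambda>n. norm (c *\<^sub>C x n - c *\<^sub>C a)) \<longlonglongrightarrow> 0" by (simp flip: scaleC_diff_right)
  then show ?thesis by (rule LIM_zero_cancel[OF tendsto_norm_zero_cancel])
qed

lemma plancherel_scaleC: "plancherel (c *\<^sub>C f) = c *\<^sub>C plancherel f"
  using truncated_fourier_tendsto[of "c *\<^sub>C f"] tendsto_scaleC[OF truncated_fourier_tendsto[of f], of c]
  unfolding truncated_fourier_scaleC by (rule LIMSEQ_unique)

lemma norm_plancherel: "norm (plancherel f) = norm f"
proof -
  have "(\<lambda>n. norm (truncated_fourier n f)) \<longlonglongrightarrow> norm (plancherel f)"
    by (intro tendsto_norm truncated_fourier_tendsto)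
  moreover have "(\<lambda>n. norm (truncated_fourier n f)) \<longlonglongrightarrow> norm f"
    unfolding truncated_fourier_def plancherel_L1_L2(2)[OF truncation_L1_L2]
    by (intro tendsto_norm truncation_rep_tendsto)
  ultimately show ?thesis by (rule LIMSEQ_unique)
qed

lemma plancherel_diff: "plancherel (f - g) = plancherel f - plancherel g"
  using plancherel_add[of f "(-1) *\<^sub>C g"] plancherel_scaleC[of "-1" g]
  by (simp add: scaleC_minus1)

lemma continuous_plancherel: "continuous_on UNIV plancherel"
  by (rule continuous_on_iff[THEN iffD2])
     (auto simp: dist_norm norm_plancherel simp flip: plancherel_diff)

lemma integrable_rep_abs_truncation: "integrable lborel (rep_L2 (abs_L2 (truncation n (rep_L2 f))))"
  by (rule Bochner_Integration.integrable_cong_AE_imp[OF truncation_L1_L2(1)[of n f]])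
     (use rep_abs_L2[OF truncation_L1_L2(2)[of n f]] in \<open>auto elim: eventually_mono\<close>)

text \<open>
  Two continuous maps that are given by the Fourier integral on integrable functions agree on all
  truncations, and these are dense.
\<close>

lemma fourier_eq_plancherel:
  "fourier = (plancherel :: 'a::euclidean_space L2 \<Rightarrow> 'a L2)"
  unfolding fourier_def
proof (rule the_equality)
  show "continuous_on UNIV plancherel \<and> (\<forall>f. integrable lborel (rep_L2 f) \<longrightarrow>
        (AE \<omega> in lborel. rep_L2 (plancherel f) \<omega> = fourier_integral (rep_L2 f) \<omega>))"
    using AE_plancherel by (intro conjI continuous_plancherel) auto
next
  fix F :: "'a L2 \<Rightarrow> 'a L2"
  assume F: "continuous_on UNIV F \<and> (\<forall>f. integrable lborel (rep_L2 f) \<longrightarrow>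
        (AE \<omega> in lborel. rep_L2 (F f) \<omega> = fourier_integral (rep_L2 f) \<omega>))"
  show "F = plancherel"
  proof
    fix f :: "'a L2"
    define t where "t n = abs_L2 (truncation n (rep_L2 f))" for n
    have t: "t \<longlonglongrightarrow> f" unfolding t_def by (rule truncation_rep_tendsto)
    have "F (t n) = plancherel (t n)" for n
    proof (rule L2_eqI)
      have "integrable lborel (rep_L2 (t n))" unfolding t_def by (rule integrable_rep_abs_truncation)
      then show "AE x in lborel. rep_L2 (F (t n)) x = rep_L2 (plancherel (t n)) x"
        using F AE_plancherel[of "t n"] by (auto elim: eventually_elim2)
    qed
    moreover have "(\<lambda>n. F (t n)) \<longlonglongrightarrow> F f"
      using F t by (intro continuous_on_tendsto_compose[of UNIV F]) auto
    moreover have "(\<lambda>n. plancherel (t n)) \<longlonglongrightarrow> plancherel f"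
      using continuous_plancherel t by (intro continuous_on_tendsto_compose[of UNIV plancherel]) auto
    ultimately show "F f = plancherel f" using LIMSEQ_unique by simp
  qed
qed

lemmas fourier_add = plancherel_add[folded fourier_eq_plancherel]
lemmas fourier_diff = plancherel_diff[folded fourier_eq_plancherel]
lemmas fourier_scaleC = plancherel_scaleC[folded fourier_eq_plancherel]
lemmas norm_fourier = norm_plancherel[folded fourier_eq_plancherel]

definition conj_L2 :: "'a::euclidean_space L2 \<Rightarrow> 'a L2" where
  "conj_L2 f = abs_L2 (\<lambda>x. cnj (rep_L2 f x))"

lemma square_integrable_cnj:
  "square_integrable f \<Longrightarrow> square_integrable (\<lambda>x. cnj (f x))"
  by (auto simp: square_integrable_def)

lemma AE_rep_conj: "AE x in lborel. rep_L2 (conj_L2 f) x = cnj (rep_L2 f x)"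
  unfolding conj_L2_def by (rule rep_abs_L2[OF square_integrable_cnj[OF square_integrable_rep_L2]])

lemma conj_conj_L2 [simp]: "conj_L2 (conj_L2 f) = f"
  by (rule L2_eqI) (use AE_rep_conj[of f] AE_rep_conj[of "conj_L2 f"] in eventually_elim, simp)

lemma norm_conj_L2_diff: "norm (conj_L2 f - conj_L2 g) = norm (f - g)"
proof -
  have "(norm (conj_L2 f - conj_L2 g))\<^sup>2 = (norm (f - g))\<^sup>2"
    unfolding norm_L2_square
  proof (rule integral_cong_AE)
    show "AE x in lborel. (cmod (rep_L2 (conj_L2 f - conj_L2 g) x))\<^sup>2 = (cmod (rep_L2 (f - g) x))\<^sup>2"
      using AE_rep_conj[of f] AE_rep_conj[of g] AE_rep_diff[of f g] AE_rep_diff[of "conj_L2 f" "conj_L2 g"]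
      by eventually_elim (simp flip: complex_cnj_diff)
  qed auto
  then show ?thesis by simp
qed

lemma tendsto_conj_L2: "x \<longlonglongrightarrow> a \<Longrightarrow> (\<lambda>n. conj_L2 (x n)) \<longlonglongrightarrow> conj_L2 a"
  by (subst (asm) tendsto_dist_iff, subst tendsto_dist_iff) (simp add: dist_norm norm_conj_L2_diff)

lemma tendsto_cinner:
  fixes x y :: "nat \<Rightarrow> 'a::complex_inner"
  assumes "x \<longlonglongrightarrow> a" "y \<longlonglongrightarrow> b"
  shows "(\<lambda>n. cinner (x n) (y n)) \<longlonglongrightarrow> cinner a b"
proof -
  have "(\<lambda>n. norm (x n) * norm (y n - b) + norm (x n - a) * norm b) \<longlonglongrightarrow> norm a * norm (b - b) + norm (a - a) * norm b"
    by (intro tendsto_intros assms)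
  then have "(\<lambda>n. norm (x n) * norm (y n - b) + norm (x n - a) * norm b) \<longlonglongrightarrow> 0" by simp
  moreover have "cmod (cinner (x n) (y n) - cinner a b) \<le> norm (x n) * norm (y n - b) + norm (x n - a) * norm b" for n
  proof -
    have "cinner (x n) (y n) - cinner a b = cinner (x n) (y n - b) + cinner (x n - a) b"
      by (simp add: cinner_diff_left cinner_diff_right)
    then have "cmod (cinner (x n) (y n) - cinner a b) = cmod (cinner (x n) (y n - b) + cinner (x n - a) b)" by simp
    then show ?thesis
      using norm_triangle_ineq[of "cinner (x n) (y n - b)" "cinner (x n - a) b"]
        cinner_bound[of "x n" "y n - b"] cinner_bound[of "x n - a" b] by linarith
  qed
  ultimately have "(\<lambda>n. cinner (x n) (y n) - cinner a b) \<longlonglongrightarrow> 0"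
    by (rule_tac Lim_null_comparison[OF always_eventually]) auto
  then show ?thesis by (rule LIM_zero_cancel)
qed

text \<open>
  The bilinear pairing of \<open>f\<close> with \<open>g\<close> is written as \<open>cinner f (conj_L2 g)\<close>; in this form the
  multiplication formula passes to the limit along truncations.
\<close>

lemma fourier_multiplication:
  fixes f g :: "'a::euclidean_space L2"
  shows "cinner (fourier f) (conj_L2 g) = cinner f (conj_L2 (fourier g))"
proof -
  define t where "t n f = abs_L2 (truncation n (rep_L2 f))" for n and f :: "'a L2"
  have t: "(\<lambda>n. t n f) \<longlonglongrightarrow> f" for f unfolding t_def by (rule truncation_rep_tendsto)
  have Ft: "(\<lambda>n. fourier (t n f)) \<longlonglongrightarrow> fourier f" for f
    using continuous_plancherel t
    unfolding fourier_eq_plancherel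
    by (intro continuous_on_tendsto_compose[of UNIV plancherel]) auto
  have eq: "cinner (fourier u) (conj_L2 v) = cinner u (conj_L2 (fourier v))"
    if u: "integrable lborel (rep_L2 u)" and v: "integrable lborel (rep_L2 v)" for u v :: "'a L2"
  proof -
    have F: "AE \<omega> in lborel. rep_L2 (fourier u) \<omega> = fourier_integral (rep_L2 u) \<omega>" if "integrable lborel (rep_L2 u)" for u :: "'a L2"
      unfolding fourier_eq_plancherel by (rule AE_plancherel[OF that])
    have "cinner (fourier u) (conj_L2 v) = (\<integral>\<omega>. fourier_integral (rep_L2 u) \<omega> * rep_L2 v \<omega> \<partial>lborel)"
      unfolding cinner_L2_rep
      by (rule integral_cong_AE) (use F[OF u] AE_rep_conj[of v] in auto)
    also have "\<dots> = (\<integral>\<omega>. rep_L2 u \<omega> * fourier_integral (rep_L2 v) \<omega> \<partial>lborel)"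
      by (rule fourier_integral_multiplication[OF u v])
    also have "\<dots> = cinner u (conj_L2 (fourier v))"
      unfolding cinner_L2_rep
      by (rule integral_cong_AE) (use F[OF v] AE_rep_conj[of "fourier v"] in auto)
    finally show ?thesis .
  qed
  have "cinner (fourier (t n f)) (conj_L2 (t n g)) = cinner (t n f) (conj_L2 (fourier (t n g)))" for n
    by (rule eq) (auto simp: t_def integrable_rep_abs_truncation)
  moreover have "(\<lambda>n. cinner (fourier (t n f)) (conj_L2 (t n g))) \<longlonglongrightarrow> cinner (fourier f) (conj_L2 g)"
    by (intro tendsto_cinner Ft tendsto_conj_L2 t)
  moreover have "(\<lambda>n. cinner (t n f) (conj_L2 (fourier (t n g)))) \<longlonglongrightarrow> cinner f (conj_L2 (fourier g))"
    by (intro tendsto_cinner Ft tendsto_conj_L2 t)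
  ultimately show ?thesis using LIMSEQ_unique by simp
qed

text \<open>
  The quadratic \<open>norm (h + r *\<^sub>R s)\<^sup>2\<close> in \<open>r\<close> has its minimum at \<open>0\<close>, so its linear term vanishes.
\<close>

lemma inner_eq_zero_of_minimal_norm:
  fixes h s :: "'a::real_inner"
  assumes "\<And>r :: real. norm h \<le> norm (h + r *\<^sub>R s)"
  shows "inner h s = 0"
proof (cases "s = 0")
  case False
  define a where "a = inner h s"
  define n where "n = inner s s"
  have n: "n > 0" using False by (simp add: n_def)
  \<comment> \<open>the quadratic in \<open>r\<close> is smallest at \<open>r = - a / n\<close>\<close>
  have "inner h h \<le> inner (h + (- a / n) *\<^sub>R s) (h + (- a / n) *\<^sub>R s)"
    using assms[of "- a / n"] unfolding norm_le .
  also have "\<dots> = inner h h + 2 * (- a / n) * a + (- a / n) * (- a / n) * n"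
    unfolding a_def n_def by (simp only: inner_add_left inner_add_right inner_commute[of s h]
        inner_scaleR_left inner_scaleR_right ring_distribs mult.assoc)
  also have "\<dots> = inner h h - a\<^sup>2 / n"
    using n by (simp add: power2_eq_square)
  finally have "a\<^sup>2 / n \<le> 0" by simp
  then have "a = 0" using n by (simp add: divide_le_0_iff)
  then show ?thesis by (simp add: a_def)
qed simp

lemma cinner_eq_zero_of_minimal_norm:
  fixes h s :: "'a::complex_inner"
  assumes "\<And>c :: complex. norm h \<le> norm (h + c *\<^sub>C s)"
  shows "cinner s h = 0"
proof -
  have "inner h s = 0"
    using assms[of "complex_of_real r" for r]
    by (intro inner_eq_zero_of_minimal_norm) (simp only: scaleC_of_real)
  moreover have "inner h (\<i> *\<^sub>C s) = 0"
    using assms[of "complex_of_real r * \<i>" for r]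
    by (intro inner_eq_zero_of_minimal_norm) (simp only: scaleC_of_real scaleC_scaleC[symmetric])
  ultimately have "cinner h s = 0"
    by (simp add: inner_eq_Re_cinner cinner_scaleC_right complex_eq_iff)
  then show ?thesis by (subst cinner_commute) simp
qed

text \<open>
  The range is closed, the transform being isometric.  If \<open>h\<close> is orthogonal to it, the multiplication
  formula makes the transform of \<open>conj_L2 h\<close> orthogonal to everything, so \<open>h = 0\<close>.
\<close>

lemma surj_fourier: "surj (fourier :: 'a::euclidean_space L2 \<Rightarrow> 'a L2)"
proof -
  have lin: "bounded_linear_on UNIV (fourier :: 'a L2 \<Rightarrow> _) 1"
    by unfold_locales
       (auto simp: fourier_add norm_fourier simp flip: scaleC_of_real, simp only: fourier_scaleC)
  then interpret bounded_linear_on UNIV "fourier :: 'a L2 \<Rightarrow> _" 1 .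
  have closed: "closed (range (fourier :: 'a L2 \<Rightarrow> _))"
    by (rule closed_image_of_bounded_below[OF lin closed_UNIV zero_less_one]) (simp add: norm_fourier)
  have "y \<in> range fourier" for y :: "'a L2"
  proof -
    obtain m where m: "m \<in> range fourier" "\<And>s. s \<in> range fourier \<Longrightarrow> norm (y - m) \<le> norm (y - s)"
      using nearest_point_exists[OF closed subspace_imp_convex[OF subspace_image], of y] by auto
    define h where "h = y - m"
    obtain f0 where f0: "m = fourier f0" using m(1) by blast
    have "cinner (fourier f) h = 0" for f
    proof (rule cinner_eq_zero_of_minimal_norm)
      fix c
      have "m - c *\<^sub>C fourier f = fourier (f0 - c *\<^sub>C f)" by (simp add: f0 fourier_diff fourier_scaleC)
      then have "norm h \<le> norm (y - (m - c *\<^sub>C fourier f))" unfolding h_def by (intro m(2)) simp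
      then show "norm h \<le> norm (h + c *\<^sub>C fourier f)" by (simp add: h_def algebra_simps)
    qed
    then have "cinner f (conj_L2 (fourier (conj_L2 h))) = 0" for f
      using fourier_multiplication[of f "conj_L2 h"] by simp
    then have "conj_L2 (fourier (conj_L2 h)) = 0"
      using cinner_self[of "conj_L2 (fourier (conj_L2 h))"] by simp
    moreover have "norm (conj_L2 u) = norm u" for u :: "'a L2"
    proof -
      have "conj_L2 0 = (0 :: 'a L2)"
        by (rule L2_eqI) (use AE_rep_conj[of 0] AE_rep_zero in eventually_elim, simp)
      then show ?thesis using norm_conj_L2_diff[of u 0] by simp
    qed
    ultimately have "norm h = 0" by (metis norm_fourier norm_zero)
    then show ?thesis using m(1) by (simp add: h_def)
  qed
  then show ?thesis by blast
qed

section \<open>The fiber map\<close>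

lemma half_open_cube_measurable [measurable]: "(half_open_cube :: (real^'d::finite) set) \<in> sets borel"
proof -
  have "(half_open_cube :: (real^'d) set) = {\<omega> \<in> space borel. \<forall>i. 0 \<le> \<omega> $ i \<and> \<omega> $ i < 1}"
    by (simp add: half_open_cube_def)
  also have "\<dots> \<in> sets borel" by measurable
  finally show ?thesis .
qed

lemma emeasure_half_open_cube_finite: "emeasure lborel (half_open_cube :: (real^'d::finite) set) < \<infinity>"
proof -
  have "(half_open_cube :: (real^'d) set) \<subseteq> cbox 0 1"
    by (auto simp: half_open_cube_def mem_box_cart less_imp_le)
  then have "emeasure lborel (half_open_cube :: (real^'d) set) \<le> emeasure lborel (cbox 0 (1 :: real^'d))"
    by (rule emeasure_mono) simp
  then show ?thesis using emeasure_lborel_cbox_finite[of 0 "1 :: real^'d"] by (rule le_less_trans)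
qed

abbreviation AE_cube :: "(real^'d::finite \<Rightarrow> bool) \<Rightarrow> bool" (binder "AE\<^sub>Q " 10) where
  "AE\<^sub>Q \<omega>. P \<omega> \<equiv> AE \<omega>\<in>half_open_cube in lborel. P \<omega>"

lemma AE_half_open_cube_iff:
  "(AE \<omega> in lebesgue_on (half_open_cube :: (real^'d::finite) set). P \<omega>) \<longleftrightarrow> (AE\<^sub>Q \<omega>. P \<omega>)"
proof -
  have "half_open_cube \<in> sets (lebesgue :: (real^'d) measure)"
    by (rule sets_completionI_sets) simp
  then show ?thesis by (subst AE_restrict_space_iff) (simp_all add: AE_completion_iff)
qed

definition lattice_floor :: "real^'d \<Rightarrow> int^'d" where
  "lattice_floor x = (\<chi> i. \<lfloor>x $ i\<rfloor>)"

lemma lattice_floor_iff: "x - lattice_point k \<in> half_open_cube \<longleftrightarrow> k = lattice_floor x"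
proof -
  have "0 \<le> x $ i - real_of_int (k $ i) \<and> x $ i - real_of_int (k $ i) < 1 \<longleftrightarrow> k $ i = \<lfloor>x $ i\<rfloor>" for i
    using floor_eq_iff[of "x $ i" "k $ i"] by linarith
  then show ?thesis
    by (simp add: half_open_cube_def lattice_point_def lattice_floor_def vec_eq_iff)
qed

lemma lattice_floor_add: "\<omega> \<in> half_open_cube \<Longrightarrow> lattice_floor (\<omega> + lattice_point k) = k"
  using lattice_floor_iff[of "\<omega> + lattice_point k" k] by simp

lemma nn_integral_lborel_translate:
  fixes g :: "'a::euclidean_space \<Rightarrow> ennreal"
  assumes [measurable]: "g \<in> borel_measurable borel"
  shows "(\<integral>\<^sup>+x. g (t + x) \<partial>lborel) = (\<integral>\<^sup>+x. g x \<partial>lborel)"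
proof -
  have "(\<integral>\<^sup>+x. g x \<partial>lborel) = (\<integral>\<^sup>+x. g x \<partial>(distr lborel borel ((+) t)))" by (simp only: lborel_distr_plus)
  also have "\<dots> = (\<integral>\<^sup>+x. g (t + x) \<partial>lborel)" by (rule nn_integral_distr) simp_all
  finally show ?thesis ..
qed

text \<open>
  Exactly one lattice translate moves a given point into the cube, so summing over the lattice the
  integrals over the translated cubes recovers the whole integral.
\<close>

lemma nn_integral_tiling:
  fixes g :: "real^'d::finite \<Rightarrow> ennreal"
  assumes [measurable]: "g \<in> borel_measurable borel"
  shows "(\<integral>\<^sup>+\<omega>. (\<integral>\<^sup>+k. g (\<omega> + lattice_point k) \<partial>count_space UNIV) * indicator half_open_cube \<omega> \<partial>lborel)
     = (\<integral>\<^sup>+x. g x \<partial>lborel)"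
proof -
  have "(\<integral>\<^sup>+x. g x \<partial>lborel) = (\<integral>\<^sup>+x. (\<integral>\<^sup>+k. g x * indicator half_open_cube (x - lattice_point k) \<partial>count_space UNIV) \<partial>lborel)"
  proof (rule nn_integral_cong)
    fix x :: "real^'d"
    have "(\<integral>\<^sup>+k. g x * indicator half_open_cube (x - lattice_point k) \<partial>count_space UNIV)
        = (\<integral>\<^sup>+k. g x * indicator {lattice_floor x} k \<partial>count_space UNIV)"
      by (rule nn_integral_cong) (simp add: indicator_def lattice_floor_iff)
    then show "g x = (\<integral>\<^sup>+k. g x * indicator half_open_cube (x - lattice_point k) \<partial>count_space UNIV)"
      by (simp add: nn_integral_cmult_indicator)
  qed
  also have "\<dots> = (\<integral>\<^sup>+k. (\<integral>\<^sup>+x. g x * indicator half_open_cube (x - lattice_point k) \<partial>lborel) \<partial>count_space UNIV)"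
    by (rule nn_integral_count_space_nn_integral) auto
  also have "\<dots> = (\<integral>\<^sup>+k. (\<integral>\<^sup>+\<omega>. g (\<omega> + lattice_point k) * indicator half_open_cube \<omega> \<partial>lborel) \<partial>count_space UNIV)"
  proof (rule nn_integral_cong)
    fix k :: "int^'d"
    show "(\<integral>\<^sup>+x. g x * indicator half_open_cube (x - lattice_point k) \<partial>lborel)
        = (\<integral>\<^sup>+\<omega>. g (\<omega> + lattice_point k) * indicator half_open_cube \<omega> \<partial>lborel)"
      using nn_integral_lborel_translate[of "\<lambda>x. g x * indicator half_open_cube (x - lattice_point k)" "lattice_point k"]
      by (simp add: add.commute)
  qed
  also have "\<dots> = (\<integral>\<^sup>+\<omega>. (\<integral>\<^sup>+k. g (\<omega> + lattice_point k) * indicator half_open_cube \<omega> \<partial>count_space UNIV) \<partial>lborel)"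
    by (rule nn_integral_count_space_nn_integral[symmetric]) auto
  also have "\<dots> = (\<integral>\<^sup>+\<omega>. (\<integral>\<^sup>+k. g (\<omega> + lattice_point k) \<partial>count_space UNIV) * indicator half_open_cube \<omega> \<partial>lborel)"
    by (rule nn_integral_cong) (simp add: nn_integral_multc)
  finally show ?thesis ..
qed

lemma summable_on_nn_integral_count_space:
  fixes f :: "'i \<Rightarrow> real"
  assumes "\<And>k. 0 \<le> f k"
  shows "f summable_on UNIV \<longleftrightarrow> (\<integral>\<^sup>+k. ennreal (f k) \<partial>count_space UNIV) < \<infinity>"
    and "f summable_on UNIV \<Longrightarrow> (\<integral>\<^sup>+k. ennreal (f k) \<partial>count_space UNIV) = ennreal (\<Sum>\<^sub>\<infinity>k. f k)"
proof -
  have "f summable_on UNIV \<longleftrightarrow> (\<lambda>k. norm (f k)) summable_on UNIV" using assms by simp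
  then have eq: "f summable_on UNIV \<longleftrightarrow> integrable (count_space UNIV) f"
    unfolding abs_summable_equivalent by (simp add: Infinite_Set_Sum.abs_summable_on_def)
  then show "f summable_on UNIV \<longleftrightarrow> (\<integral>\<^sup>+k. ennreal (f k) \<partial>count_space UNIV) < \<infinity>"
    using assms by (simp add: integrable_iff_bounded)
  show "(\<integral>\<^sup>+k. ennreal (f k) \<partial>count_space UNIV) = ennreal (\<Sum>\<^sub>\<infinity>k. f k)" if "f summable_on UNIV"
    using that assms eq nn_integral_conv_infsetsum[of f UNIV] infsetsum_infsum[of f UNIV]
    by (simp add: Infinite_Set_Sum.abs_summable_on_def)
qed

lemma nn_norm_ell2_square:
  "(\<integral>\<^sup>+k. ennreal ((cmod (Rep_ell2 a k))\<^sup>2) \<partial>count_space UNIV) = ennreal ((norm a)\<^sup>2)"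
proof -
  have "(norm a)\<^sup>2 = (\<Sum>\<^sub>\<infinity>k. (cmod (Rep_ell2 a k))\<^sup>2)"
    using ell2_cinner_self[of a] unfolding cinner_self by (simp only: of_real_eq_iff)
  then show ?thesis
    using summable_on_nn_integral_count_space(2)[of "\<lambda>k. (cmod (Rep_ell2 a k))\<^sup>2"] Rep_ell2[of a] by simp
qed

text \<open>
  The square norm of the fiber, in a form that is Borel measurable everywhere and not only up to
  null sets.
\<close>

definition fiber_energy :: "(real^'d::finite) L2 \<Rightarrow> real^'d \<Rightarrow> ennreal" where
  "fiber_energy f \<omega> = (\<integral>\<^sup>+k. ennreal ((cmod (rep_L2 (fourier f) (\<omega> + lattice_point k)))\<^sup>2) \<partial>count_space UNIV)"

lemma fiber_energy_measurable [measurable]: "fiber_energy (f :: (real^'d::finite) L2) \<in> borel_measurable borel"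
proof -
  have "(\<lambda>(\<omega>, k). ennreal ((cmod (rep_L2 (fourier f) (\<omega> + lattice_point k)))\<^sup>2))
     \<in> borel_measurable (borel \<Otimes>\<^sub>M count_space (UNIV :: (int^'d) set))"
    by (subst measurable_pair_swap_iff, rule measurable_pair_measure_countable1) auto
  then show ?thesis
    unfolding fiber_energy_def
    by (intro sigma_finite_measure.borel_measurable_nn_integral[OF sigma_finite_measure_count_space_countable]) auto
qed

lemma nn_integral_fiber_energy:
  "(\<integral>\<^sup>+\<omega>. fiber_energy f \<omega> * indicator half_open_cube \<omega> \<partial>lborel) = ennreal ((norm f)\<^sup>2)"
  unfolding fiber_energy_def
  by (subst nn_integral_tiling) (simp_all add: nn_norm_L2_square[symmetric] norm_fourier)

lemma AE_fiber_energy_finite: "AE\<^sub>Q \<omega>. fiber_energy f \<omega> < \<infinity>"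
proof -
  have "AE \<omega> in lborel. fiber_energy f \<omega> * indicator half_open_cube \<omega> \<noteq> \<infinity>"
    by (rule nn_integral_PInf_AE) (auto simp: nn_integral_fiber_energy)
  then show ?thesis by eventually_elim (auto simp: top.not_eq_extremum)
qed

lemma AE_Rep_fiber:
  "AE\<^sub>Q \<omega>. (\<forall>k. Rep_ell2 (fiber f \<omega>) k = rep_L2 (fourier f) (\<omega> + lattice_point k))"
  using AE_fiber_energy_finite[of f]
proof eventually_elim
  case (elim \<omega>)
  show ?case
  proof
    assume "\<omega> \<in> half_open_cube"
    then have "(\<lambda>k. (cmod (rep_L2 (fourier f) (\<omega> + lattice_point k)))\<^sup>2) summable_on UNIV"
      using elim by (subst summable_on_nn_integral_count_space(1)) (auto simp: fiber_energy_def)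
    then show "\<forall>k. Rep_ell2 (fiber f \<omega>) k = rep_L2 (fourier f) (\<omega> + lattice_point k)"
      by (simp add: fiber_def Abs_ell2_inverse)
  qed
qed

lemma AE_fiber_energy: "AE\<^sub>Q \<omega>. fiber_energy f \<omega> = ennreal ((norm (fiber f \<omega>))\<^sup>2)"
  using AE_Rep_fiber[of f] by eventually_elim (auto simp: fiber_energy_def simp flip: nn_norm_ell2_square)

lemma AE_all_lattice_translates:
  fixes P :: "real^'d::finite \<Rightarrow> bool"
  assumes "AE x in lborel. P x"
  shows "AE \<omega> in lborel. \<forall>k. P (\<omega> + lattice_point k)"
proof (subst AE_all_countable, rule allI)
  show "AE \<omega> in lborel. P (\<omega> + lattice_point k)" for k :: "int^'d"
    using AE_lborel_translate[OF assms, of "- lattice_point k"] by simp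
qed

lemma ell2_eqI: "(\<And>k. Rep_ell2 a k = Rep_ell2 b k) \<Longrightarrow> a = b"
  by (simp add: Rep_ell2_inject[symmetric] fun_eq_iff)

lemma AE_fiber_add: "AE\<^sub>Q \<omega>. fiber (f + g) \<omega> = fiber f \<omega> + fiber g \<omega>"
  using AE_all_lattice_translates[OF AE_rep_plus[of "fourier f" "fourier g"]]
    AE_Rep_fiber[of "f + g"] AE_Rep_fiber[of f] AE_Rep_fiber[of g]
  by eventually_elim (auto intro!: ell2_eqI simp: fourier_add plus_ell2.rep_eq)

lemma AE_fiber_scaleC: "AE\<^sub>Q \<omega>. fiber (c *\<^sub>C f) \<omega> = c *\<^sub>C fiber f \<omega>"
  using AE_all_lattice_translates[OF AE_rep_scaleC[of c "fourier f"]]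
    AE_Rep_fiber[of "c *\<^sub>C f"] AE_Rep_fiber[of f]
  by eventually_elim (auto intro!: ell2_eqI simp: fourier_scaleC scaleC_ell2.rep_eq)

lemma fiber_eq_imp_eq:
  assumes "AE\<^sub>Q \<omega>. fiber f \<omega> = fiber g \<omega>"
  shows "f = g"
proof -
  have "AE\<^sub>Q \<omega>. fiber_energy (f - g) \<omega> = 0"
    using AE_fiber_add[of f "(-1) *\<^sub>C g"] AE_fiber_scaleC[of "-1" g] AE_fiber_energy[of "f - g"] assms
    by eventually_elim (auto simp: scaleC_minus1)
  then have "(\<integral>\<^sup>+\<omega>. fiber_energy (f - g) \<omega> * indicator half_open_cube \<omega> \<partial>lborel) = 0"
    by (subst nn_integral_0_iff_AE) (auto elim!: eventually_mono simp: indicator_def)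
  then show ?thesis unfolding nn_integral_fiber_energy by simp
qed

text \<open>
  Fibers and projections agree only almost everywhere with Borel functions, so measurability of the
  coordinates is required up to null sets.
\<close>

definition measurable_field :: "(real^'d::finite \<Rightarrow> (int^'d) ell2) \<Rightarrow> bool" where
  "measurable_field \<phi> \<longleftrightarrow>
     (\<forall>k. \<exists>\<psi>\<in>borel_measurable borel. AE\<^sub>Q \<omega>. Rep_ell2 (\<phi> \<omega>) k = \<psi> \<omega>)"

lemma measurable_field_fiber: "measurable_field (fiber f)"
  unfolding measurable_field_def
proof
  fix k
  have "(\<lambda>\<omega>. rep_L2 (fourier f) (\<omega> + lattice_point k)) \<in> borel_measurable borel" by measurable
  moreover have "AE\<^sub>Q \<omega>. Rep_ell2 (fiber f \<omega>) k = rep_L2 (fourier f) (\<omega> + lattice_point k)"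
    using AE_Rep_fiber[of f] by eventually_elim auto
  ultimately show "\<exists>\<psi>\<in>borel_measurable borel. AE\<^sub>Q \<omega>. Rep_ell2 (fiber f \<omega>) k = \<psi> \<omega>"
    by (intro bexI[where x = "\<lambda>\<omega>. rep_L2 (fourier f) (\<omega> + lattice_point k)"])
qed

lemma measurable_field_if:
  assumes "measurable_field \<phi>" "measurable_field \<eta>" and [measurable]: "A \<in> sets borel"
  shows "measurable_field (\<lambda>\<omega>. if \<omega> \<in> A then \<phi> \<omega> else \<eta> \<omega>)"
  unfolding measurable_field_def
proof
  fix k
  obtain \<psi> where \<psi> [measurable]: "\<psi> \<in> borel_measurable borel"
    and 1: "AE\<^sub>Q \<omega>. Rep_ell2 (\<phi> \<omega>) k = \<psi> \<omega>"
    using assms(1) unfolding measurable_field_def by blast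
  obtain \<theta> where \<theta> [measurable]: "\<theta> \<in> borel_measurable borel"
    and 2: "AE\<^sub>Q \<omega>. Rep_ell2 (\<eta> \<omega>) k = \<theta> \<omega>"
    using assms(2) unfolding measurable_field_def by blast
  have "(\<lambda>\<omega>. if \<omega> \<in> A then \<psi> \<omega> else \<theta> \<omega>) \<in> borel_measurable borel" by measurable
  moreover have "AE\<^sub>Q \<omega>.
      Rep_ell2 (if \<omega> \<in> A then \<phi> \<omega> else \<eta> \<omega>) k = (if \<omega> \<in> A then \<psi> \<omega> else \<theta> \<omega>)"
    using 1 2 by eventually_elim auto
  ultimately show "\<exists>\<psi>\<in>borel_measurable borel. AE\<^sub>Q \<omega>.
      Rep_ell2 (if \<omega> \<in> A then \<phi> \<omega> else \<eta> \<omega>) k = \<psi> \<omega>"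
    by (intro bexI[where x = "\<lambda>\<omega>. if \<omega> \<in> A then \<psi> \<omega> else \<theta> \<omega>"])
qed

lemma lebesgue_on_cube_ex_borel:
  fixes g :: "real^'d::finite \<Rightarrow> complex"
  assumes "g \<in> borel_measurable (lebesgue_on half_open_cube)"
  shows "\<exists>\<psi>\<in>borel_measurable borel. AE\<^sub>Q \<omega>. g \<omega> = \<psi> \<omega>"
proof -
  define h where "h \<omega> = indicator half_open_cube \<omega> *\<^sub>R g \<omega>" for \<omega>
  have cube: "half_open_cube \<inter> space lebesgue \<in> sets (lebesgue :: (real^'d) measure)"
    by (simp add: sets_completionI_sets)
  have h: "h \<in> borel_measurable lebesgue"
    using assms unfolding borel_measurable_restrict_space_iff[OF cube] h_def .
  have "(\<lambda>\<omega>. Re (h \<omega>)) \<in> borel_measurable lebesgue" "(\<lambda>\<omega>. Im (h \<omega>)) \<in> borel_measurable lebesgue"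
    using h by measurable
  note ri = this[THEN completion_ex_borel_measurable_real]
  obtain r where r [measurable]: "r \<in> borel_measurable lborel" "AE \<omega> in lborel. Re (h \<omega>) = r \<omega>"
    using ri(1) by blast
  obtain i where i [measurable]: "i \<in> borel_measurable lborel" "AE \<omega> in lborel. Im (h \<omega>) = i \<omega>"
    using ri(2) by blast
  have "(\<lambda>\<omega>. complex_of_real (r \<omega>) + \<i> * complex_of_real (i \<omega>)) \<in> borel_measurable lborel" by measurable
  then have "(\<lambda>\<omega>. complex_of_real (r \<omega>) + \<i> * complex_of_real (i \<omega>)) \<in> borel_measurable borel" by simp
  moreover have "AE\<^sub>Q \<omega>. g \<omega> = complex_of_real (r \<omega>) + \<i> * complex_of_real (i \<omega>)"
    using r(2) i(2) by eventually_elim (auto simp: h_def complex_eq_iff)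
  ultimately show ?thesis by (intro bexI[where x = "\<lambda>\<omega>. complex_of_real (r \<omega>) + \<i> * complex_of_real (i \<omega>)"])
qed

text \<open>
  Writing the \<open>k\<close>-th coordinate on the \<open>k\<close>-th translate of the cube assembles a field into one square
  integrable function on the whole space, which is a Fourier transform.
\<close>

theorem fiber_surjective:
  fixes \<phi> :: "real^'d::finite \<Rightarrow> (int^'d) ell2"
  assumes "measurable_field \<phi>" and [measurable]: "B \<in> borel_measurable borel"
    and bound: "AE\<^sub>Q \<omega>. ennreal ((norm (\<phi> \<omega>))\<^sup>2) \<le> B \<omega>"
    and fin: "(\<integral>\<^sup>+\<omega>. B \<omega> * indicator half_open_cube \<omega> \<partial>lborel) < \<infinity>"
  obtains f where "AE\<^sub>Q \<omega>. fiber f \<omega> = \<phi> \<omega>"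
proof -
  have "\<exists>\<psi>. \<forall>k. \<psi> k \<in> borel_measurable borel \<and>
      (AE\<^sub>Q \<omega>. Rep_ell2 (\<phi> \<omega>) k = \<psi> k \<omega>)"
    using assms(1) unfolding measurable_field_def Bex_def by (rule choice)
  then obtain \<psi> where \<psi>: "\<And>k. \<psi> k \<in> borel_measurable borel"
    "\<And>k. AE\<^sub>Q \<omega>. Rep_ell2 (\<phi> \<omega>) k = \<psi> k \<omega>"
    by blast
  have all: "AE \<omega> in lborel. \<forall>k. \<omega> \<in> half_open_cube \<longrightarrow> Rep_ell2 (\<phi> \<omega>) k = \<psi> k \<omega>"
    using \<psi>(2) by (subst AE_all_countable) blast
  define G where "G x = \<psi> (lattice_floor x) (x - lattice_point (lattice_floor x))" for x
  have G_cube: "G (\<omega> + lattice_point k) = \<psi> k \<omega>" if "\<omega> \<in> half_open_cube" for \<omega> k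
    using that by (simp add: G_def lattice_floor_add)
  have floor_m: "(lattice_floor :: real^'d \<Rightarrow> _) \<in> borel \<rightarrow>\<^sub>M count_space UNIV"
  proof -
    have "lattice_floor -` {k} \<inter> space borel \<in> sets (borel :: (real^'d) measure)" for k
    proof -
      have "lattice_floor -` {k} \<inter> space borel = {x \<in> space borel. x - lattice_point k \<in> half_open_cube}"
        by (auto simp: lattice_floor_iff)
      also have "\<dots> \<in> sets borel" by measurable
      finally show ?thesis .
    qed
    then show ?thesis by (subst measurable_count_space_eq2_countable) auto
  qed
  have G [measurable]: "G \<in> borel_measurable borel"
    unfolding G_def
    by (rule measurable_compose_countable[OF _ floor_m]) (use \<psi>(1) in measurable)
  have "(\<integral>\<^sup>+x. ennreal ((cmod (G x))\<^sup>2) \<partial>lborel)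
      = (\<integral>\<^sup>+\<omega>. (\<integral>\<^sup>+k. ennreal ((cmod (G (\<omega> + lattice_point k)))\<^sup>2) \<partial>count_space UNIV) * indicator half_open_cube \<omega> \<partial>lborel)"
    by (rule nn_integral_tiling[symmetric]) measurable
  also have "\<dots> \<le> (\<integral>\<^sup>+\<omega>. B \<omega> * indicator half_open_cube \<omega> \<partial>lborel)"
  proof (rule nn_integral_mono_AE, use all bound in eventually_elim)
    case (elim \<omega>)
    show ?case
    proof (cases "\<omega> \<in> half_open_cube")
      case True
      then show ?thesis using elim by (simp add: G_cube nn_norm_ell2_square flip: elim(1)[rule_format, OF True])
    qed simp
  qed
  also have "\<dots> < \<infinity>" by (rule fin)
  finally have sq: "square_integrable G" by (subst square_integrable_iff_nn) auto
  obtain f where f: "fourier f = abs_L2 G" using surj_fourier by (metis surjD)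
  have "AE \<omega> in lborel. \<forall>k. rep_L2 (fourier f) (\<omega> + lattice_point k) = G (\<omega> + lattice_point k)"
    unfolding f by (rule AE_all_lattice_translates[OF rep_abs_L2[OF sq]])
  then have "AE\<^sub>Q \<omega>. fiber f \<omega> = \<phi> \<omega>"
    using AE_Rep_fiber[of f] all by eventually_elim (auto intro!: ell2_eqI simp: G_cube)
  then show ?thesis by (rule that)
qed

lemma fiber_glue:
  fixes f g :: "(real^'d::finite) L2"
  assumes [measurable]: "A \<in> sets borel"
  obtains h where "AE\<^sub>Q \<omega>. fiber h \<omega> = (if \<omega> \<in> A then fiber f \<omega> else fiber g \<omega>)"
proof -
  have 1: "measurable_field (\<lambda>\<omega>. if \<omega> \<in> A then fiber f \<omega> else fiber g \<omega>)"
    by (intro measurable_field_if measurable_field_fiber assms)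
  have 2: "(\<lambda>\<omega>. fiber_energy f \<omega> + fiber_energy g \<omega>) \<in> borel_measurable borel" by measurable
  have 3: "AE\<^sub>Q \<omega>.
      ennreal ((norm (if \<omega> \<in> A then fiber f \<omega> else fiber g \<omega>))\<^sup>2) \<le> fiber_energy f \<omega> + fiber_energy g \<omega>"
    using AE_fiber_energy[of f] AE_fiber_energy[of g] by eventually_elim auto
  have 4: "(\<integral>\<^sup>+\<omega>. (fiber_energy f \<omega> + fiber_energy g \<omega>) * indicator half_open_cube \<omega> \<partial>lborel) < \<infinity>"
    by (simp add: distrib_right nn_integral_add nn_integral_fiber_energy)
  show ?thesis by (rule fiber_surjective[OF 1 2 3 4]) (rule that)
qed

lemma nn_integral_glued_energy:
  fixes f g h :: "(real^'d::finite) L2"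
  assumes [measurable]: "A \<in> sets borel"
    and h: "AE\<^sub>Q \<omega>. fiber h \<omega> = (if \<omega> \<in> A then fiber f \<omega> else fiber g \<omega>)"
  shows "ennreal ((norm h)\<^sup>2) = (\<integral>\<^sup>+\<omega>. fiber_energy f \<omega> * indicator (half_open_cube \<inter> A) \<omega> \<partial>lborel)
     + (\<integral>\<^sup>+\<omega>. fiber_energy g \<omega> * indicator (half_open_cube - A) \<omega> \<partial>lborel)"
proof -
  have "ennreal ((norm h)\<^sup>2) = (\<integral>\<^sup>+\<omega>. fiber_energy h \<omega> * indicator half_open_cube \<omega> \<partial>lborel)"
    by (rule nn_integral_fiber_energy[symmetric])
  also have "\<dots> = (\<integral>\<^sup>+\<omega>. fiber_energy f \<omega> * indicator (half_open_cube \<inter> A) \<omega>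
      + fiber_energy g \<omega> * indicator (half_open_cube - A) \<omega> \<partial>lborel)"
    by (rule nn_integral_cong_AE)
       (use AE_fiber_energy[of f] AE_fiber_energy[of g] AE_fiber_energy[of h] h in eventually_elim,
         auto simp: indicator_def)
  also have "\<dots> = (\<integral>\<^sup>+\<omega>. fiber_energy f \<omega> * indicator (half_open_cube \<inter> A) \<omega> \<partial>lborel)
     + (\<integral>\<^sup>+\<omega>. fiber_energy g \<omega> * indicator (half_open_cube - A) \<omega> \<partial>lborel)"
    by (rule nn_integral_add) measurable
  finally show ?thesis .
qed

text \<open>
  Apply the hypothesis to the set \<open>A\<close> where the energy of \<open>v\<close> is below that of \<open>u\<close>.  Off \<open>A\<close> both
  glued functions have the fibers of \<open>w\<close>, whose contribution is finite and cancels; what remains says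
  that \<open>u\<close> has no more energy over \<open>A\<close> than \<open>v\<close>, which forces \<open>A\<close> to be null.
\<close>

theorem fiber_norm_le_of_localized:
  fixes u v w :: "(real^'d::finite) L2"
  assumes loc: "\<And>A. A \<in> sets borel \<Longrightarrow> \<exists>x y. norm x \<le> norm y \<and>
      (AE\<^sub>Q \<omega>. fiber x \<omega> = (if \<omega> \<in> A then fiber u \<omega> else fiber w \<omega>)) \<and>
      (AE\<^sub>Q \<omega>. fiber y \<omega> = (if \<omega> \<in> A then fiber v \<omega> else fiber w \<omega>))"
  shows "AE\<^sub>Q \<omega>. norm (fiber u \<omega>) \<le> norm (fiber v \<omega>)"
proof -
  define A where "A = {\<omega> \<in> space borel. fiber_energy v \<omega> < fiber_energy u \<omega>}"
  have [measurable]: "A \<in> sets borel" unfolding A_def by measurable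
  define Q where "Q = half_open_cube \<inter> A"
  have [measurable]: "Q \<in> sets borel" unfolding Q_def by measurable
  let ?I = "\<lambda>f. \<integral>\<^sup>+\<omega>. fiber_energy f \<omega> * indicator Q \<omega> \<partial>lborel"
  let ?W = "\<integral>\<^sup>+\<omega>. fiber_energy w \<omega> * indicator (half_open_cube - A) \<omega> \<partial>lborel"
  have fin: "?I f < \<infinity>" for f :: "(real^'d) L2"
  proof -
    have "?I f \<le> (\<integral>\<^sup>+\<omega>. fiber_energy f \<omega> * indicator half_open_cube \<omega> \<partial>lborel)"
      by (rule nn_integral_mono) (auto simp: Q_def indicator_def)
    then show ?thesis by (simp add: nn_integral_fiber_energy le_less_trans)
  qed
  have W_fin: "?W < \<infinity>"
  proof -
    have "?W \<le> (\<integral>\<^sup>+\<omega>. fiber_energy w \<omega> * indicator half_open_cube \<omega> \<partial>lborel)"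
      by (rule nn_integral_mono) (auto simp: indicator_def)
    then show ?thesis by (simp add: nn_integral_fiber_energy le_less_trans)
  qed
  obtain x y where xy: "norm x \<le> norm y"
      "AE\<^sub>Q \<omega>. fiber x \<omega> = (if \<omega> \<in> A then fiber u \<omega> else fiber w \<omega>)"
      "AE\<^sub>Q \<omega>. fiber y \<omega> = (if \<omega> \<in> A then fiber v \<omega> else fiber w \<omega>)"
    using loc[of A] by auto
  have "ennreal ((norm x)\<^sup>2) \<le> ennreal ((norm y)\<^sup>2)"
    using xy(1) by (intro ennreal_leI power_mono) auto
  then have "?I u + ?W \<le> ?I v + ?W"
    unfolding nn_integral_glued_energy[OF _ xy(2), simplified] nn_integral_glued_energy[OF _ xy(3), simplified] Q_def .
  then have le: "?I u \<le> ?I v" using W_fin by (auto simp: ennreal_add_left_cancel_le add.commute[of _ ?W])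
  have "(\<integral>\<^sup>+\<omega>. fiber_energy u \<omega> * indicator Q \<omega> - fiber_energy v \<omega> * indicator Q \<omega> \<partial>lborel) = ?I u - ?I v"
    by (rule nn_integral_diff) (use fin[of v] in \<open>auto simp: Q_def A_def indicator_def\<close>)
  also have "\<dots> = 0" using le fin[of u] by (simp add: diff_eq_0_iff_ennreal)
  finally have "AE \<omega> in lborel. fiber_energy u \<omega> * indicator Q \<omega> - fiber_energy v \<omega> * indicator Q \<omega> = 0"
    by (subst (asm) nn_integral_0_iff_AE) auto
  then show ?thesis
    using AE_fiber_energy[of u] AE_fiber_energy[of v] AE_fiber_energy_finite[of v]
  proof eventually_elim
    case (elim \<omega>)
    show ?case
    proof
      assume \<omega>: "\<omega> \<in> half_open_cube"
      have "fiber_energy u \<omega> \<le> fiber_energy v \<omega>"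
      proof (cases "\<omega> \<in> A")
        case True
        then have "fiber_energy u \<omega> - fiber_energy v \<omega> = 0" using elim(1) \<omega> by (simp add: Q_def)
        then show ?thesis using elim(4) \<omega> True by (simp add: A_def ennreal_minus_eq_0)
      qed (auto simp: A_def)
      then have "(norm (fiber u \<omega>))\<^sup>2 \<le> (norm (fiber v \<omega>))\<^sup>2" using elim(2,3) \<omega> by simp
      then show "norm (fiber u \<omega>) \<le> norm (fiber v \<omega>)" by (rule power2_le_imp_le) simp
    qed
  qed
qed

section \<open>Projections and a countable dense set of sequences\<close>

text \<open>
  One Gram--Schmidt step: a new generator \<open>b\<close> is replaced by its component \<open>e\<close> orthogonal to the span
  of the old ones, and the projection gains the multiple of \<open>e\<close> prescribed by \<open>u\<close>.
\<close>

lemma projection_on_span_exists: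
  fixes u :: "'a::complex_inner"
  assumes "finite B"
  shows "\<exists>p\<in>cspan B. \<forall>s\<in>cspan B. cinner (u - p) s = 0"
  using assms
proof (induction B arbitrary: u rule: finite_induct)
  case empty
  then show ?case by simp
next
  case (insert b B)
  obtain q where q: "q \<in> cspan B" "\<And>s. s \<in> cspan B \<Longrightarrow> cinner (b - q) s = 0"
    using insert.IH[of b] by blast
  obtain p where p: "p \<in> cspan B" "\<And>s. s \<in> cspan B \<Longrightarrow> cinner (u - p) s = 0"
    using insert.IH[of u] by blast
  define e where "e = b - q"
  define c where "c = cinner (u - p) e / cinner e e"
  have e_perp: "cinner s e = 0" if "s \<in> cspan B" for s
    using q(2)[OF that] by (subst cinner_commute) (simp add: e_def)
  have ins: "cspan B \<subseteq> cspan (insert b B)"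
    by (rule complex_vector.span_mono) auto
  have e_in: "e \<in> cspan (insert b B)"
    unfolding e_def using q(1) ins by (intro complex_vector.span_diff) (auto intro: complex_vector.span_base)
  show ?case
  proof (intro bexI ballI)
    show "p + c *\<^sub>C e \<in> cspan (insert b B)"
      using p(1) ins e_in by (intro complex_vector.span_add complex_vector.span_scale) auto
    fix s assume "s \<in> cspan (insert b B)"
    then obtain k where k: "s - k *\<^sub>C b \<in> cspan B"
      by (auto simp: complex_vector.span_insert)
    define t where "t = s - k *\<^sub>C e"
    have "t = (s - k *\<^sub>C b) + k *\<^sub>C q" by (simp add: t_def e_def scaleC_diff_right)
    then have t: "t \<in> cspan B"
      using k q(1) by (simp add: complex_vector.span_add complex_vector.span_scale)
    have et: "cinner e t = 0" using q(2)[OF t] by (simp add: e_def)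
    have "cinner (u - (p + c *\<^sub>C e)) e = 0"
    proof (cases "e = 0")
      case False
      then have "cinner e e \<noteq> 0" by (simp add: cinner_self)
      then show ?thesis
        by (simp add: c_def diff_diff_eq[symmetric] cinner_diff_left[of "u - p"] cinner_scaleC_left)
    qed simp
    moreover have "cinner (u - (p + c *\<^sub>C e)) t = 0"
      using p(2)[OF t] et by (simp add: diff_diff_eq[symmetric] cinner_diff_left[of "u - p"] cinner_scaleC_left)
    moreover have "s = t + k *\<^sub>C e" by (simp add: t_def)
    ultimately show "cinner (u - (p + c *\<^sub>C e)) s = 0"
      by (simp add: cinner_add_right cinner_scaleC_right)
  qed
qed

lemma orthogonal_projection:
  fixes S :: "'a::complex_inner set"
  assumes "finite_dimensional S"
  shows "orthogonal_projection S u \<in> S"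
    and "s \<in> S \<Longrightarrow> cinner (u - orthogonal_projection S u) s = 0"
proof -
  obtain B where B: "finite B" "cspan B = S"
    using assms unfolding finite_dimensional_def by blast
  have "\<exists>!p. p \<in> S \<and> (\<forall>s\<in>S. cinner (u - p) s = 0)"
  proof (rule ex_ex1I)
    show "\<exists>p. p \<in> S \<and> (\<forall>s\<in>S. cinner (u - p) s = 0)"
      using projection_on_span_exists[OF B(1), of u] unfolding B(2) by blast
    fix p q assume p: "p \<in> S \<and> (\<forall>s\<in>S. cinner (u - p) s = 0)" and q: "q \<in> S \<and> (\<forall>s\<in>S. cinner (u - q) s = 0)"
    have "p - q \<in> S" using p q unfolding B(2)[symmetric] by (auto intro: complex_vector.span_diff)
    then have "cinner ((u - q) - (u - p)) (p - q) = 0" using p q unfolding cinner_diff_left[of "u - q"] by simp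
    then show "p = q" by (simp add: cinner_self)
  qed
  from theI'[OF this]
  show "orthogonal_projection S u \<in> S" "s \<in> S \<Longrightarrow> cinner (u - orthogonal_projection S u) s = 0"
    unfolding orthogonal_projection_def by blast+
qed

lemma finite_dimensional_subspace: "finite_dimensional S \<Longrightarrow> csubspace S"
  unfolding finite_dimensional_def by (metis complex_vector.subspace_span)

lemma orthogonal_projection_pythagoras:
  fixes S :: "'a::complex_inner set"
  assumes "finite_dimensional S" "a \<in> S"
  shows "(norm (u - a))\<^sup>2 = (norm (u - orthogonal_projection S u))\<^sup>2 + (norm (orthogonal_projection S u - a))\<^sup>2"
proof -
  define p where "p = orthogonal_projection S u"
  have "p - a \<in> S"
    using assms orthogonal_projection(1)[OF assms(1)] finite_dimensional_subspace
    by (auto simp: p_def intro: complex_vector.subspace_diff)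
  then have "inner (u - p) (p - a) = 0"
    using orthogonal_projection(2)[OF assms(1)] by (simp add: p_def inner_eq_Re_cinner)
  moreover have "u - a = (u - p) + (p - a)" by simp
  ultimately show ?thesis
    unfolding p_def[symmetric] power2_norm_eq_inner
    by (simp only: inner_add_left inner_add_right inner_commute[of "p - a" "u - p"])
qed

lemma norm_orthogonal_projection_diff_le:
  assumes "finite_dimensional S" "a \<in> S"
  shows "norm (orthogonal_projection S u - a) \<le> norm (u - a)"
    and "norm (u - orthogonal_projection S u) \<le> norm (u - a)"
  by (rule power2_le_imp_le; simp add: orthogonal_projection_pythagoras[OF assms, of u])+

lemma norm_orthogonal_projection_le:
  assumes "finite_dimensional S"
  shows "norm (orthogonal_projection S u) \<le> norm u"
  using norm_orthogonal_projection_diff_le(1)[OF assms, of 0 u] finite_dimensional_subspace[OF assms]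
  by (simp add: complex_vector.subspace_0)

text \<open>
  Finite-dimensional subspaces are closed: no vector of \<open>S\<close> is nearer to \<open>a\<close> than its projection.
\<close>

lemma finite_dimensional_approximable:
  assumes "finite_dimensional S" "\<And>e. e > 0 \<Longrightarrow> \<exists>t\<in>S. norm (a - t) < e"
  shows "a \<in> S"
proof (rule ccontr)
  assume "a \<notin> S"
  then have "norm (a - orthogonal_projection S a) > 0" using orthogonal_projection(1)[OF assms(1), of a] by auto
  from assms(2)[OF this] obtain t where "t \<in> S" "norm (a - t) < norm (a - orthogonal_projection S a)" by blast
  then show False using norm_orthogonal_projection_diff_le(2)[OF assms(1), of t a] by simp
qed

text \<open>
  The operator is linear on \<open>S\<close> only, so the induction over the span carries membership in \<open>S\<close> along.
\<close>

lemma finite_dimensional_image: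
  assumes "bounded_operator_on S A" "finite_dimensional S"
  shows "finite_dimensional (A ` S)"
proof -
  obtain B where B: "finite B" "cspan B = S"
    using assms(2) unfolding finite_dimensional_def by blast
  have sub: "csubspace S" by (rule finite_dimensional_subspace[OF assms(2)])
  have A: "\<And>x y. x \<in> S \<Longrightarrow> y \<in> S \<Longrightarrow> A (x + y) = A x + A y" "\<And>c x. x \<in> S \<Longrightarrow> A (c *\<^sub>C x) = c *\<^sub>C A x"
    using assms(1) unfolding bounded_operator_on_def by auto
  have A0: "A 0 = 0" using A(2)[of 0 0] complex_vector.subspace_0[OF sub] by simp
  have "x \<in> S \<and> A x \<in> cspan (A ` B)" if "x \<in> S" for x
    using that unfolding B(2)[symmetric]
  proof (induction rule: complex_vector.span_induct_alt)
    case base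
    then show ?case by (simp add: A0 complex_vector.span_zero)
  next
    case (step c x y)
    then have "x \<in> S" "y \<in> S" "c *\<^sub>C x \<in> S"
      using B(2) complex_vector.span_base[of x B] complex_vector.subspace_scale[OF sub] by auto
    then show ?case using step B(2) A complex_vector.subspace_add[OF sub]
      by (simp add: complex_vector.span_add complex_vector.span_scale complex_vector.span_base)
  qed
  moreover have "y \<in> A ` S" if "y \<in> cspan (A ` B)" for y
    using that
  proof (induction rule: complex_vector.span_induct_alt)
    case base
    show ?case using A0 complex_vector.subspace_0[OF sub] by force
  next
    case (step c x y)
    then obtain b s where bs: "b \<in> B" "x = A b" "s \<in> S" "y = A s" by auto
    have "b \<in> S" using bs(1) B(2) complex_vector.span_base[of b B] by auto
    then show ?case
      using bs A(1)[of "c *\<^sub>C b" s] A(2)[of b c] complex_vector.subspace_scale[OF sub, of b c]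
        complex_vector.subspace_add[OF sub, of "c *\<^sub>C b" s]
      by (intro image_eqI[of _ _ "c *\<^sub>C b + s"]) auto
  qed
  ultimately have "cspan (A ` B) = A ` S" by blast
  then show ?thesis using B(1) unfolding finite_dimensional_def by blast
qed

lift_definition ell2_unit :: "'i \<Rightarrow> 'i ell2" is "\<lambda>k j. if j = k then 1 else 0"
proof -
  fix k :: 'i
  have "(\<lambda>j. if j \<in> {k} then 1 else 0 :: real) summable_on UNIV"
    by (subst summable_on_cong_neutral[where T = "{k}" and g = "\<lambda>_. 1"]) auto
  then show "(\<lambda>j. (cmod (if j = k then 1 else 0))\<^sup>2) summable_on UNIV"
    by (rule back_subst[of "\<lambda>f. f summable_on UNIV"]) auto
qed

lemma cinner_ell2_unit: "cinner a (ell2_unit k) = Rep_ell2 a k"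
proof -
  have "cinner a (ell2_unit k) = (\<Sum>\<^sub>\<infinity>j. Rep_ell2 a j * cnj (if j = k then 1 else 0))"
    by (simp add: cinner_ell2.rep_eq ell2_unit.rep_eq)
  also have "\<dots> = (\<Sum>\<^sub>\<infinity>j\<in>{k}. Rep_ell2 a j)"
    by (rule infsum_cong_neutral) auto
  finally show ?thesis by simp
qed

lemma norm_ell2_unit [simp]: "norm (ell2_unit k) = 1"
proof -
  have "complex_of_real ((norm (ell2_unit k))\<^sup>2) = 1"
    unfolding cinner_self[symmetric] cinner_ell2_unit by (simp add: ell2_unit.rep_eq)
  then have "(norm (ell2_unit k))\<^sup>2 = 1" by (simp only: of_real_eq_1_iff)
  then show ?thesis unfolding power2_eq_1_iff using norm_ge_zero[of "ell2_unit k"] by linarith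
qed

definition finite_part :: "'i set \<Rightarrow> 'i ell2 \<Rightarrow> 'i ell2" where
  "finite_part K a = (\<Sum>k\<in>K. Rep_ell2 a k *\<^sub>C ell2_unit k)"

text \<open>
  The squared distance from \<open>a\<close> to its finite part is the tail of \<open>\<Sum>\<^sub>\<infinity>k. (cmod (Rep_ell2 a k))\<^sup>2\<close>.
\<close>

lemma ell2_finite_sum_approx:
  assumes "e > 0"
  obtains K where "finite K" "norm (a - finite_part K a) < e"
proof -
  define t where "t k = (cmod (Rep_ell2 a k))\<^sup>2" for k
  have norm_a: "(norm a)\<^sup>2 = (\<Sum>\<^sub>\<infinity>k. t k)"
    using ell2_cinner_self[of a] unfolding cinner_self t_def by (simp only: of_real_eq_iff)
  have "t summable_on UNIV" using Rep_ell2[of a] unfolding t_def by simp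
  moreover have "e\<^sup>2 / 2 > 0" using assms by simp
  ultimately obtain K where K: "finite K" "dist (sum t K) (\<Sum>\<^sub>\<infinity>k. t k) \<le> e\<^sup>2 / 2"
    using infsum_finite_approximation[of t UNIV] by blast
  define s where "s = finite_part K a"
  have sum_right: "cinner x (finite_part F a) = (\<Sum>k\<in>F. cnj (Rep_ell2 a k) * Rep_ell2 x k)"
    if "finite F" for x F
    using that by (induction F rule: finite_induct) (auto simp: finite_part_def cinner_add_right cinner_scaleC_right cinner_ell2_unit)
  have Rep_s: "Rep_ell2 (finite_part F a) j = (if j \<in> F then Rep_ell2 a j else 0)" if "finite F" for F j
    using that by (induction F rule: finite_induct)
      (auto simp: finite_part_def zero_ell2.rep_eq plus_ell2.rep_eq scaleC_ell2.rep_eq ell2_unit.rep_eq)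
  have as: "cinner a s = complex_of_real (sum t K)"
    unfolding s_def sum_right[OF K(1)] by (simp add: t_def complex_norm_square mult.commute del: of_real_power)
  have ss: "cinner s s = complex_of_real (sum t K)"
    by (subst (2) s_def, subst sum_right[OF K(1)])
       (simp add: s_def Rep_s[OF K(1)] t_def complex_norm_square mult.commute del: of_real_power)
  have sa: "cinner s a = complex_of_real (sum t K)" by (subst cinner_commute) (simp add: as)
  have "complex_of_real ((norm (a - s))\<^sup>2) = complex_of_real ((norm a)\<^sup>2 - sum t K)"
    unfolding cinner_self[symmetric] cinner_diff_left cinner_diff_right as ss sa
    by (simp add: cinner_self)
  then have "(norm (a - s))\<^sup>2 = (\<Sum>\<^sub>\<infinity>k. t k) - sum t K" unfolding norm_a by (simp only: of_real_eq_iff)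
  also have "\<dots> < e\<^sup>2" using K(2) zero_less_power[OF assms, of 2] unfolding dist_real_def by linarith
  finally have "norm (a - s) < e" by (rule power_less_imp_less_base) (use assms in simp)
  then show ?thesis using K(1) that unfolding s_def by blast
qed

lemma complex_rational_approx:
  assumes "e > 0"
  obtains p q :: rat where "cmod (z - Complex (of_rat p) (of_rat q)) < e"
proof -
  obtain p :: rat where p: "Re z - e / 2 < of_rat p" "of_rat p < Re z"
    using of_rat_dense[of "Re z - e / 2" "Re z"] assms by auto
  obtain q :: rat where q: "Im z - e / 2 < of_rat q" "of_rat q < Im z"
    using of_rat_dense[of "Im z - e / 2" "Im z"] assms by auto
  have "cmod (z - Complex (of_rat p) (of_rat q)) \<le> \<bar>Re z - of_rat p\<bar> + \<bar>Im z - of_rat q\<bar>"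
    using cmod_le[of "z - Complex (of_rat p) (of_rat q)"] by simp
  also have "\<dots> < e" using p q by linarith
  finally show ?thesis by (rule that)
qed

text \<open>
  Coding combinations by lists over a countable type makes their countability a matter of type classes.
\<close>

definition rational_combination :: "('i \<times> rat \<times> rat) list \<Rightarrow> 'i ell2" where
  "rational_combination xs = (\<Sum>(k, p, q)\<leftarrow>xs. Complex (of_rat p) (of_rat q) *\<^sub>C ell2_unit k)"

lemma rational_combination_dense:
  assumes "e > 0"
  shows "\<exists>xs. norm (a - rational_combination xs) < e"
proof -
  obtain K where K: "finite K" "norm (a - finite_part K a) < e / 2"
    using ell2_finite_sum_approx[of "e / 2" a] assms by auto
  have "\<exists>xs. norm (finite_part K a - rational_combination xs) < d" if "d > 0" for d
    using K(1) that
  proof (induction K arbitrary: d rule: finite_induct)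
    case empty
    then show ?case by (intro exI[of _ "[]"]) (simp add: finite_part_def rational_combination_def)
  next
    case (insert k K)
    obtain xs where xs: "norm (finite_part K a - rational_combination xs) < d / 2"
      using insert.IH[of "d / 2"] insert.prems by auto
    obtain p q where pq: "cmod (Rep_ell2 a k - Complex (of_rat p) (of_rat q)) < d / 2"
      using complex_rational_approx[of "d / 2"] insert.prems by (metis half_gt_zero)
    have "finite_part (insert k K) a - rational_combination ((k, p, q) # xs)
       = (Rep_ell2 a k - Complex (of_rat p) (of_rat q)) *\<^sub>C ell2_unit k +
         (finite_part K a - rational_combination xs)"
      using insert.hyps by (simp add: finite_part_def rational_combination_def complex_vector.scale_left_diff_distrib)
    also have "norm \<dots> < d"
      using xs pq by (intro norm_triangle_lt) simp
    finally show ?case by blast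
  qed
  from this[of "e / 2"] obtain xs where
    "norm (finite_part K a - rational_combination xs) < e / 2" using assms by auto
  then have "norm (a - rational_combination xs) < e"
    using K(2) norm_triangle_lt[of "a - finite_part K a"
        "finite_part K a - rational_combination xs" e] by simp
  then show ?thesis by blast
qed

lemma projected_combinations_dense:
  fixes S :: "'i ell2 set"
  assumes "finite_dimensional S" "a \<in> S"
  obtains x where "(\<lambda>n. orthogonal_projection S (rational_combination (x n))) \<longlonglongrightarrow> a"
proof -
  have "\<exists>xs. norm (a - rational_combination xs) < 1 / real (Suc n)" for n
    by (rule rational_combination_dense) simp
  then obtain x where x: "\<And>n. norm (a - rational_combination (x n)) < 1 / real (Suc n)" by metis
  have "norm (orthogonal_projection S (rational_combination (x n)) - a) \<le> 1 / real (Suc n)" for n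
    using norm_orthogonal_projection_diff_le(1)[OF assms, of "rational_combination (x n)"] x[of n]
    by (simp add: norm_minus_commute)
  then have "\<forall>n. norm (orthogonal_projection S (rational_combination (x n)) - a) \<le> 1 / real (Suc n)" ..
  then have "(\<lambda>n. orthogonal_projection S (rational_combination (x n)) - a) \<longlonglongrightarrow> 0"
    by (rule Lim_null_comparison[OF always_eventually LIMSEQ_Suc[OF lim_1_over_n]])
  then show ?thesis by (rule that[OF LIM_zero_cancel])
qed

section \<open>Operators that act fiber by fiber\<close>

lemma bounded_operator_on_imp:
  assumes "bounded_operator_on S A" "csubspace S"
  obtains K where "bounded_linear_on S A K"
proof -
  obtain K where "\<forall>x\<in>S. norm (A x) \<le> K * norm x" using assms(1) unfolding bounded_operator_on_def by blast
  then have "bounded_linear_on S A K"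
    using assms csubspace_imp_subspace[OF assms(2)]
    unfolding bounded_operator_on_def bounded_linear_on_def by (metis scaleC_of_real)
  then show ?thesis by (rule that)
qed

lemma bounded_operator_on_inverse:
  assumes "bounded_operator_on S A" "csubspace S" "bij_betw A S S"
    and "C > 0" "\<And>x. x \<in> S \<Longrightarrow> C * norm x \<le> norm (A x)"
  shows "bounded_operator_on S (inv_into S A)"
proof -
  have im: "A ` S = S" and inj: "inj_on A S" using assms(3) by (auto simp: bij_betw_def)
  have inS: "inv_into S A y \<in> S" if "y \<in> S" for y using inv_into_into[of y A S] that im by simp
  have A_inv: "A (inv_into S A y) = y" if "y \<in> S" for y using f_inv_into_f[of y A S] that im by simp
  have eq: "inv_into S A y = x" if "x \<in> S" "A x = y" for x y
    using inv_into_f_f[OF inj that(1)] that(2) by simp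
  have A: "\<And>x y. x \<in> S \<Longrightarrow> y \<in> S \<Longrightarrow> A (x + y) = A x + A y" "\<And>c x. x \<in> S \<Longrightarrow> A (c *\<^sub>C x) = c *\<^sub>C A x"
    using assms(1) unfolding bounded_operator_on_def by auto
  show ?thesis
    unfolding bounded_operator_on_def
  proof (intro conjI ballI allI)
    show "inv_into S A x \<in> S" if "x \<in> S" for x by (rule inS[OF that])
    show "inv_into S A (x + y) = inv_into S A x + inv_into S A y" if "x \<in> S" "y \<in> S" for x y
      using that inS A A_inv complex_vector.subspace_add[OF assms(2)] by (intro eq) auto
    show "inv_into S A (c *\<^sub>C x) = c *\<^sub>C inv_into S A x" if "x \<in> S" for c x
      using that inS A A_inv complex_vector.subspace_scale[OF assms(2)] by (intro eq) auto
    show "\<exists>K. \<forall>x\<in>S. norm (inv_into S A x) \<le> K * norm x"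
    proof (intro exI ballI)
      fix x assume "x \<in> S"
      then show "norm (inv_into S A x) \<le> (1 / C) * norm x"
        using assms(5)[OF inS[OF \<open>x \<in> S\<close>]] A_inv[OF \<open>x \<in> S\<close>] assms(4) by (simp add: field_simps)
    qed
  qed
qed

text \<open>
  If \<open>L g = f\<close> then \<open>L (shift k g) = shift k f\<close>, and injectivity reads this backwards.
\<close>

lemma shift_preserving_inverse:
  assumes V: "shift_invariant V" and L: "shift_preserving V L" and bij: "bij_betw L V V"
    and bdd: "bounded_operator_on V (inv_into V L)"
  shows "shift_preserving V (inv_into V L)"
  unfolding shift_preserving_def
proof (intro conjI allI ballI bdd)
  fix k f assume "f \<in> V"
  have im: "L ` V = V" and inj: "inj_on L V" using bij by (auto simp: bij_betw_def)
  have g: "inv_into V L f \<in> V" "L (inv_into V L f) = f"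
    using inv_into_into[of f L V] f_inv_into_f[of f L V] \<open>f \<in> V\<close> im by auto
  have "L (shift k (inv_into V L f)) = shift k f"
    using L g unfolding shift_preserving_def by simp
  moreover have "shift k (inv_into V L f) \<in> V" using V g(1) unfolding shift_invariant_def by blast
  ultimately show "inv_into V L (shift k f) = shift k (inv_into V L f)"
    using inv_into_f_f[OF inj] by metis
qed

lemma AE_fiber_zero: "AE\<^sub>Q \<omega>. fiber 0 \<omega> = 0"
  using AE_fiber_scaleC[of 0 0] by eventually_elim simp

lemma norm_le_of_fiber_norm_le:
  assumes "AE\<^sub>Q \<omega>. norm (fiber f \<omega>) \<le> norm (fiber g \<omega>)"
  shows "norm f \<le> norm g"
proof -
  have "ennreal ((norm f)\<^sup>2) \<le> ennreal ((norm g)\<^sup>2)"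
    unfolding nn_integral_fiber_energy[symmetric]
  proof (rule nn_integral_mono_AE)
    show "AE \<omega> in lborel. fiber_energy f \<omega> * indicator half_open_cube \<omega> \<le> fiber_energy g \<omega> * indicator half_open_cube \<omega>"
      using AE_fiber_energy[of f] AE_fiber_energy[of g] assms
    proof eventually_elim
      case (elim \<omega>)
      show ?case
      proof (cases "\<omega> \<in> half_open_cube")
        case True
        then have "(norm (fiber f \<omega>))\<^sup>2 \<le> (norm (fiber g \<omega>))\<^sup>2" using elim(3) by (intro power_mono) auto
        then show ?thesis using elim(1,2) True by (simp add: ennreal_leI)
      qed simp
    qed
  qed
  then have "(norm f)\<^sup>2 \<le> (norm g)\<^sup>2" by simp
  then show ?thesis by (rule power2_le_imp_le) simp
qed

text \<open>
  The setting of the theorem.  Null sets are those of \<open>lborel\<close>, so that Borel measurable representatives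
  can be used throughout.
\<close>

locale range_operator =
  fixes V :: "(real ^ 'd::finite) L2 set"
    and J :: "real ^ 'd \<Rightarrow> (int ^ 'd) ell2 set"
    and L :: "(real ^ 'd) L2 \<Rightarrow> (real ^ 'd) L2"
    and R :: "real ^ 'd \<Rightarrow> (int ^ 'd) ell2 \<Rightarrow> (int ^ 'd) ell2"
  assumes closed_V: "closed_subspace V"
    and range_function: "is_range_function V J"
    and finite_dim: "AE\<^sub>Q \<omega>. finite_dimensional (J \<omega>)"
    and bounded_L: "bounded_operator_on V L"
    and range_operator_R: "is_range_operator V J L R"
begin

abbreviation projected :: "real ^ 'd \<Rightarrow> ((int ^ 'd) \<times> rat \<times> rat) list \<Rightarrow> (int ^ 'd) ell2" where
  "projected \<omega> xs \<equiv> orthogonal_projection (J \<omega>) (rational_combination xs)"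

lemma V_iff: "f \<in> V \<longleftrightarrow> (AE\<^sub>Q \<omega>. fiber f \<omega> \<in> J \<omega>)"
  using range_function unfolding is_range_function_def AE_half_open_cube_iff by blast

lemma subspace_V: "csubspace V" and closed: "closed V"
  using closed_V by (auto simp: closed_subspace_def)

lemma subspace_J: "\<omega> \<in> half_open_cube \<Longrightarrow> csubspace (J \<omega>)"
  using range_function by (auto simp: is_range_function_def measurable_range_function_def closed_subspace_def)

lemma bounded_R: "\<omega> \<in> half_open_cube \<Longrightarrow> bounded_operator_on (J \<omega>) (R \<omega>)"
  using range_operator_R by (auto simp: is_range_operator_def)

lemma fiber_L: "f \<in> V \<Longrightarrow> AE\<^sub>Q \<omega>. fiber (L f) \<omega> = R \<omega> (fiber f \<omega>)"
  using range_operator_R unfolding is_range_operator_def AE_half_open_cube_iff by blast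

lemma L_in: "f \<in> V \<Longrightarrow> L f \<in> V"
  using bounded_L by (simp add: bounded_operator_on_def)

lemma R_tendsto:
  assumes "\<omega> \<in> half_open_cube" "\<And>n. x n \<in> J \<omega>" "a \<in> J \<omega>" "x \<longlonglongrightarrow> a"
  shows "(\<lambda>n. R \<omega> (x n)) \<longlonglongrightarrow> R \<omega> a"
proof -
  obtain K where "bounded_linear_on (J \<omega>) (R \<omega>) K"
    using bounded_operator_on_imp[OF bounded_R subspace_J] assms(1) by blast
  then show ?thesis using bounded_linear_on.tendsto assms(2-4) by blast
qed

lemma measurable_field_projected: "measurable_field (\<lambda>\<omega>. orthogonal_projection (J \<omega>) u)"
  unfolding measurable_field_def
proof
  fix k
  have "(\<lambda>\<omega>. cinner (orthogonal_projection (J \<omega>) u) (ell2_unit k)) \<in> borel_measurable (lebesgue_on half_open_cube)"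
    using range_function by (simp add: is_range_function_def measurable_range_function_def)
  then show "\<exists>\<psi>\<in>borel_measurable borel. AE\<^sub>Q \<omega>. Rep_ell2 (orthogonal_projection (J \<omega>) u) k = \<psi> \<omega>"
    unfolding cinner_ell2_unit by (rule lebesgue_on_cube_ex_borel)
qed

text \<open>
  Measurability of the range function says that the projections of \<open>u\<close> form a measurable field;
  their norms are at most \<open>norm u\<close> and the cube has finite measure.
\<close>

lemma projected_section:
  obtains f where "f \<in> V" "AE\<^sub>Q \<omega>. fiber f \<omega> = orthogonal_projection (J \<omega>) u"
proof -
  have bound: "AE\<^sub>Q \<omega>. ennreal ((norm (orthogonal_projection (J \<omega>) u))\<^sup>2) \<le> ennreal ((norm u)\<^sup>2)"
    using finite_dim by eventually_elim (auto intro!: ennreal_leI power_mono norm_orthogonal_projection_le)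
  have "(\<integral>\<^sup>+\<omega>. ennreal ((norm u)\<^sup>2) * indicator (half_open_cube :: (real^'d) set) \<omega> \<partial>lborel) < \<infinity>"
    using emeasure_half_open_cube_finite[where 'd = 'd] by (simp add: nn_integral_cmult_indicator ennreal_mult_less_top)
  then obtain f where f: "AE\<^sub>Q \<omega>. fiber f \<omega> = orthogonal_projection (J \<omega>) u"
    using fiber_surjective[OF measurable_field_projected _ bound] by auto
  have "AE\<^sub>Q \<omega>. fiber f \<omega> \<in> J \<omega>"
    using f finite_dim by eventually_elim (simp add: orthogonal_projection(1))
  then show ?thesis using f that V_iff by blast
qed

text \<open>
  Cutting off commutes with \<open>L\<close>, because \<open>R \<omega>\<close> fixes \<open>0\<close>.
\<close>

lemma cut_off_section:
  assumes "f \<in> V" "A \<in> sets borel"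
  obtains f' where "f' \<in> V" "AE\<^sub>Q \<omega>. fiber f' \<omega> = (if \<omega> \<in> A then fiber f \<omega> else 0)"
    "AE\<^sub>Q \<omega>. fiber (L f') \<omega> = (if \<omega> \<in> A then fiber (L f) \<omega> else 0)"
proof -
  obtain f' where "AE\<^sub>Q \<omega>. fiber f' \<omega> = (if \<omega> \<in> A then fiber f \<omega> else fiber 0 \<omega>)"
    using fiber_glue[OF assms(2), of f 0] by blast
  then have f': "AE\<^sub>Q \<omega>. fiber f' \<omega> = (if \<omega> \<in> A then fiber f \<omega> else 0)"
    using AE_fiber_zero by eventually_elim auto
  have "AE\<^sub>Q \<omega>. fiber f' \<omega> \<in> J \<omega>"
    using f' assms(1)[unfolded V_iff]
    by eventually_elim (auto simp: complex_vector.subspace_0[OF subspace_J])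
  then have V': "f' \<in> V" unfolding V_iff .
  have "AE\<^sub>Q \<omega>. fiber (L f') \<omega> = (if \<omega> \<in> A then fiber (L f) \<omega> else 0)"
    using f' fiber_L[OF V'] fiber_L[OF assms(1)]
  proof eventually_elim
    case (elim \<omega>)
    have "R \<omega> 0 = 0" if "\<omega> \<in> half_open_cube"
      using bounded_operator_on_imp[OF bounded_R subspace_J] that bounded_linear_on.zero by blast
    then show ?case using elim by auto
  qed
  then show ?thesis using that V' f' by blast
qed

lemma AE_all_projected:
  assumes "\<And>f. f \<in> V \<Longrightarrow> AE\<^sub>Q \<omega>. P \<omega> (fiber f \<omega>)"
  shows "AE\<^sub>Q \<omega>. (\<forall>xs. P \<omega> (projected \<omega> xs))"
proof -
  have "AE\<^sub>Q \<omega>. P \<omega> (projected \<omega> xs)" for xs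
  proof -
    obtain f where "f \<in> V" "AE\<^sub>Q \<omega>. fiber f \<omega> = projected \<omega> xs"
      by (rule projected_section)
    then show ?thesis using assms[of f] by (auto elim: eventually_elim2)
  qed
  then have "AE \<omega> in lborel. \<forall>xs. \<omega> \<in> half_open_cube \<longrightarrow> P \<omega> (projected \<omega> xs)"
    by (subst AE_all_countable) blast
  then show ?thesis by eventually_elim auto
qed

lemma projected_dense:
  assumes "\<omega> \<in> half_open_cube" "finite_dimensional (J \<omega>)" "a \<in> J \<omega>"
  obtains x where "(\<lambda>n. projected \<omega> (x n)) \<longlonglongrightarrow> a" "(\<lambda>n. R \<omega> (projected \<omega> (x n))) \<longlonglongrightarrow> R \<omega> a"
proof -
  obtain x where x: "(\<lambda>n. projected \<omega> (x n)) \<longlonglongrightarrow> a"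
    using projected_combinations_dense[OF assms(2,3)] by blast
  then have "(\<lambda>n. R \<omega> (projected \<omega> (x n))) \<longlonglongrightarrow> R \<omega> a"
    by (intro R_tendsto assms orthogonal_projection(1))
  then show ?thesis using x that by blast
qed

text \<open>
  Localisation compares \<open>C *\<^sub>C g\<close> with \<open>L g\<close>, cut off to an arbitrary Borel set; density passes from
  fibers of elements of \<open>V\<close> to all vectors of \<open>J \<omega>\<close>.
\<close>

lemma fibers_bounded_below:
  assumes "C > 0" and below: "\<And>f. f \<in> V \<Longrightarrow> C * norm f \<le> norm (L f)"
  shows "AE\<^sub>Q \<omega>. (\<forall>a\<in>J \<omega>. C * norm a \<le> norm (R \<omega> a))"
proof -
  have "AE\<^sub>Q \<omega>. C * norm (fiber g \<omega>) \<le> norm (R \<omega> (fiber g \<omega>))" if g: "g \<in> V" for g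
  proof -
    have "AE\<^sub>Q \<omega>. norm (fiber (complex_of_real C *\<^sub>C g) \<omega>) \<le> norm (fiber (L g) \<omega>)"
    proof (rule fiber_norm_le_of_localized[where w = 0])
      fix A :: "(real^'d) set" assume A: "A \<in> sets borel"
      obtain g' where g': "g' \<in> V" "AE\<^sub>Q \<omega>. fiber g' \<omega> = (if \<omega> \<in> A then fiber g \<omega> else 0)"
        "AE\<^sub>Q \<omega>. fiber (L g') \<omega> = (if \<omega> \<in> A then fiber (L g) \<omega> else 0)"
        using cut_off_section[OF g A] by blast
      show "\<exists>x y. norm x \<le> norm y \<and>
        (AE\<^sub>Q \<omega>. fiber x \<omega> = (if \<omega> \<in> A then fiber (complex_of_real C *\<^sub>C g) \<omega> else fiber 0 \<omega>)) \<and>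
        (AE\<^sub>Q \<omega>. fiber y \<omega> = (if \<omega> \<in> A then fiber (L g) \<omega> else fiber 0 \<omega>))"
      proof (intro exI conjI)
        show "norm (complex_of_real C *\<^sub>C g') \<le> norm (L g')" using below[OF g'(1)] \<open>C > 0\<close> by simp
        show "AE\<^sub>Q \<omega>. fiber (complex_of_real C *\<^sub>C g') \<omega>
            = (if \<omega> \<in> A then fiber (complex_of_real C *\<^sub>C g) \<omega> else fiber 0 \<omega>)"
          using g'(2) AE_fiber_scaleC[of "complex_of_real C" g'] AE_fiber_scaleC[of "complex_of_real C" g] AE_fiber_zero
          by eventually_elim auto
        show "AE\<^sub>Q \<omega>. fiber (L g') \<omega> = (if \<omega> \<in> A then fiber (L g) \<omega> else fiber 0 \<omega>)"
          using g'(3) AE_fiber_zero by eventually_elim auto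
      qed
    qed
    then show ?thesis
      using AE_fiber_scaleC[of "complex_of_real C" g] fiber_L[OF g]
      by eventually_elim (use \<open>C > 0\<close> in auto)
  qed
  then have "AE\<^sub>Q \<omega>. (\<forall>xs. C * norm (projected \<omega> xs) \<le> norm (R \<omega> (projected \<omega> xs)))"
    by (rule AE_all_projected)
  then show ?thesis
    using finite_dim
  proof eventually_elim
    case (elim \<omega>)
    show ?case
    proof (intro impI ballI)
      fix a assume \<omega>: "\<omega> \<in> half_open_cube" and a: "a \<in> J \<omega>"
      obtain x where x: "(\<lambda>n. projected \<omega> (x n)) \<longlonglongrightarrow> a" "(\<lambda>n. R \<omega> (projected \<omega> (x n))) \<longlonglongrightarrow> R \<omega> a"
        using projected_dense[OF \<omega> _ a] elim \<omega> by blast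
      show "C * norm a \<le> norm (R \<omega> a)"
      proof (rule LIMSEQ_le)
        show "(\<lambda>n. C * norm (projected \<omega> (x n))) \<longlonglongrightarrow> C * norm a" by (intro tendsto_intros x)
        show "(\<lambda>n. norm (R \<omega> (projected \<omega> (x n)))) \<longlonglongrightarrow> norm (R \<omega> a)" by (intro tendsto_intros x)
      qed (use elim \<omega> in auto)
    qed
  qed
qed

text \<open>
  Since \<open>L\<close> is onto, the projections of the dense set lie in the range of \<open>R \<omega>\<close>, which is closed because
  it has finite dimension.
\<close>

lemma fibers_surjective:
  assumes "L ` V = V"
  shows "AE\<^sub>Q \<omega>. R \<omega> ` J \<omega> = J \<omega>"
proof -
  have "AE\<^sub>Q \<omega>. fiber f \<omega> \<in> R \<omega> ` J \<omega>" if "f \<in> V" for f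
  proof -
    have "f \<in> L ` V" using assms that by simp
    then obtain g where g: "g \<in> V" "f = L g" by auto
    show ?thesis using fiber_L[OF g(1)] g(1)[unfolded V_iff] by eventually_elim (auto simp: g(2))
  qed
  then have "AE\<^sub>Q \<omega>. (\<forall>xs. projected \<omega> xs \<in> R \<omega> ` J \<omega>)"
    by (rule AE_all_projected)
  then show ?thesis
    using finite_dim
  proof eventually_elim
    case (elim \<omega>)
    show ?case
    proof
      assume \<omega>: "\<omega> \<in> half_open_cube"
      have fd: "finite_dimensional (J \<omega>)" using elim \<omega> by blast
      have "J \<omega> \<subseteq> R \<omega> ` J \<omega>"
      proof
        fix a assume a: "a \<in> J \<omega>"
        obtain x where x: "(\<lambda>n. projected \<omega> (x n)) \<longlonglongrightarrow> a" using projected_dense[OF \<omega> fd a] by blast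
        show "a \<in> R \<omega> ` J \<omega>"
        proof (rule finite_dimensional_approximable[OF finite_dimensional_image[OF bounded_R[OF \<omega>] fd]])
          fix e :: real assume "e > 0"
          then obtain n where "norm (projected \<omega> (x n) - a) < e" using LIMSEQ_D[OF x] by blast
          then show "\<exists>t\<in>R \<omega> ` J \<omega>. norm (a - t) < e"
            using elim(1) \<omega> by (intro bexI[of _ "projected \<omega> (x n)"]) (auto simp: norm_minus_commute)
        qed
      qed
      moreover have "R \<omega> ` J \<omega> \<subseteq> J \<omega>" using bounded_R[OF \<omega>] unfolding bounded_operator_on_def by blast
      ultimately show "R \<omega> ` J \<omega> = J \<omega>" by blast
    qed
  qed
qed

lemma L_bounded_below_of_fibers:
  assumes "C > 0" and below: "AE\<^sub>Q \<omega>. (\<forall>a\<in>J \<omega>. C * norm a \<le> norm (R \<omega> a))"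
    and f: "f \<in> V"
  shows "C * norm f \<le> norm (L f)"
proof -
  have "norm (complex_of_real C *\<^sub>C f) \<le> norm (L f)"
  proof (rule norm_le_of_fiber_norm_le)
    show "AE\<^sub>Q \<omega>. norm (fiber (complex_of_real C *\<^sub>C f) \<omega>) \<le> norm (fiber (L f) \<omega>)"
      using below AE_fiber_scaleC[of "complex_of_real C" f] fiber_L[OF f] f[unfolded V_iff]
      by eventually_elim (use \<open>C > 0\<close> in auto)
  qed
  then show ?thesis using \<open>C > 0\<close> by simp
qed

text \<open>
  Here the comparison is between \<open>h\<close> and \<open>h + L f'\<close> for a cut-off \<open>f'\<close> of \<open>f\<close>; outside the chosen set both
  have the fibers of \<open>h\<close>.
\<close>

lemma minimal_norm_fibers:
  assumes h: "h \<in> V" and min: "\<And>f. f \<in> V \<Longrightarrow> norm h \<le> norm (h + L f)"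
  shows "AE\<^sub>Q \<omega>. (\<forall>a\<in>J \<omega>. norm (fiber h \<omega>) \<le> norm (fiber h \<omega> + R \<omega> a))"
proof -
  have "AE\<^sub>Q \<omega>. norm (fiber h \<omega>) \<le> norm (fiber h \<omega> + R \<omega> (fiber f \<omega>))" if f: "f \<in> V" for f
  proof -
    have "AE\<^sub>Q \<omega>. norm (fiber h \<omega>) \<le> norm (fiber (h + L f) \<omega>)"
    proof (rule fiber_norm_le_of_localized[where w = h])
      fix A :: "(real^'d) set" assume A: "A \<in> sets borel"
      obtain f' where f': "f' \<in> V" "AE\<^sub>Q \<omega>. fiber f' \<omega> = (if \<omega> \<in> A then fiber f \<omega> else 0)"
        "AE\<^sub>Q \<omega>. fiber (L f') \<omega> = (if \<omega> \<in> A then fiber (L f) \<omega> else 0)"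
        using cut_off_section[OF f A] by blast
      show "\<exists>x y. norm x \<le> norm y \<and>
        (AE\<^sub>Q \<omega>. fiber x \<omega> = (if \<omega> \<in> A then fiber h \<omega> else fiber h \<omega>)) \<and>
        (AE\<^sub>Q \<omega>. fiber y \<omega> = (if \<omega> \<in> A then fiber (h + L f) \<omega> else fiber h \<omega>))"
      proof (intro exI conjI)
        show "norm h \<le> norm (h + L f')" by (rule min[OF f'(1)])
        show "AE\<^sub>Q \<omega>. fiber (h + L f') \<omega>
            = (if \<omega> \<in> A then fiber (h + L f) \<omega> else fiber h \<omega>)"
          using f'(3) AE_fiber_add[of h "L f'"] AE_fiber_add[of h "L f"] by eventually_elim auto
      qed simp
    qed
    then show ?thesis
      using AE_fiber_add[of h "L f"] fiber_L[OF f] by eventually_elim auto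
  qed
  then have "AE\<^sub>Q \<omega>. (\<forall>xs. norm (fiber h \<omega>) \<le> norm (fiber h \<omega> + R \<omega> (projected \<omega> xs)))"
    by (rule AE_all_projected)
  then show ?thesis
    using finite_dim
  proof eventually_elim
    case (elim \<omega>)
    show ?case
    proof (intro impI ballI)
      fix a assume \<omega>: "\<omega> \<in> half_open_cube" and a: "a \<in> J \<omega>"
      obtain x where x: "(\<lambda>n. R \<omega> (projected \<omega> (x n))) \<longlonglongrightarrow> R \<omega> a"
        using projected_dense[OF \<omega> _ a] elim \<omega> by blast
      show "norm (fiber h \<omega>) \<le> norm (fiber h \<omega> + R \<omega> a)"
      proof (rule LIMSEQ_le[OF tendsto_const])
        show "(\<lambda>n. norm (fiber h \<omega> + R \<omega> (projected \<omega> (x n)))) \<longlonglongrightarrow> norm (fiber h \<omega> + R \<omega> a)"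
          by (intro tendsto_intros x)
      qed (use elim \<omega> in auto)
    qed
  qed
qed

text \<open>
  Surjectivity: the difference \<open>h\<close> of \<open>y\<close> and its nearest point in the closed range has fibers that no
  \<open>R \<omega> a\<close> shortens.  As \<open>R \<omega>\<close> is onto, \<open>a\<close> can be chosen with \<open>R \<omega> a = - fiber h \<omega>\<close>.
\<close>

lemma L_bijective_of_fibers:
  assumes "C > 0" and below: "AE\<^sub>Q \<omega>. (\<forall>a\<in>J \<omega>. C * norm a \<le> norm (R \<omega> a))"
    and surj: "AE\<^sub>Q \<omega>. R \<omega> ` J \<omega> = J \<omega>"
  shows "bij_betw L V V"
proof -
  obtain K where lin: "bounded_linear_on V L K"
    using bounded_operator_on_imp[OF bounded_L subspace_V] by blast
  interpret L: bounded_linear_on V L K by (rule lin)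
  have below_L: "C * norm f \<le> norm (L f)" if "f \<in> V" for f
    by (rule L_bounded_below_of_fibers[OF assms(1) below that])
  have "inj_on L V"
  proof (rule inj_onI)
    fix f g assume fg: "f \<in> V" "g \<in> V" "L f = L g"
    then have "C * norm (f - g) \<le> norm (0 :: (real^'d) L2)"
      using below_L[of "f - g"] L.minus[of f g] subspace_diff[OF L.subspace] by simp
    then show "f = g" using assms(1) by (simp add: mult_le_0_iff)
  qed
  moreover have "V \<subseteq> L ` V"
  proof
    fix y assume y: "y \<in> V"
    have cl: "closed (L ` V)" by (rule closed_image_of_bounded_below[OF lin closed assms(1) below_L])
    obtain m where m: "m \<in> L ` V" "\<And>s. s \<in> L ` V \<Longrightarrow> norm (y - m) \<le> norm (y - s)"
      using nearest_point_exists[OF cl subspace_imp_convex[OF L.subspace_image], of y] subspace_0[OF L.subspace] by blast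
    define h where "h = y - m"
    have h: "h \<in> V" using y m(1) L_in subspace_diff[OF L.subspace] by (auto simp: h_def)
    have min: "norm h \<le> norm (h + L f)" if "f \<in> V" for f
    proof -
      have "m - L f \<in> L ` V" using m(1) that by (intro subspace_diff[OF L.subspace_image]) auto
      then show ?thesis using m(2)[of "m - L f"] by (simp add: h_def algebra_simps)
    qed
    have "AE\<^sub>Q \<omega>. (\<forall>a\<in>J \<omega>. norm (fiber h \<omega>) \<le> norm (fiber h \<omega> + R \<omega> a))"
      by (rule minimal_norm_fibers[OF h]) (rule min)
    then have "AE\<^sub>Q \<omega>. fiber h \<omega> = fiber 0 \<omega>"
      using surj h[unfolded V_iff] AE_fiber_zero
    proof eventually_elim
      case (elim \<omega>)
      show ?case
      proof
        assume \<omega>: "\<omega> \<in> half_open_cube"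
        then have "- fiber h \<omega> \<in> R \<omega> ` J \<omega>"
          using elim complex_vector.subspace_neg[OF subspace_J] by simp
        then obtain a where "a \<in> J \<omega>" "R \<omega> a = - fiber h \<omega>" by (metis imageE)
        then show "fiber h \<omega> = fiber 0 \<omega>" using elim(1,4) \<omega> by force
      qed
    qed
    then have "h = 0" by (rule fiber_eq_imp_eq)
    then show "y \<in> L ` V" using m(1) by (simp add: h_def)
  qed
  ultimately show ?thesis using L_in by (auto simp: bij_betw_def)
qed

lemma L_bounded_below:
  assumes "bij_betw L V V"
  obtains C where "C > 0" "\<And>f. f \<in> V \<Longrightarrow> C * norm f \<le> norm (L f)"
proof -
  obtain K where "bounded_linear_on V L K"
    using bounded_operator_on_imp[OF bounded_L subspace_V] by blast
  from bounded_inverse_on[OF this closed assms] show ?thesis using that by blast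
qed

lemma fiber_bijective:
  assumes "\<omega> \<in> half_open_cube" "C > 0" "\<forall>a\<in>J \<omega>. C * norm a \<le> norm (R \<omega> a)" "R \<omega> ` J \<omega> = J \<omega>"
  shows "bij_betw (R \<omega>) (J \<omega>) (J \<omega>)"
proof -
  obtain K where "bounded_linear_on (J \<omega>) (R \<omega>) K"
    using bounded_operator_on_imp[OF bounded_R subspace_J] assms(1) by blast
  then interpret R: bounded_linear_on "J \<omega>" "R \<omega>" K .
  have "inj_on (R \<omega>) (J \<omega>)"
  proof (rule inj_onI)
    fix a b assume ab: "a \<in> J \<omega>" "b \<in> J \<omega>" "R \<omega> a = R \<omega> b"
    then have "C * norm (a - b) \<le> norm (0 :: (int^'d) ell2)"
      using assms(3)[rule_format, of "a - b"] R.minus[of a b] subspace_diff[OF R.subspace] by simp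
    then show "a = b" using assms(2) by (simp add: mult_le_0_iff)
  qed
  then show ?thesis using assms(4) by (simp add: bij_betw_def)
qed

lemma L_bijective_iff:
  "bij_betw L V V \<longleftrightarrow>
     (AE\<^sub>Q \<omega>. bij_betw (R \<omega>) (J \<omega>) (J \<omega>)) \<and>
     (\<exists>C>0. AE\<^sub>Q \<omega>. (\<forall>a\<in>J \<omega>. C * norm a \<le> norm (R \<omega> a)))"
proof
  assume bij: "bij_betw L V V"
  obtain C where C: "C > 0" "\<And>f. f \<in> V \<Longrightarrow> C * norm f \<le> norm (L f)" using L_bounded_below[OF bij] by blast
  have im: "L ` V = V" using bij by (simp add: bij_betw_def)
  have below: "AE\<^sub>Q \<omega>. (\<forall>a\<in>J \<omega>. C * norm a \<le> norm (R \<omega> a))"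
    by (rule fibers_bounded_below[OF C])
  moreover have "AE\<^sub>Q \<omega>. bij_betw (R \<omega>) (J \<omega>) (J \<omega>)"
    using below fibers_surjective[OF im] by eventually_elim (use fiber_bijective C(1) in blast)
  ultimately show "(AE\<^sub>Q \<omega>. bij_betw (R \<omega>) (J \<omega>) (J \<omega>)) \<and>
     (\<exists>C>0. AE\<^sub>Q \<omega>. (\<forall>a\<in>J \<omega>. C * norm a \<le> norm (R \<omega> a)))"
    using C(1) by blast
next
  assume *: "(AE\<^sub>Q \<omega>. bij_betw (R \<omega>) (J \<omega>) (J \<omega>)) \<and>
     (\<exists>C>0. AE\<^sub>Q \<omega>. (\<forall>a\<in>J \<omega>. C * norm a \<le> norm (R \<omega> a)))"
  then obtain C where "C > 0" "AE\<^sub>Q \<omega>. (\<forall>a\<in>J \<omega>. C * norm a \<le> norm (R \<omega> a))" by blast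
  moreover have "AE\<^sub>Q \<omega>. R \<omega> ` J \<omega> = J \<omega>"
    using * by (auto simp: bij_betw_def elim: eventually_mono)
  ultimately show "bij_betw L V V" by (rule L_bijective_of_fibers)
qed

text \<open>
  Applying \<open>L\<close> after its inverse shows \<open>R \<omega> (R' \<omega> v) = v\<close> for the projections \<open>v\<close> of the dense set;
  both operators are continuous on \<open>J \<omega>\<close>.
\<close>

lemma inverse_range_operator:
  assumes bij: "bij_betw L V V" and inv: "bounded_operator_on V (inv_into V L)"
    and R': "is_range_operator V J (inv_into V L) R'"
  shows "AE\<^sub>Q \<omega>. (\<forall>a\<in>J \<omega>. inv_into (J \<omega>) (R \<omega>) a = R' \<omega> a)"
proof -
  interpret inv: range_operator V J "inv_into V L" R'
    by (rule range_operator.intro) (fact closed_V, fact range_function, fact finite_dim, fact inv, fact R')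
  have im: "L ` V = V" using bij by (simp add: bij_betw_def)
  have "AE\<^sub>Q \<omega>. R \<omega> (R' \<omega> (fiber f \<omega>)) = fiber f \<omega>" if f: "f \<in> V" for f
  proof -
    have g: "inv_into V L f \<in> V" "L (inv_into V L f) = f"
      using inv_into_into[of f L V] f_inv_into_f[of f L V] f im by auto
    show ?thesis using fiber_L[OF g(1)] inv.fiber_L[OF f] unfolding g(2) by eventually_elim auto
  qed
  then have "AE\<^sub>Q \<omega>. (\<forall>xs. R \<omega> (R' \<omega> (projected \<omega> xs)) = projected \<omega> xs)"
    by (rule AE_all_projected)
  moreover have "AE\<^sub>Q \<omega>. bij_betw (R \<omega>) (J \<omega>) (J \<omega>)"
    using bij L_bijective_iff by blast
  ultimately show ?thesis
    using finite_dim
  proof eventually_elim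
    case (elim \<omega>)
    show ?case
    proof (intro impI ballI)
      fix a assume \<omega>: "\<omega> \<in> half_open_cube" and a: "a \<in> J \<omega>"
      have fd: "finite_dimensional (J \<omega>)" using elim \<omega> by blast
      obtain x where x: "(\<lambda>n. projected \<omega> (x n)) \<longlonglongrightarrow> a" "(\<lambda>n. R' \<omega> (projected \<omega> (x n))) \<longlonglongrightarrow> R' \<omega> a"
        using inv.projected_dense[OF \<omega> fd a] by blast
      have in_J: "R' \<omega> b \<in> J \<omega>" if "b \<in> J \<omega>" for b
        using inv.bounded_R[OF \<omega>] that unfolding bounded_operator_on_def by blast
      have "(\<lambda>n. R \<omega> (R' \<omega> (projected \<omega> (x n)))) \<longlonglongrightarrow> R \<omega> (R' \<omega> a)"
        by (rule R_tendsto[OF \<omega> _ in_J[OF a] x(2)]) (intro in_J orthogonal_projection(1) fd)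
      then have "(\<lambda>n. projected \<omega> (x n)) \<longlonglongrightarrow> R \<omega> (R' \<omega> a)" using elim(1) \<omega> by simp
      then have "R \<omega> (R' \<omega> a) = a" using x(1) LIMSEQ_unique by blast
      moreover have "inj_on (R \<omega>) (J \<omega>)" using elim(2) \<omega> by (simp add: bij_betw_def)
      ultimately show "inv_into (J \<omega>) (R \<omega>) a = R' \<omega> a" using in_J[OF a] by (intro inv_into_f_eq)
    qed
  qed
qed

end

theorem theorem3p6:
  fixes V :: "(real ^ 'd::finite) L2 set"
    and J :: "real ^ 'd \<Rightarrow> (int ^ 'd) ell2 set"
    and L :: "(real ^ 'd) L2 \<Rightarrow> (real ^ 'd) L2"
    and R :: "real ^ 'd \<Rightarrow> (int ^ 'd) ell2 \<Rightarrow> (int ^ 'd) ell2"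
  assumes "shift_invariant V"
    and "is_range_function V J"
    and "AE \<omega> in lebesgue_on half_open_cube. finite_dimensional (J \<omega>)"
    and "shift_preserving V L"
    and "is_range_operator V J L R"
  shows "(invertible_on V L \<longrightarrow> shift_preserving V (inv_into V L))
    \<and> (invertible_on V L \<longleftrightarrow>
         (AE \<omega> in lebesgue_on half_open_cube. invertible_on (J \<omega>) (R \<omega>)) \<and>
         (\<exists>C>0. AE \<omega> in lebesgue_on half_open_cube. \<forall>a\<in>J \<omega>. norm (R \<omega> a) \<ge> C * norm a))
    \<and> (invertible_on V L \<longrightarrow>
         (\<forall>R'. is_range_operator V J (inv_into V L) R' \<longrightarrow>
            (AE \<omega> in lebesgue_on half_open_cube. \<forall>a\<in>J \<omega>. inv_into (J \<omega>) (R \<omega>) a = R' \<omega> a)))"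
proof -
  interpret range_operator V J L R
    using assms unfolding shift_invariant_def shift_preserving_def AE_half_open_cube_iff
    by unfold_locales auto
  have inv: "bounded_operator_on V (inv_into V L)" if "bij_betw L V V"
    using L_bounded_below[OF that] bounded_operator_on_inverse[OF bounded_L subspace_V that] by blast
  show ?thesis
    unfolding invertible_on_def AE_half_open_cube_iff
  proof (intro conjI impI allI)
    assume bij: "bij_betw L V V"
    show "shift_preserving V (inv_into V L)"
      by (rule shift_preserving_inverse[OF assms(1,4) bij inv[OF bij]])
  next
    fix R' assume bij: "bij_betw L V V" and R': "is_range_operator V J (inv_into V L) R'"
    show "AE\<^sub>Q \<omega>. (\<forall>a\<in>J \<omega>. inv_into (J \<omega>) (R \<omega>) a = R' \<omega> a)"
      by (rule inverse_range_operator[OF bij inv[OF bij] R'])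
  qed (rule L_bijective_iff)
qed

end
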